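(* Let $\varphi$ be a volume-preserving (and bounded) action of a group $G$ on $\mathbb{R}^d$. A unitary $G$-system $a$ associated with $\varphi$ is independent of $\xi$ if and only if it is of the form $$a_g(x)=e^{iS_g(x)},$$ where $S$ is a $1$-cocycle in $C^\bullet_\varphi(G,\mathcal{B})$. The corresponding operators are given by $$T_g^a\psi(x)=e^{iS_g(x)}\psi(\varphi_g^{-1}(x)).$$ Moreover, cocycles in the same cohomology class induce equivalent representations: if the first cohomology group $H^1_\varphi(G,\mathcal{B})$ of $C^\bullet_\varphi(G,\mathcal{B})$ vanishes, then all representations of the form $T_g^a\psi(x)=e^{iS_g(x)}\psi(\varphi_g^{-1}(x))$, with $S$ a $1$-cocycle, are equivalent to the trivial quantization $T_g\psi(x)=\psi(\varphi_g^{-1}(x))$.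
   Context: A volume-preserving (and bounded) action is a family of smooth diffeomorphisms $\varphi_g$ of $\mathbb{R}^d$, $g\in G$, with $\varphi_{gh}=\varphi_g\circ\varphi_h$ and $\varphi_e=\mathrm{id}$, such that for each $g$ all partial derivatives of $\varphi_g$ of order $\ge1$ are bounded on $\mathbb{R}^d$, and the Jacobian determinant satisfies $|\varphi_g'(x)|=1$ for all $x$. $S_{n}(1)$ is the set of families of smooth functions on $\mathbb{R}^n$, parametrized by $\hbar\in(0,\hbar_0]$ (dependence on $\hbar$ suppressed in the notation), which are bounded together with all their derivatives, uniformly in $\hbar$. For $a\in S_{2d}(1)$ and a diffeomorphism $\phi$ with bounded derivatives, $\mathrm{Op}(a,\phi)$ is the bounded operator on $L^2(\mathbb{R}^d)$ given by the oscillatory integral $$\mathrm{Op}(a,\phi)\psi(x)=\int\psi(\bar x)\,a(x,\bar\xi)\,e^{\frac{i}{\hbar}\langle\bar\xi,\phi^{-1}(x)-\bar x\rangle}\frac{d\bar\xi\,d\bar x}{(2\pi\hbar)^d}.$$ A unitary $G$-system associated with $\varphi$ is a map $a:G\to S_{2d}(1)$ such that the operators $T_g^a:=\mathrm{Op}(a_g,\varphi_g)$ form a unitary representation of $G$ by bounded operators on $L^2(\mathbb{R}^d)$. It is independent of $\xi$ if each $a_g(x,\xi)$ does not depend on $\xi$. $\mathcal{B}$ is the space of smooth real-valued functions on $\mathbb{R}^d$ all of whose derivatives of order $\ge1$ are bounded (the functions themselves need not be bounded). As for symbols, these may depend on $\hbar$, with uniform bounds. $\mathcal{B}$ is a $G$-bimodule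 with left action $(g\cdot S)(x)=S(\varphi_g^{-1}(x))$ and trivial right action. $C^k_\varphi(G,\mathcal{B})$ is the space of maps $S:G^k\to\mathcal{B}$ (smooth when $G$ is a Lie group) with $S_{g_1,\dots,g_k}=0$ whenever some $g_i$ is the unit ($C^0_\varphi(G,\mathcal{B})=\mathcal{B}$), with differential $$(\delta c)_{g_1,\dots,g_{k+1}}=g_1\cdot c_{g_2,\dots,g_{k+1}}+\sum_{i=1}^k(-1)^ic_{g_1,\dots,g_ig_{i+1},\dots,g_{k+1}}+(-1)^{k+1}c_{g_1,\dots,g_k}.$$ Equivalent representations are ones intertwined by an invertible bounded operator on $L^2(\mathbb{R}^d)$.
   Formalization: "Only if" fails as stated (Z/2 acting trivially, a = 1, -1): for every group, S is shown to be a 1-cocycle modulo 2π; the iff with genuine 1-cocycles is stated when H²(G,Z)=0. G is an abstract group: smoothness of cochains in g for Lie groups is not imposed. *)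

theory Defs
  imports "HOL-Analysis.Analysis" "HOL-Algebra.Group"
begin

section \<open>Smooth functions, symbols, and the space \<open>\<B>\<close>\<close>

text \<open>\<open>iter_deriv [v\<^sub>1, \<dots>, v\<^sub>k] f\<close> is \<open>\<partial>\<^bsub>v\<^sub>1\<^esub> \<dots> \<partial>\<^bsub>v\<^sub>k\<^esub> f\<close>; with basis vectors as directions
  these are the partial derivatives of order \<open>k\<close>.\<close>

primrec iter_deriv ::
    "'a::euclidean_space list \<Rightarrow> ('a \<Rightarrow> 'b::real_normed_vector) \<Rightarrow> 'a \<Rightarrow> 'b" where
  "iter_deriv [] f = f"
| "iter_deriv (v # vs) f = (\<lambda>x. frechet_derivative (iter_deriv vs f) (at x) v)"

definition smooth :: "('a::euclidean_space \<Rightarrow> 'b::real_normed_vector) \<Rightarrow> bool" where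
  "smooth f \<longleftrightarrow>
    (\<forall>vs. set vs \<subseteq> Basis \<longrightarrow> (\<forall>x. iter_deriv vs f differentiable (at x)))"

definition diffeomorphism :: "('a::euclidean_space \<Rightarrow> 'a) \<Rightarrow> bool" where
  "diffeomorphism f \<longleftrightarrow> bij f \<and> smooth f \<and> smooth (inv_into UNIV f)"

text \<open>In the following, a family depending on \<open>\<hbar> \<in> (0, \<hbar>\<^sub>0]\<close> is a function of a real \<open>h\<close>;
  only its values for \<open>h \<in> {0<..h0}\<close> matter.\<close>

definition symbol_class :: "real \<Rightarrow> (real \<Rightarrow> 'a::euclidean_space \<Rightarrow> complex) set" where
  "symbol_class h0 = {a.
     (\<forall>h\<in>{0<..h0}. smooth (a h)) \<and>
     (\<forall>vs. set vs \<subseteq> Basis \<longrightarrow>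
        (\<exists>C. \<forall>h\<in>{0<..h0}. \<forall>z. norm (iter_deriv vs (a h) z) \<le> C))}"

definition phase_space :: "real \<Rightarrow> (real \<Rightarrow> 'a::euclidean_space \<Rightarrow> real) set" where
  "phase_space h0 = {S.
     (\<forall>h\<in>{0<..h0}. smooth (S h)) \<and>
     (\<forall>vs. vs \<noteq> [] \<and> set vs \<subseteq> Basis \<longrightarrow>
        (\<exists>C. \<forall>h\<in>{0<..h0}. \<forall>x. norm (iter_deriv vs (S h) x) \<le> C))}"

definition schwartz :: "('a::euclidean_space \<Rightarrow> complex) \<Rightarrow> bool" where
  "schwartz \<psi> \<longleftrightarrow> smooth \<psi> \<and>
     (\<forall>k. \<forall>vs. set vs \<subseteq> Basis \<longrightarrow>
        (\<exists>C. \<forall>x. norm x ^ k * norm (iter_deriv vs \<psi> x) \<le> C))"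


section \<open>Volume-preserving actions\<close>

definition volume_preserving_action ::
    "('g, 'm) monoid_scheme \<Rightarrow> ('g \<Rightarrow> real^'d \<Rightarrow> real^'d) \<Rightarrow> bool" where
  "volume_preserving_action G \<phi> \<longleftrightarrow>
     (\<forall>g\<in>carrier G. diffeomorphism (\<phi> g)) \<and>
     (\<forall>g\<in>carrier G. \<forall>g'\<in>carrier G. \<phi> (g \<otimes>\<^bsub>G\<^esub> g') = \<phi> g \<circ> \<phi> g') \<and>
     \<phi> \<one>\<^bsub>G\<^esub> = id \<and>
     (\<forall>g\<in>carrier G. \<forall>vs. vs \<noteq> [] \<and> set vs \<subseteq> Basis \<longrightarrow>
        bounded (range (iter_deriv vs (\<phi> g)))) \<and>
     (\<forall>g\<in>carrier G. \<forall>x. \<bar>det (matrix (frechet_derivative (\<phi> g) (at x)))\<bar> = 1)"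


section \<open>Operators and representations on \<open>L\<^sup>2\<close>\<close>

text \<open>Elements of \<open>L\<^sup>2(\<real>\<^sup>d)\<close> are represented by Borel measurable square-integrable functions, and
  an operator by its action on representatives. All identities in \<open>L\<^sup>2\<close> are therefore
  almost-everywhere identities. Boundedness and linearity imply that an operator respects
  almost-everywhere equality.\<close>

definition L2 :: "('a::euclidean_space \<Rightarrow> complex) set" where
  "L2 = {\<psi>. \<psi> \<in> borel_measurable lborel \<and> integrable lborel (\<lambda>x. (norm (\<psi> x))\<^sup>2)}"

definition L2_inner :: "('a::euclidean_space \<Rightarrow> complex) \<Rightarrow> ('a \<Rightarrow> complex) \<Rightarrow> complex" where
  "L2_inner \<psi> \<eta> = (LINT x|lborel. \<psi> x * cnj (\<eta> x))"

definition L2_norm :: "('a::euclidean_space \<Rightarrow> complex) \<Rightarrow> real" where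
  "L2_norm \<psi> = sqrt (LINT x|lborel. (norm (\<psi> x))\<^sup>2)"

definition bounded_operator ::
    "(('a::euclidean_space \<Rightarrow> complex) \<Rightarrow> ('a \<Rightarrow> complex)) \<Rightarrow> bool" where
  "bounded_operator T \<longleftrightarrow>
     (\<forall>\<psi>\<in>L2. T \<psi> \<in> L2) \<and>
     (\<forall>\<psi>\<in>L2. \<forall>\<eta>\<in>L2. \<forall>c. AE x in lborel. T (\<lambda>y. c * \<psi> y + \<eta> y) x = c * T \<psi> x + T \<eta> x) \<and>
     (\<exists>C. \<forall>\<psi>\<in>L2. L2_norm (T \<psi>) \<le> C * L2_norm \<psi>)"

definition unitary_operator ::
    "(('a::euclidean_space \<Rightarrow> complex) \<Rightarrow> ('a \<Rightarrow> complex)) \<Rightarrow> bool" where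
  "unitary_operator T \<longleftrightarrow>
     bounded_operator T \<and>
     (\<forall>\<psi>\<in>L2. \<forall>\<eta>\<in>L2. L2_inner (T \<psi>) (T \<eta>) = L2_inner \<psi> \<eta>) \<and>
     (\<forall>\<eta>\<in>L2. \<exists>\<psi>\<in>L2. AE x in lborel. T \<psi> x = \<eta> x)"

definition L2_representation ::
    "('g, 'm) monoid_scheme \<Rightarrow>
     ('g \<Rightarrow> ('a::euclidean_space \<Rightarrow> complex) \<Rightarrow> ('a \<Rightarrow> complex)) \<Rightarrow> bool" where
  "L2_representation G T \<longleftrightarrow>
     (\<forall>g\<in>carrier G. bounded_operator (T g)) \<and>
     (\<forall>\<psi>\<in>L2. AE x in lborel. T \<one>\<^bsub>G\<^esub> \<psi> x = \<psi> x) \<and>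
     (\<forall>g\<in>carrier G. \<forall>g'\<in>carrier G. \<forall>\<psi>\<in>L2.
        AE x in lborel. T (g \<otimes>\<^bsub>G\<^esub> g') \<psi> x = T g (T g' \<psi>) x)"

definition unitary_representation ::
    "('g, 'm) monoid_scheme \<Rightarrow>
     ('g \<Rightarrow> ('a::euclidean_space \<Rightarrow> complex) \<Rightarrow> ('a \<Rightarrow> complex)) \<Rightarrow> bool" where
  "unitary_representation G T \<longleftrightarrow>
     L2_representation G T \<and> (\<forall>g\<in>carrier G. unitary_operator (T g))"

definition equivalent_representations ::
    "('g, 'm) monoid_scheme \<Rightarrow>
     ('g \<Rightarrow> ('a::euclidean_space \<Rightarrow> complex) \<Rightarrow> ('a \<Rightarrow> complex)) \<Rightarrow>
     ('g \<Rightarrow> ('a \<Rightarrow> complex) \<Rightarrow> ('a \<Rightarrow> complex)) \<Rightarrow> bool" where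
  "equivalent_representations G T T' \<longleftrightarrow>
     L2_representation G T \<and> L2_representation G T' \<and>
     (\<exists>V W. bounded_operator V \<and> bounded_operator W \<and>
        (\<forall>\<psi>\<in>L2. AE x in lborel. V (W \<psi>) x = \<psi> x) \<and>
        (\<forall>\<psi>\<in>L2. AE x in lborel. W (V \<psi>) x = \<psi> x) \<and>
        (\<forall>g\<in>carrier G. \<forall>\<psi>\<in>L2. AE x in lborel. V (T g \<psi>) x = T' g (V \<psi>) x))"


section \<open>The operators \<open>Op(a, \<phi>)\<close> and unitary \<open>G\<close>-systems\<close>

text \<open>The oscillatory integral is not absolutely convergent in both variables. For Schwartz \<open>\<psi>\<close>
  it is the iterated integral with the inner integration over \<open>y\<close>: the inner integral decays
  rapidly in \<open>\<xi>\<close>.\<close>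

definition osc_integral ::
    "real \<Rightarrow> ((real^'d) \<times> (real^'d) \<Rightarrow> complex) \<Rightarrow> (real^'d \<Rightarrow> real^'d) \<Rightarrow>
     (real^'d \<Rightarrow> complex) \<Rightarrow> real^'d \<Rightarrow> complex" where
  "osc_integral h a f \<psi> x =
     (LINT \<xi>|lborel. LINT y|lborel.
        \<psi> y * a (x, \<xi>) * exp (\<i> / of_real h * of_real (\<xi> \<bullet> (inv_into UNIV f x - y)))
          / of_real ((2 * pi * h) ^ CARD('d)))"

text \<open>\<open>Op(a, f)\<close> is the bounded extension of the oscillatory integral from Schwartz functions to
  \<open>L\<^sup>2\<close>. It exists by the Calderon--Vaillancourt theorem, and by density it is unique up to
  almost-everywhere equality.\<close>

definition Op ::
    "real \<Rightarrow> ((real^'d) \<times> (real^'d) \<Rightarrow> complex) \<Rightarrow> (real^'d \<Rightarrow> real^'d) \<Rightarrow>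
     (real^'d \<Rightarrow> complex) \<Rightarrow> (real^'d \<Rightarrow> complex)" where
  "Op h a f = (SOME T. bounded_operator T \<and>
     (\<forall>\<psi>. schwartz \<psi> \<longrightarrow> (AE x in lborel. T \<psi> x = osc_integral h a f \<psi> x)))"

definition unitary_G_system ::
    "('g, 'm) monoid_scheme \<Rightarrow> ('g \<Rightarrow> real^'d \<Rightarrow> real^'d) \<Rightarrow> real \<Rightarrow>
     ('g \<Rightarrow> real \<Rightarrow> (real^'d) \<times> (real^'d) \<Rightarrow> complex) \<Rightarrow> bool" where
  "unitary_G_system G \<phi> h0 a \<longleftrightarrow>
     (\<forall>g\<in>carrier G. a g \<in> symbol_class h0) \<and>
     (\<forall>h\<in>{0<..h0}. unitary_representation G (\<lambda>g. Op h (a g h) (\<phi> g)))"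

definition independent_of_xi ::
    "('g, 'm) monoid_scheme \<Rightarrow> real \<Rightarrow>
     ('g \<Rightarrow> real \<Rightarrow> (real^'d) \<times> (real^'d) \<Rightarrow> complex) \<Rightarrow> bool" where
  "independent_of_xi G h0 a \<longleftrightarrow>
     (\<forall>g\<in>carrier G. \<forall>h\<in>{0<..h0}. \<forall>x \<xi> \<xi>'. a g h (x, \<xi>) = a g h (x, \<xi>'))"


section \<open>The complex \<open>C\<^sup>k\<^sub>\<phi>(G, \<B>)\<close>\<close>

text \<open>A \<open>k\<close>-cochain is a function on lists of length \<open>k\<close> over the group; its values on other lists
  are irrelevant.\<close>

definition tuples :: "('g, 'm) monoid_scheme \<Rightarrow> nat \<Rightarrow> 'g list set" where
  "tuples G k = {gs. length gs = k \<and> set gs \<subseteq> carrier G}"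

definition cochain ::
    "('g, 'm) monoid_scheme \<Rightarrow> real \<Rightarrow> nat \<Rightarrow> ('g list \<Rightarrow> real \<Rightarrow> real^'d \<Rightarrow> real) \<Rightarrow> bool" where
  "cochain G h0 k c \<longleftrightarrow>
     (\<forall>gs\<in>tuples G k. c gs \<in> phase_space h0 \<and>
        (\<one>\<^bsub>G\<^esub> \<in> set gs \<longrightarrow> (\<forall>h\<in>{0<..h0}. \<forall>x. c gs h x = 0)))"

text \<open>List positions start at 0, so \<open>g\<^sub>i\<close> is \<open>gs ! (i - 1)\<close>.\<close>

definition codiff ::
    "('g, 'm) monoid_scheme \<Rightarrow> ('g \<Rightarrow> real^'d \<Rightarrow> real^'d) \<Rightarrow> nat \<Rightarrow>
     ('g list \<Rightarrow> real \<Rightarrow> real^'d \<Rightarrow> real) \<Rightarrow> 'g list \<Rightarrow> real \<Rightarrow> real^'d \<Rightarrow> real" where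
  "codiff G \<phi> k c gs h x =
     c (tl gs) h (inv_into UNIV (\<phi> (hd gs)) x)
     + (\<Sum>i=1..k. (-1) ^ i *
          c (take (i - 1) gs @ [gs ! (i - 1) \<otimes>\<^bsub>G\<^esub> gs ! i] @ drop (i + 1) gs) h x)
     + (-1) ^ (k + 1) * c (butlast gs) h x"

definition cocycle ::
    "('g, 'm) monoid_scheme \<Rightarrow> ('g \<Rightarrow> real^'d \<Rightarrow> real^'d) \<Rightarrow> real \<Rightarrow> nat \<Rightarrow>
     ('g list \<Rightarrow> real \<Rightarrow> real^'d \<Rightarrow> real) \<Rightarrow> bool" where
  "cocycle G \<phi> h0 k c \<longleftrightarrow> cochain G h0 k c \<and>
     (\<forall>gs\<in>tuples G (k + 1). \<forall>h\<in>{0<..h0}. \<forall>x. codiff G \<phi> k c gs h x = 0)"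

definition cohomologous ::
    "('g, 'm) monoid_scheme \<Rightarrow> ('g \<Rightarrow> real^'d \<Rightarrow> real^'d) \<Rightarrow> real \<Rightarrow> nat \<Rightarrow>
     ('g list \<Rightarrow> real \<Rightarrow> real^'d \<Rightarrow> real) \<Rightarrow>
     ('g list \<Rightarrow> real \<Rightarrow> real^'d \<Rightarrow> real) \<Rightarrow> bool" where
  "cohomologous G \<phi> h0 k c c' \<longleftrightarrow>
     (\<exists>b. cochain G h0 (k - 1) b \<and>
        (\<forall>gs\<in>tuples G k. \<forall>h\<in>{0<..h0}. \<forall>x.
           c gs h x - c' gs h x = codiff G \<phi> (k - 1) b gs h x))"

text \<open>Vanishing of \<open>H\<^sup>k\<^sub>\<phi>(G, \<B>)\<close>, for \<open>k \<ge> 1\<close>.\<close>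

definition cohomology_vanishes ::
    "('g, 'm) monoid_scheme \<Rightarrow> ('g \<Rightarrow> real^'d \<Rightarrow> real^'d) \<Rightarrow> real \<Rightarrow> nat \<Rightarrow> bool" where
  "cohomology_vanishes G \<phi> h0 k \<longleftrightarrow>
     (\<forall>c. cocycle G \<phi> h0 k c \<longrightarrow> cohomologous G \<phi> h0 k c (\<lambda>_ _ _. 0))"

text \<open>The phase of a symbol \<open>e\<^bsup>iS\<^esup>\<close> is only determined modulo \<open>2\<pi>\<close>, and multiplicativity of the
  operators only says that the differential of \<open>S\<close> takes values in \<open>2\<pi>\<int>\<close>. This cannot be improved
  for all groups: if \<open>\<int>/2\<close> acts trivially, the system with symbols \<open>1\<close> and \<open>-1\<close> is not of the form
  \<open>e\<^bsup>iS\<^esup>\<close> for a real cocycle \<open>S\<close>, since such an \<open>S\<close> vanishes. The obstruction to replacing \<open>S\<close> by a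
  cocycle is a class in \<open>H\<^sup>2(G, \<int>)\<close>.\<close>

definition cocycle_mod_2pi ::
    "('g, 'm) monoid_scheme \<Rightarrow> ('g \<Rightarrow> real^'d \<Rightarrow> real^'d) \<Rightarrow> real \<Rightarrow>
     ('g list \<Rightarrow> real \<Rightarrow> real^'d \<Rightarrow> real) \<Rightarrow> bool" where
  "cocycle_mod_2pi G \<phi> h0 S \<longleftrightarrow> cochain G h0 1 S \<and>
     (\<forall>gs\<in>tuples G 2. \<forall>h\<in>{0<..h0}. \<forall>x.
        \<exists>n::int. codiff G \<phi> 1 S gs h x = 2 * pi * of_int n)"

definition integral_H2_vanishes :: "('g, 'm) monoid_scheme \<Rightarrow> bool" where
  "integral_H2_vanishes G \<longleftrightarrow>
     (\<forall>k :: 'g \<Rightarrow> 'g \<Rightarrow> int.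
        (\<forall>g\<^sub>1\<in>carrier G. \<forall>g\<^sub>2\<in>carrier G. \<forall>g\<^sub>3\<in>carrier G.
           k g\<^sub>2 g\<^sub>3 - k (g\<^sub>1 \<otimes>\<^bsub>G\<^esub> g\<^sub>2) g\<^sub>3 + k g\<^sub>1 (g\<^sub>2 \<otimes>\<^bsub>G\<^esub> g\<^sub>3) - k g\<^sub>1 g\<^sub>2 = 0) \<longrightarrow>
        (\<exists>n :: 'g \<Rightarrow> int. \<forall>g\<^sub>1\<in>carrier G. \<forall>g\<^sub>2\<in>carrier G.
           k g\<^sub>1 g\<^sub>2 = n g\<^sub>2 - n (g\<^sub>1 \<otimes>\<^bsub>G\<^esub> g\<^sub>2) + n g\<^sub>1))"

definition has_phase ::
    "('g, 'm) monoid_scheme \<Rightarrow> real \<Rightarrow>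
     ('g \<Rightarrow> real \<Rightarrow> (real^'d) \<times> (real^'d) \<Rightarrow> complex) \<Rightarrow>
     ('g list \<Rightarrow> real \<Rightarrow> real^'d \<Rightarrow> real) \<Rightarrow> bool" where
  "has_phase G h0 a S \<longleftrightarrow>
     (\<forall>g\<in>carrier G. \<forall>h\<in>{0<..h0}. \<forall>x \<xi>. a g h (x, \<xi>) = exp (\<i> * of_real (S [g] h x)))"

definition phase_operator ::
    "('g \<Rightarrow> real^'d \<Rightarrow> real^'d) \<Rightarrow> ('g list \<Rightarrow> real \<Rightarrow> real^'d \<Rightarrow> real) \<Rightarrow> real \<Rightarrow> 'g \<Rightarrow>
     (real^'d \<Rightarrow> complex) \<Rightarrow> (real^'d \<Rightarrow> complex)" where
  "phase_operator \<phi> S h g \<psi> =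
     (\<lambda>x. exp (\<i> * of_real (S [g] h x)) * \<psi> (inv_into UNIV (\<phi> g) x))"

definition trivial_quantization ::
    "('g \<Rightarrow> real^'d \<Rightarrow> real^'d) \<Rightarrow> 'g \<Rightarrow> (real^'d \<Rightarrow> complex) \<Rightarrow> (real^'d \<Rightarrow> complex)" where
  "trivial_quantization \<phi> g \<psi> = (\<lambda>x. \<psi> (inv_into UNIV (\<phi> g) x))"

end

theory Submission
  imports Defs "HOL-Probability.Characteristic_Functions" "HOL-Probability.Sinc_Integral"
begin

text \<open>For a symbol independent of \<open>\<xi>\<close>, Fourier inversion evaluates the oscillatory integral on
  Schwartz functions, \<open>Op(a, \<phi>) \<psi> = a \<cdot> (\<psi> \<circ> \<phi>\<^sup>-\<^sup>1)\<close>; since \<open>\<phi>\<close> preserves volume the right-hand side is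
  bounded on \<open>L\<^sup>2\<close>, and by density of the Schwartz functions the identity holds there. Such a
  weighted composition operator is unitary if and only if \<open>|a| = 1\<close>. A smooth map from \<open>\<real>\<^sup>d\<close> to the
  circle lifts to a phase \<open>S\<close>, and \<open>dS = Im (cnj a da)\<close> bounds its derivatives. The representation
  property evaluated on a Gaussian says that \<open>a\<close> is a multiplicative cocycle, so that the differential
  of \<open>S\<close> has values in \<open>2 \<pi> \<int>\<close>. Finally, if \<open>S - S' = \<delta>b\<close>, then multiplication by \<open>exp (i b)\<close>
  intertwines the two representations.\<close>

section \<open>Smooth functions with uniformly bounded derivatives\<close>

text \<open>\<open>Op\<close> is a choice among the bounded operators with prescribed values on
  Schwartz functions, so it is accessible only once its specification is known to be satisfiable,
  and then only up to null sets. The weighted composition is itself the required witness; pointwise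
  statements about weights come back from almost-everywhere ones through continuity. Lifts are
  chosen separately for each \<open>g\<close> and each \<open>h\<close>. Hence \<open>S\<close> has
  no uniform bound in \<open>h\<close>, which is harmless because \<open>phase_space\<close> bounds
  only derivatives of order at least one. Lifts are also ambiguous by integer multiples of 2 pi,
  which is the real obstruction: the defect of \<open>S\<close> is an integral 2-cocycle of
  \<open>G\<close>, and when it is the coboundary of some \<open>n\<close>, the corrected lift
  \<open>S - 2 pi n\<close> is a genuine cocycle. Derivatives of high order are never computed. Each
  class of functions is embedded in a class stable under first-order differentiation, and bounds of
  all orders follow from bounds on the members of that class.\<close>

lemma iter_deriv_append: "iter_deriv (vs @ ws) f = iter_deriv vs (iter_deriv ws f)"
  by (induction vs) auto

lemma iter_deriv_snoc:
  "iter_deriv (vs @ [b]) f = iter_deriv vs (\<lambda>x. frechet_derivative f (at x) b)"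
  by (simp add: iter_deriv_append)

text \<open>Families are functions on all of the reals, but their derivatives are controlled only
  for parameters in \<open>I\<close>. The conclusion is therefore agreement with a member of
  \<open>X\<close> on \<open>I\<close>, not membership of the iterated derivative.\<close>

lemma iter_deriv_in_closed_class:
  assumes "F \<in> X" "set vs \<subseteq> Basis"
    and "\<And>F b. F \<in> X \<Longrightarrow> b \<in> Basis \<Longrightarrow> \<exists>F'\<in>X. \<forall>h\<in>I. \<forall>x. frechet_derivative (F h) (at x) b = F' h x"
  shows "\<exists>F'\<in>X. \<forall>h\<in>I. iter_deriv vs (F h) = F' h"
  using assms(2)
proof (induction vs)
  case Nil
  then show ?case using assms(1) by auto
next
  case (Cons b vs)
  then obtain F' where F': "F' \<in> X" "\<And>h. h \<in> I \<Longrightarrow> iter_deriv vs (F h) = F' h" by auto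
  obtain F'' where "F'' \<in> X" "\<And>h x. h \<in> I \<Longrightarrow> frechet_derivative (F' h) (at x) b = F'' h x"
    using assms(3)[OF F'(1)] Cons.prems by force
  then show ?case using F' by (intro bexI[of _ F'']) auto
qed

text \<open>The symbol class with arbitrary target and parameter set, so that complex symbols and
  the real derivatives of phases share the same closure lemmas.\<close>

definition bounded_smooth :: "real set \<Rightarrow> (real \<Rightarrow> 'a::euclidean_space \<Rightarrow> 'b::real_normed_vector) \<Rightarrow> bool" where
  "bounded_smooth I F \<longleftrightarrow> (\<forall>h\<in>I. smooth (F h)) \<and>
     (\<forall>vs. set vs \<subseteq> Basis \<longrightarrow> (\<exists>C. \<forall>h\<in>I. \<forall>x. norm (iter_deriv vs (F h) x) \<le> C))"

lemma symbol_class_iff: "a \<in> symbol_class h0 \<longleftrightarrow> bounded_smooth {0<..h0} a"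
  by (simp add: symbol_class_def bounded_smooth_def)

text \<open>Coinduction principle: closure under one derivative, together with differentiability and
  a bound for each member, yields all orders. It replaces Leibniz and chain rules of higher
  order.\<close>

lemma bounded_smooth_coinduct:
  assumes "F \<in> X"
    and diff: "\<And>F h x. F \<in> X \<Longrightarrow> h \<in> I \<Longrightarrow> F h differentiable at x"
    and bdd: "\<And>F. F \<in> X \<Longrightarrow> \<exists>C. \<forall>h\<in>I. \<forall>x. norm (F h x) \<le> C"
    and deriv: "\<And>F b. F \<in> X \<Longrightarrow> b \<in> Basis \<Longrightarrow>
      \<exists>F'\<in>X. \<forall>h\<in>I. \<forall>x. frechet_derivative (F h) (at x) b = F' h x"
  shows "bounded_smooth I F"
  unfolding bounded_smooth_def smooth_def
proof (intro conjI ballI allI impI)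
  fix vs :: "'a list" assume vs: "set vs \<subseteq> Basis"
  obtain F' where F': "F' \<in> X" "\<And>h. h \<in> I \<Longrightarrow> iter_deriv vs (F h) = F' h"
    using iter_deriv_in_closed_class[OF \<open>F \<in> X\<close> vs, where I=I] deriv by metis
  show "iter_deriv vs (F h) differentiable at x" if "h \<in> I" for h x
    using F' diff that by simp
  show "\<exists>C. \<forall>h\<in>I. \<forall>x. norm (iter_deriv vs (F h) x) \<le> C"
    using bdd[OF F'(1)] F'(2) by simp
qed

lemma bounded_smooth_differentiable: "bounded_smooth I F \<Longrightarrow> h \<in> I \<Longrightarrow> F h differentiable at x"
  unfolding bounded_smooth_def smooth_def by (metis empty_subsetI iter_deriv.simps(1) list.set(1))

lemma bounded_smooth_bounded: "bounded_smooth I F \<Longrightarrow> \<exists>C. \<forall>h\<in>I. \<forall>x. norm (F h x) \<le> C"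
  unfolding bounded_smooth_def by (metis empty_subsetI iter_deriv.simps(1) list.set(1))

lemma bounded_smooth_deriv:
  assumes "bounded_smooth I F" "b \<in> Basis"
  shows "bounded_smooth I (\<lambda>h x. frechet_derivative (F h) (at x) b)"
  using assms unfolding bounded_smooth_def smooth_def
  by (simp add: iter_deriv_snoc[symmetric])

lemma bounded_smooth_has_derivative:
  "bounded_smooth I F \<Longrightarrow> h \<in> I \<Longrightarrow> (F h has_derivative frechet_derivative (F h) (at x)) (at x)"
  using bounded_smooth_differentiable frechet_derivative_works by blast

lemma bounded_smooth_cong:
  assumes "bounded_smooth I F" "\<And>h x. h \<in> I \<Longrightarrow> F h x = G h x"
  shows "bounded_smooth I G"
proof -
  have "F h = G h" if "h \<in> I" for h using assms(2)[OF that] by (rule ext)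
  thus ?thesis using assms(1) by (simp add: bounded_smooth_def)
qed

lemma bounded_smooth_const [simp]: "bounded_smooth I (\<lambda>h x. c)"
proof (rule bounded_smooth_coinduct[where X = "range (\<lambda>c h x. c)"])
  show "\<exists>F'\<in>range (\<lambda>c h x. c). \<forall>h\<in>I. \<forall>x. frechet_derivative (F h) (at x) b = F' h x"
    if "F \<in> range (\<lambda>c h x. c)" for F :: "real \<Rightarrow> 'a \<Rightarrow> 'b" and b
    using that by (auto intro!: exI[of _ 0])
qed auto

lemma bounded_smooth_linear:
  fixes L :: "'b::real_normed_vector \<Rightarrow> 'c::real_normed_vector"
    and F :: "real \<Rightarrow> 'a::euclidean_space \<Rightarrow> 'b"
  assumes L: "bounded_linear L" and F: "bounded_smooth I F"
  shows "bounded_smooth I (\<lambda>h x. L (F h x))"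
proof (rule bounded_smooth_coinduct[where X = "{\<lambda>h x. L (F h x) |F. bounded_smooth I F}"])
  show "(\<lambda>h x. L (F h x)) \<in> {\<lambda>h x. L (F h x) |F. bounded_smooth I F}" using F by blast
  fix F :: "real \<Rightarrow> 'a \<Rightarrow> 'c" assume "F \<in> {\<lambda>h x. L (F h x) |F. bounded_smooth I F}"
  then obtain F1 where F1: "F = (\<lambda>h x. L (F1 h x))" "bounded_smooth I F1" by auto
  have der: "(F h has_derivative (\<lambda>v. L (frechet_derivative (F1 h) (at x) v))) (at x)" if "h \<in> I" for h x
    unfolding F1(1) by (intro bounded_linear.has_derivative[OF L] bounded_smooth_has_derivative[OF F1(2) that])
  show "F h differentiable at x" if "h \<in> I" for h x using der[OF that] by (rule differentiableI)
  obtain C where C: "\<And>h x. h \<in> I \<Longrightarrow> norm (F1 h x) \<le> C" using bounded_smooth_bounded[OF F1(2)] by auto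
  obtain K where K: "\<And>x. norm (L x) \<le> norm x * K" "K \<ge> 0" using bounded_linear.nonneg_bounded[OF L] by auto
  show "\<exists>C. \<forall>h\<in>I. \<forall>x. norm (F h x) \<le> C"
    unfolding F1(1) using K C by (intro exI[of _ "C * K"] ballI allI order_trans[OF K(1)] mult_right_mono) auto
  fix b :: 'a assume b: "b \<in> Basis"
  show "\<exists>F'\<in>{\<lambda>h x. L (F h x) |F. bounded_smooth I F}. \<forall>h\<in>I. \<forall>x. frechet_derivative (F h) (at x) b = F' h x"
    using bounded_smooth_deriv[OF F1(2) b] frechet_derivative_at[OF der, symmetric]
    by (intro bexI[of _ "\<lambda>h x. L (frechet_derivative (F1 h) (at x) b)"]) auto
qed

lemma bounded_smooth_add:
  assumes F: "bounded_smooth I F" and G: "bounded_smooth I G"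
  shows "bounded_smooth I (\<lambda>h x. F h x + G h x)"
proof (rule bounded_smooth_coinduct[where X = "{\<lambda>h x. F h x + G h x |F G. bounded_smooth I F \<and> bounded_smooth I G}"])
  let ?X = "{\<lambda>h x. F h x + G h x |F G. bounded_smooth I F \<and> bounded_smooth I G}"
  show "(\<lambda>h x. F h x + G h x) \<in> ?X" using F G by blast
  fix F :: "real \<Rightarrow> 'a \<Rightarrow> 'b" assume "F \<in> ?X"
  then obtain F1 F2 where F: "F = (\<lambda>h x. F1 h x + F2 h x)" "bounded_smooth I F1" "bounded_smooth I F2" by auto
  have der: "(F h has_derivative (\<lambda>v. frechet_derivative (F1 h) (at x) v + frechet_derivative (F2 h) (at x) v)) (at x)"
    if "h \<in> I" for h x
    unfolding F(1) by (intro has_derivative_add bounded_smooth_has_derivative[OF F(2) that] bounded_smooth_has_derivative[OF F(3) that])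
  show "F h differentiable at x" if "h \<in> I" for h x using der[OF that] by (rule differentiableI)
  obtain C1 C2 where C: "\<And>h x. h \<in> I \<Longrightarrow> norm (F1 h x) \<le> C1" "\<And>h x. h \<in> I \<Longrightarrow> norm (F2 h x) \<le> C2"
    using bounded_smooth_bounded[OF F(2)] bounded_smooth_bounded[OF F(3)] by meson
  show "\<exists>C. \<forall>h\<in>I. \<forall>x. norm (F h x) \<le> C"
    unfolding F(1) using C by (intro exI[of _ "C1 + C2"] ballI allI norm_triangle_mono) auto
  fix b :: 'a assume b: "b \<in> Basis"
  show "\<exists>F'\<in>?X. \<forall>h\<in>I. \<forall>x. frechet_derivative (F h) (at x) b = F' h x"
    using bounded_smooth_deriv[OF F(2) b] bounded_smooth_deriv[OF F(3) b] frechet_derivative_at[OF der, symmetric]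
    by (intro bexI[of _ "\<lambda>h x. frechet_derivative (F1 h) (at x) b + frechet_derivative (F2 h) (at x) b"]) auto
qed

text \<open>Products alone are not stable under differentiation, since the product rule yields two
  of them. Finite sums of products form a stable class.\<close>

inductive product_sum :: "real set \<Rightarrow> (real \<Rightarrow> 'a::euclidean_space \<Rightarrow> 'b::real_normed_algebra) \<Rightarrow> bool" for I where
  prod: "bounded_smooth I F \<Longrightarrow> bounded_smooth I G \<Longrightarrow> product_sum I (\<lambda>h x. F h x * G h x)"
| add: "product_sum I F \<Longrightarrow> product_sum I G \<Longrightarrow> product_sum I (\<lambda>h x. F h x + G h x)"

lemma bounded_smooth_mult:
  fixes F :: "real \<Rightarrow> 'a::euclidean_space \<Rightarrow> 'b::real_normed_algebra"
  assumes F: "bounded_smooth I F" and G: "bounded_smooth I G"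
  shows "bounded_smooth I (\<lambda>h x. F h x * G h x)"
proof (rule bounded_smooth_coinduct[where X = "Collect (product_sum I)"])
  show "(\<lambda>h x. F h x * G h x) \<in> Collect (product_sum I)" using F G by (auto intro: product_sum.prod)
  fix F :: "real \<Rightarrow> 'a \<Rightarrow> 'b" assume "F \<in> Collect (product_sum I)"
  hence "product_sum I F" by simp
  \<comment> \<open>All three requirements of the coinduction are proved simultaneously:
    differentiating a sum needs differentiability of both summands along with representatives for
    their derivatives.\<close>
  hence *: "(\<forall>h\<in>I. \<forall>x. F h differentiable at x) \<and> (\<exists>C. \<forall>h\<in>I. \<forall>x. norm (F h x) \<le> C) \<and>
    (\<forall>b\<in>Basis. \<exists>F'. product_sum I F' \<and> (\<forall>h\<in>I. \<forall>x. frechet_derivative (F h) (at x) b = F' h x))"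
  proof induction
    case (prod F G)
    have der: "((\<lambda>x. F h x * G h x) has_derivative (\<lambda>v. F h x * frechet_derivative (G h) (at x) v
         + frechet_derivative (F h) (at x) v * G h x)) (at x)" if "h \<in> I" for h x
      by (intro has_derivative_mult bounded_smooth_has_derivative[OF prod(1) that] bounded_smooth_has_derivative[OF prod(2) that])
    obtain C1 C2 where C: "\<And>h x. h \<in> I \<Longrightarrow> norm (F h x) \<le> C1" "\<And>h x. h \<in> I \<Longrightarrow> norm (G h x) \<le> C2"
      using bounded_smooth_bounded[OF prod(1)] bounded_smooth_bounded[OF prod(2)] by meson
    have "norm (F h x * G h x) \<le> C1 * C2" if "h \<in> I" for h x
    proof -
      have "norm (F h x * G h x) \<le> norm (F h x) * norm (G h x)" by (rule norm_mult_ineq)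
      also have "\<dots> \<le> C1 * C2" using C[OF that, of x]
        by (intro mult_mono) (auto intro: order_trans[OF norm_ge_zero])
      finally show ?thesis .
    qed
    moreover have "\<exists>F'. product_sum I F' \<and> (\<forall>h\<in>I. \<forall>x. frechet_derivative (\<lambda>x. F h x * G h x) (at x) b = F' h x)"
      if "b \<in> Basis" for b
      using frechet_derivative_at[OF der, symmetric] bounded_smooth_deriv[OF prod(1) that]
        bounded_smooth_deriv[OF prod(2) that] prod
      by (intro exI[of _ "\<lambda>h x. F h x * frechet_derivative (G h) (at x) b
         + frechet_derivative (F h) (at x) b * G h x"]) (auto intro!: product_sum.intros)
    ultimately show ?case using differentiableI[OF der] by blast
  next
    case (add F G)
    have der: "((\<lambda>x. F h x + G h x) has_derivative (\<lambda>v. frechet_derivative (F h) (at x) v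
         + frechet_derivative (G h) (at x) v)) (at x)" if "h \<in> I" for h x
      by (intro has_derivative_add) (use add.IH that frechet_derivative_works in blast)+
    obtain C1 C2 where C: "\<And>h x. h \<in> I \<Longrightarrow> norm (F h x) \<le> C1" "\<And>h x. h \<in> I \<Longrightarrow> norm (G h x) \<le> C2"
      using add.IH by meson
    have "norm (F h x + G h x) \<le> C1 + C2" if "h \<in> I" for h x
      by (intro norm_triangle_mono C that)
    moreover have "\<exists>F'. product_sum I F' \<and> (\<forall>h\<in>I. \<forall>x. frechet_derivative (\<lambda>x. F h x + G h x) (at x) b = F' h x)"
      if b: "b \<in> Basis" for b
    proof -
      obtain F' G' where "product_sum I F'" "\<forall>h\<in>I. \<forall>x. frechet_derivative (F h) (at x) b = F' h x"
        "product_sum I G'" "\<forall>h\<in>I. \<forall>x. frechet_derivative (G h) (at x) b = G' h x"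
        using add.IH b by blast
      thus ?thesis using frechet_derivative_at[OF der, symmetric]
        by (intro exI[of _ "\<lambda>h x. F' h x + G' h x"]) (auto intro!: product_sum.intros)
    qed
    ultimately show ?case using differentiableI[OF der] by blast
  qed
  show "F h differentiable at x" if "h \<in> I" for h x using * that by blast
  show "\<exists>C. \<forall>h\<in>I. \<forall>x. norm (F h x) \<le> C" using * by blast
  show "\<exists>F'\<in>Collect (product_sum I). \<forall>h\<in>I. \<forall>x. frechet_derivative (F h) (at x) b = F' h x"
    if "b \<in> Basis" for b using * that by blast
qed

text \<open>Turns a function of position into a symbol on phase space. The first component of a
  basis vector of the product is a basis vector or zero, and in the second case the derivative
  vanishes, so the zero family has to lie in the class.\<close>

lemma bounded_smooth_compose_fst:
  fixes F :: "real \<Rightarrow> 'a::euclidean_space \<Rightarrow> 'c::real_normed_vector"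
  assumes F: "bounded_smooth I F"
  shows "bounded_smooth I (\<lambda>h (z :: 'a \<times> 'b::euclidean_space). F h (fst z))"
proof (rule bounded_smooth_coinduct[where X = "{\<lambda>h z. F h (fst z) |F. bounded_smooth I F}"])
  let ?X = "{\<lambda>h z. F h (fst z) |F. bounded_smooth I F}"
  show "(\<lambda>h z. F h (fst z)) \<in> ?X" using F by blast
  fix F :: "real \<Rightarrow> 'a \<times> 'b \<Rightarrow> 'c" assume "F \<in> ?X"
  then obtain F1 where F1: "F = (\<lambda>h z. F1 h (fst z))" "bounded_smooth I F1" by auto
  have der: "(F h has_derivative (\<lambda>v. frechet_derivative (F1 h) (at (fst z)) (fst v))) (at z)" if "h \<in> I" for h z
    unfolding F1(1)
    by (rule has_derivative_compose[OF _ bounded_smooth_has_derivative[OF F1(2) that]]) (rule has_derivative_fst[OF has_derivative_ident])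
  show "F h differentiable at z" if "h \<in> I" for h z using der[OF that] by (rule differentiableI)
  show "\<exists>C. \<forall>h\<in>I. \<forall>x. norm (F h x) \<le> C"
    using bounded_smooth_bounded[OF F1(2)] unfolding F1(1) by blast
  fix b :: "'a \<times> 'b" assume b: "b \<in> Basis"
  have "linear (frechet_derivative (F1 h) (at z))" if "h \<in> I" for h z
    using bounded_smooth_has_derivative[OF F1(2) that] has_derivative_linear by blast
  hence zero: "frechet_derivative (F1 h) (at z) 0 = 0" if "h \<in> I" for h z
    using that linear_0 by blast
  from b consider "fst b \<in> Basis" | "fst b = 0" by (auto simp: Basis_prod_def)
  thus "\<exists>F'\<in>?X. \<forall>h\<in>I. \<forall>x. frechet_derivative (F h) (at x) b = F' h x"
  proof cases
    case 1
    thus ?thesis using bounded_smooth_deriv[OF F1(2) 1] frechet_derivative_at[OF der, symmetric]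
      by (intro bexI[of _ "\<lambda>h z. frechet_derivative (F1 h) (at (fst z)) (fst b)"]) auto
  next
    case 2
    have "(\<lambda>h z. 0) \<in> ?X" by (intro CollectI exI[of _ "\<lambda>h x. 0"]) simp
    thus ?thesis using frechet_derivative_at[OF der, symmetric] zero 2
      by (intro bexI[of _ "\<lambda>h z. 0"]) auto
  qed
qed

text \<open>Freezing the momentum variable recovers the weight on position space from a symbol;
  directions \<open>b\<close> lift to the basis vectors \<open>(b, 0)\<close>.\<close>

lemma bounded_smooth_slice:
  fixes F :: "real \<Rightarrow> 'a::euclidean_space \<times> 'b::euclidean_space \<Rightarrow> 'c::real_normed_vector"
  assumes F: "bounded_smooth I F"
  shows "bounded_smooth I (\<lambda>h x. F h (x, y))"
proof (rule bounded_smooth_coinduct[where X = "{\<lambda>h x. F h (x, y) |F. bounded_smooth I F}"])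
  let ?X = "{\<lambda>h x. F h (x, y) |F. bounded_smooth I F}"
  show "(\<lambda>h x. F h (x, y)) \<in> ?X" using F by blast
  fix F :: "real \<Rightarrow> 'a \<Rightarrow> 'c" assume "F \<in> ?X"
  then obtain F1 where F1: "F = (\<lambda>h x. F1 h (x, y))" "bounded_smooth I F1" by auto
  have der: "(F h has_derivative (\<lambda>v. frechet_derivative (F1 h) (at (x, y)) (v, 0))) (at x)" if "h \<in> I" for h x
    unfolding F1(1)
    by (rule has_derivative_compose[OF _ bounded_smooth_has_derivative[OF F1(2) that]])
       (auto intro!: derivative_eq_intros)
  show "F h differentiable at z" if "h \<in> I" for h z using der[OF that] by (rule differentiableI)
  show "\<exists>C. \<forall>h\<in>I. \<forall>x. norm (F h x) \<le> C"
    using bounded_smooth_bounded[OF F1(2)] unfolding F1(1) by blast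
  fix b :: "'a" assume b: "b \<in> Basis"
  hence b': "(b, 0) \<in> (Basis :: ('a \<times> 'b) set)" by (auto simp: Basis_prod_def)
  show "\<exists>F'\<in>?X. \<forall>h\<in>I. \<forall>x. frechet_derivative (F h) (at x) b = F' h x"
    using bounded_smooth_deriv[OF F1(2) b'] frechet_derivative_at[OF der, symmetric]
    by (intro bexI[of _ "\<lambda>h x. frechet_derivative (F1 h) (at (x, y)) (b, 0)"]) auto
qed

section \<open>Phases: their first derivatives, exponentials and lifts\<close>

text \<open>The innermost derivative is split off (a list ends in its first-applied direction),
  which moves the order-zero exception in \<open>phase_space\<close> to a plain differentiability
  condition and leaves a \<open>bounded_smooth\<close> condition on the first derivatives.\<close>

lemma phase_space_iff:
  "S \<in> phase_space h0 \<longleftrightarrow> (\<forall>h\<in>{0<..h0}. \<forall>x. S h differentiable at x) \<and>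
     (\<forall>b\<in>Basis. bounded_smooth {0<..h0} (\<lambda>h x. frechet_derivative (S h) (at x) b))"
  (is "?L \<longleftrightarrow> ?R")
proof
  assume L: ?L
  show ?R
  proof (intro conjI ballI allI)
    show "S h differentiable at x" if "h \<in> {0<..h0}" for h x
      using L that unfolding phase_space_def smooth_def
      by (metis (mono_tags, lifting) empty_subsetI iter_deriv.simps(1) list.set(1) mem_Collect_eq)
    show "bounded_smooth {0<..h0} (\<lambda>h x. frechet_derivative (S h) (at x) b)" if "b \<in> Basis" for b
      using L that unfolding bounded_smooth_def phase_space_def smooth_def
      by (simp add: iter_deriv_snoc[symmetric])
  qed
next
  assume R: ?R
  have split: "\<exists>ws b. vs = ws @ [b] \<and> set ws \<subseteq> Basis \<and> b \<in> Basis"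
    if "vs \<noteq> []" "set vs \<subseteq> Basis" for vs :: "'a list"
    using that by (cases vs rule: rev_cases) auto
  show ?L
    unfolding phase_space_def smooth_def
  proof (intro CollectI conjI ballI allI impI)
    fix h vs x assume h: "h \<in> {0<..h0}" and vs: "set vs \<subseteq> (Basis :: 'a set)"
    show "iter_deriv vs (S h) differentiable at x"
    proof (cases "vs = []")
      case True
      thus ?thesis using R h by simp
    next
      case False
      then obtain ws b where "vs = ws @ [b]" "set ws \<subseteq> Basis" "b \<in> Basis" using split[OF _ vs] by blast
      thus ?thesis using R h unfolding bounded_smooth_def smooth_def by (auto simp: iter_deriv_snoc)
    qed
  next
    fix vs :: "'a list" assume "vs \<noteq> [] \<and> set vs \<subseteq> Basis"
    then obtain ws b where "vs = ws @ [b]" "set ws \<subseteq> Basis" "b \<in> Basis" using split by blast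
    thus "\<exists>C. \<forall>h\<in>{0<..h0}. \<forall>x. norm (iter_deriv vs (S h) x) \<le> C"
      using R unfolding bounded_smooth_def by (auto simp: iter_deriv_snoc)
  qed
qed

text \<open>Differentiating \<open>P exp (i S)\<close> gives \<open>(dP + i P dS) exp (i S)\<close>.
  Only \<open>dS\<close> enters, so an unbounded \<open>S\<close> causes no trouble, and the
  exponential has modulus one.\<close>

lemma bounded_smooth_exp_phase:
  assumes S: "S \<in> phase_space h0"
  shows "bounded_smooth {0<..h0} (\<lambda>h x. exp (\<i> * of_real (S h x)))"
proof -
  let ?I = "{0<..h0}"
  let ?E = "\<lambda>h x. exp (\<i> * complex_of_real (S h x))"
  let ?X = "{\<lambda>h x. P h x * ?E h x |P. bounded_smooth ?I P}"
  show ?thesis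
  proof (rule bounded_smooth_coinduct[where X = ?X])
    show "?E \<in> ?X" using bounded_smooth_const[of ?I 1] by (intro CollectI exI[of _ "\<lambda>h x. 1"]) simp
    fix F assume "F \<in> ?X"
    then obtain P where P: "F = (\<lambda>h x. P h x * ?E h x)" "bounded_smooth ?I P" by auto
    have der: "(F h has_derivative (\<lambda>v. (frechet_derivative (P h) (at x) v
         + \<i> * (P h x * of_real (frechet_derivative (S h) (at x) v))) * ?E h x)) (at x)" if "h \<in> ?I" for h x
    proof -
      have [derivative_intros]: "(S h has_derivative frechet_derivative (S h) (at x)) (at x)"
        using S that frechet_derivative_works unfolding phase_space_iff by blast
      have [derivative_intros]: "(P h has_derivative frechet_derivative (P h) (at x)) (at x)"
        by (rule bounded_smooth_has_derivative[OF P(2) that])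
      have 1: "((\<lambda>x. \<i> * complex_of_real (S h x)) has_derivative (\<lambda>v. \<i> * of_real (frechet_derivative (S h) (at x) v))) (at x)"
        by (intro derivative_intros)
      have 2: "(?E h has_derivative (\<lambda>v. ?E h x * (\<i> * of_real (frechet_derivative (S h) (at x) v)))) (at x)"
        by (rule has_derivative_compose[OF 1 DERIV_exp[THEN has_field_derivative_imp_has_derivative]])
      show ?thesis unfolding P(1)
        by (rule has_derivative_eq_rhs[OF has_derivative_mult[OF bounded_smooth_has_derivative[OF P(2) that] 2]])
           (simp add: fun_eq_iff algebra_simps)
    qed
    show "F h differentiable at x" if "h \<in> ?I" for h x using der[OF that] by (rule differentiableI)
    show "\<exists>C. \<forall>h\<in>?I. \<forall>x. norm (F h x) \<le> C"
      using bounded_smooth_bounded[OF P(2)] unfolding P(1) by (simp add: norm_mult)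
    fix b :: 'a assume b: "b \<in> Basis"
    have Sb: "bounded_smooth ?I (\<lambda>h x. frechet_derivative (S h) (at x) b)"
      using S b unfolding phase_space_iff by blast
    have "bounded_smooth ?I (\<lambda>h x. frechet_derivative (P h) (at x) b
         + \<i> * (P h x * of_real (frechet_derivative (S h) (at x) b)))"
      by (intro bounded_smooth_add bounded_smooth_deriv[OF P(2) b] P(2) bounded_smooth_mult bounded_smooth_const
           bounded_smooth_linear[OF bounded_linear_of_real Sb])
    thus "\<exists>F'\<in>?X. \<forall>h\<in>?I. \<forall>x. frechet_derivative (F h) (at x) b = F' h x"
      using frechet_derivative_at[OF der, symmetric]
      by (intro bexI[of _ "\<lambda>h x. (frechet_derivative (P h) (at x) b
         + \<i> * (P h x * of_real (frechet_derivative (S h) (at x) b))) * ?E h x"]) auto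
  qed
qed

text \<open>Near \<open>x\<close> the phase is \<open>S x + Im (Ln (a y * cnj (a x)))\<close>: the
  argument of \<open>Ln\<close> is close to 1, away from the branch cut, where \<open>Ln\<close> has
  derivative the identity. Thus a merely continuous lift inherits differentiability from
  \<open>a\<close>.\<close>

lemma has_derivative_phase:
  fixes S :: "'a::euclidean_space \<Rightarrow> real"
  assumes cont: "continuous_on UNIV S" and a: "\<And>y. a y = exp (\<i> * of_real (S y))"
    and der: "(a has_derivative a') (at x)"
  shows "(S has_derivative (\<lambda>v. Im (cnj (a x) * a' v))) (at x)"
proof -
  let ?f = "\<lambda>y. a y * cnj (a x)"
  have f: "?f y = exp (\<i> * of_real (S y - S x))" for y
    by (simp add: a exp_cnj flip: exp_add) (simp add: algebra_simps)
  have fx: "?f x = 1" by (simp add: f)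
  have 1: "(?f has_derivative (\<lambda>v. a' v * cnj (a x))) (at x)"
    by (intro has_derivative_mult_left der)
  have "(Ln has_field_derivative inverse (?f x)) (at (?f x))"
    by (rule has_field_derivative_Ln) (simp add: fx)
  hence 2: "(Ln has_derivative (\<lambda>v. v)) (at (?f x))"
    by (simp add: has_field_derivative_def fx mult_1_left[abs_def])
  have 3: "((\<lambda>y. S x + Im (Ln (?f y))) has_derivative (\<lambda>v. Im (cnj (a x) * a' v))) (at x)"
    by (rule has_derivative_eq_rhs[OF has_derivative_add[OF has_derivative_const
          bounded_linear.has_derivative[OF bounded_linear_Im has_derivative_compose[OF 1 2]]]])
       (simp add: mult.commute)
  \<comment> \<open>Continuity keeps the increment of \<open>S\<close> below \<open>pi\<close>, so
    the principal logarithm returns this increment itself and not a translate by 2 pi.\<close>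
  have "isCont S x" using cont by (simp add: continuous_on_eq_continuous_at)
  hence "\<forall>\<^sub>F y in at x. \<bar>S y - S x\<bar> < pi"
    using pi_gt_zero unfolding isCont_def tendsto_iff dist_real_def by blast
  hence "\<forall>\<^sub>F y in at x. S x + Im (Ln (?f y)) = S y"
  proof eventually_elim
    case (elim y)
    thus ?case unfolding f by (subst Ln_exp) auto
  qed
  thus ?thesis
    using has_derivative_transform_eventually[OF 3] by (simp add: fx)
qed

text \<open>Contractibility of the domain gives a continuous logarithm for each fixed
  \<open>h\<close>. These choices are unrelated for different \<open>h\<close>; uniformity is needed
  only for the derivatives, which the formula for \<open>dS\<close> expresses through the uniformly
  bounded family \<open>a\<close>.\<close>

lemma phase_lift:
  fixes a :: "real \<Rightarrow> 'a::euclidean_space \<Rightarrow> complex"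
  assumes a: "bounded_smooth {0<..h0} a" and norm: "\<And>h x. h \<in> {0<..h0} \<Longrightarrow> norm (a h x) = 1"
  obtains S where "S \<in> phase_space h0"
    "\<And>h x. h \<in> {0<..h0} \<Longrightarrow> a h x = exp (\<i> * of_real (S h x))"
proof -
  let ?I = "{0<..h0}"
  have "\<exists>S. continuous_on UNIV S \<and> (\<forall>x. a h x = exp (\<i> * of_real (S x)))" if h: "h \<in> ?I" for h
  proof -
    have "continuous_on UNIV (a h)"
      using bounded_smooth_differentiable[OF a h] by (meson differentiable_imp_continuous_on differentiable_on_def differentiable_at_withinI)
    moreover have "a h x \<noteq> 0" for x using norm[OF h, of x] by auto
    moreover have "contractible (UNIV :: 'a set)" by simp
    ultimately obtain g where g: "continuous_on UNIV g" "\<And>x. a h x = exp (g x)"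
      using continuous_logarithm_on_contractible[of UNIV "a h"] by auto
    have "Re (g x) = 0" for x using norm[OF h, of x] g(2)[of x] by simp
    hence "g x = \<i> * of_real (Im (g x))" for x by (simp add: complex_eq_iff)
    hence "a h x = exp (\<i> * of_real (Im (g x)))" for x using g(2) by metis
    moreover have "continuous_on UNIV (\<lambda>x. Im (g x))" by (intro continuous_intros g)
    ultimately show ?thesis by blast
  qed
  hence "\<exists>S. \<forall>h\<in>?I. continuous_on UNIV (S h) \<and> (\<forall>x. a h x = exp (\<i> * of_real (S h x)))"
    by (intro bchoice ballI)
  then obtain S where S: "\<And>h. h \<in> ?I \<Longrightarrow> continuous_on UNIV (S h)"
     "\<And>h x. h \<in> ?I \<Longrightarrow> a h x = exp (\<i> * of_real (S h x))" by blast
  have der: "(S h has_derivative (\<lambda>v. Im (cnj (a h x) * frechet_derivative (a h) (at x) v))) (at x)"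
    if "h \<in> ?I" for h x
    by (rule has_derivative_phase[OF S(1) S(2) bounded_smooth_has_derivative[OF a]]) (use that in auto)
  have "S \<in> phase_space h0"
    unfolding phase_space_iff
  proof (intro conjI ballI allI)
    show "S h differentiable at x" if "h \<in> ?I" for h x using der[OF that] by (rule differentiableI)
    fix b :: 'a assume "b \<in> Basis"
    hence "bounded_smooth ?I (\<lambda>h x. Im (cnj (a h x) * frechet_derivative (a h) (at x) b))"
      by (intro bounded_smooth_linear[OF bounded_linear_Im] bounded_smooth_mult bounded_smooth_deriv[OF a]
           bounded_smooth_linear[OF bounded_linear_cnj a])
    thus "bounded_smooth ?I (\<lambda>h x. frechet_derivative (S h) (at x) b)"
      by (rule bounded_smooth_cong) (simp add: frechet_derivative_at[OF der, symmetric])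
  qed
  thus ?thesis using that[of S] S(2) by blast
qed

section \<open>Volume-preserving diffeomorphisms preserve Lebesgue measure\<close>

text \<open>The change of variables theorems of HOL-Analysis need a well-ordered index type. The type
  \<open>'a wo\<close> is a copy of the finite type \<open>'a\<close>, ordered by an enumeration.\<close>

typedef 'a wo = "UNIV :: 'a set"
  by auto

instantiation wo :: (finite) wellorder
begin

definition "x \<le> y \<longleftrightarrow> to_nat (Rep_wo x) \<le> to_nat (Rep_wo y)"
definition "x < y \<longleftrightarrow> to_nat (Rep_wo x) < to_nat (Rep_wo y)"

instance
  apply intro_classes
      apply (auto simp: less_eq_wo_def less_wo_def Rep_wo_inject)
  subgoal premises p for P a
    using p by (induction "to_nat (Rep_wo a)" arbitrary: a rule: less_induct) blast
  done

end

instance wo :: (finite) finite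
proof
  have "(UNIV :: 'a wo set) = range Abs_wo"
    by (metis Abs_wo_cases surjI UNIV_I Rep_wo_inverse)
  thus "finite (UNIV :: 'a wo set)" by (metis finite finite_imageI)
qed

lemma bij_Rep_wo: "bij Rep_wo"
  by (rule o_bij[where g=Abs_wo]) (auto simp: fun_eq_iff Rep_wo_inverse Abs_wo_inverse)

section \<open>Relabelling of coordinates\<close>

definition reindex :: "('n \<Rightarrow> 'd) \<Rightarrow> real^'d \<Rightarrow> real^'n" where
  "reindex e x = (\<chi> i. x $ e i)"

lemma bounded_linear_reindex:
  fixes e :: "'n::finite \<Rightarrow> 'd::finite"
  shows "bounded_linear (reindex e)"
  unfolding reindex_def[abs_def]
  by (simp add: linear_conv_bounded_linear [symmetric] linear_iff vec_eq_iff)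

lemma continuous_reindex: "continuous_on S (reindex e)"
  by (rule bounded_linear.continuous_on[OF bounded_linear_reindex continuous_on_id])

lemma measurable_reindex [measurable]: "reindex e \<in> borel \<rightarrow>\<^sub>M borel"
  by (rule borel_measurable_continuous_onI[OF continuous_reindex])

lemma reindex_inverse: "bij e \<Longrightarrow> reindex (inv_into UNIV e) (reindex e x) = x" "bij e \<Longrightarrow> reindex e (reindex (inv_into UNIV e) y) = y"
  by (auto simp: reindex_def vec_eq_iff bij_is_surj surj_f_inv_f bij_is_inj)

text \<open>In the Leibniz expansion, transport along \<open>e\<close> is a sign-preserving
  bijection between the permutations of the two index types.\<close>

lemma det_reindex:
  fixes A :: "real^'d^'d" and e :: "'n::finite \<Rightarrow> 'd"
  assumes e: "bij e"
  shows "det (\<chi> i j. A $ e i $ e j) = det A"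
proof -
  have inj: "inj e" using e by (rule bij_is_inj)
  have bij: "bij_betw (map_permutation UNIV e) {p. p permutes UNIV} {p. p permutes UNIV}"
  proof -
    have "bij_betw (\<lambda>\<pi> x. if x \<in> UNIV then e (\<pi> (inv_into UNIV e x)) else x)
             {\<pi>. \<pi> permutes UNIV} {\<pi>. \<pi> permutes UNIV}"
      by (rule bij_betw_permutations) (use e in simp)
    also have "(\<lambda>\<pi> x. if x \<in> UNIV then e (\<pi> (inv_into UNIV e x)) else x) = map_permutation UNIV e"
      using e by (auto simp: fun_eq_iff map_permutation_def restrict_id_def bij_is_surj)
    finally show ?thesis .
  qed
  have "det A = (\<Sum>p\<in>{p. p permutes UNIV}. of_int (sign (map_permutation UNIV e p))
          * (\<Prod>i\<in>UNIV. A $ i $ (map_permutation UNIV e p i)))"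
    unfolding det_def by (rule sum.reindex_bij_betw[OF bij, symmetric])
  also have "\<dots> = (\<Sum>p\<in>{p. p permutes UNIV}. of_int (sign p) * (\<Prod>i\<in>UNIV. A $ e i $ e (p i)))"
  proof (rule sum.cong[OF refl])
    fix p :: "'n \<Rightarrow> 'n" assume p: "p \<in> {p. p permutes UNIV}"
    have "(\<Prod>i\<in>UNIV. A $ i $ (map_permutation UNIV e p i))
        = (\<Prod>i\<in>UNIV. A $ e i $ (map_permutation UNIV e p (e i)))"
      by (rule prod.reindex_bij_betw[OF e, symmetric])
    thus "of_int (sign (map_permutation UNIV e p)) * (\<Prod>i\<in>UNIV. A $ i $ (map_permutation UNIV e p i))
       = of_int (sign p) * (\<Prod>i\<in>UNIV. A $ e i $ e (p i))"
      using p inj by (simp add: map_permutation_apply sign_map_permutation)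
  qed
  finally show ?thesis by (simp add: det_def)
qed

lemma prod_Basis_cart: "(\<Prod>b\<in>(Basis :: (real^'n) set). f b) = (\<Prod>i\<in>UNIV. f (axis i 1))"
proof -
  have "(Basis :: (real^'n) set) = range (\<lambda>i. axis i 1)" by (auto simp: Basis_vec_def)
  moreover have "inj (\<lambda>i::'n. axis i (1::real))" by (simp add: inj_def axis_eq_axis)
  ultimately show ?thesis using prod.reindex[of "\<lambda>i::'n. axis i (1::real)" UNIV f] by (simp only: o_def)
qed

lemma emeasure_box_cart:
  fixes l u :: "real^'n"
  assumes "\<And>i. l $ i \<le> u $ i"
  shows "emeasure lborel (box l u) = (\<Prod>i\<in>UNIV. ennreal (u $ i - l $ i))"
proof -
  have "l \<bullet> b \<le> u \<bullet> b" if "b \<in> Basis" for b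
    using that assms by (auto simp: Basis_vec_def inner_axis)
  thus ?thesis using assms
    by (simp add: emeasure_lborel_box_eq prod_Basis_cart inner_axis prod_ennreal)
qed

text \<open>The preimage of a box is a box with permuted side lengths, and boxes determine
  \<open>lborel\<close>.\<close>

lemma distr_reindex:
  fixes e :: "'n::finite \<Rightarrow> 'd::finite"
  assumes e: "bij e"
  shows "distr lborel borel (reindex e) = lborel"
proof (rule lborel_eqI[symmetric])
  fix l u :: "real^'n"
  assume "\<And>b. b \<in> Basis \<Longrightarrow> l \<bullet> b \<le> u \<bullet> b"
  hence le: "l $ i \<le> u $ i" for i
    by (metis axis_in_Basis_iff Basis_real_def cart_eq_inner_axis insertI1)
  have eq: "reindex e -` box l u = box (reindex (inv_into UNIV e) l) (reindex (inv_into UNIV e) u)"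
  proof -
    have "(\<forall>i. l $ i < x $ e i \<and> x $ e i < u $ i) \<longleftrightarrow> (\<forall>i. l $ inv_into UNIV e i < x $ i \<and> x $ i < u $ inv_into UNIV e i)" for x
      using e by (metis bij_inv_eq_iff)
    thus ?thesis by (auto simp: mem_box_cart reindex_def)
  qed
  have "emeasure (distr lborel borel (reindex e)) (box l u) = emeasure lborel (reindex e -` box l u)"
    by (subst emeasure_distr) auto
  also have "\<dots> = (\<Prod>i\<in>UNIV. ennreal (u $ inv_into UNIV e i - l $ inv_into UNIV e i))"
    unfolding eq using le by (auto simp: emeasure_box_cart reindex_def)
  also have "\<dots> = (\<Prod>i\<in>UNIV. ennreal (u $ i - l $ i))"
    by (rule prod.reindex_bij_betw) (rule bij_imp_bij_inv[OF e])
  also have "\<dots> = (\<Prod>b\<in>Basis. (u - l) \<bullet> b)"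
    using le by (simp add: prod_Basis_cart inner_axis prod_ennreal)
  finally show "emeasure (distr lborel borel (reindex e)) (box l u) = (\<Prod>b\<in>Basis. (u - l) \<bullet> b)" .
qed auto

lemma emeasure_reindex_image:
  fixes e :: "'n::finite \<Rightarrow> 'd::finite"
  assumes e: "bij e" and X: "X \<in> sets borel"
  shows "reindex e ` X \<in> sets borel" "emeasure lborel (reindex e ` X) = emeasure lborel X"
proof -
  have eq: "reindex e ` X = reindex (inv_into UNIV e) -` X"
    by (auto simp: reindex_inverse[OF e] image_iff) (metis reindex_inverse(2)[OF e])
  show "reindex e ` X \<in> sets borel"
    unfolding eq by (rule measurable_sets_borel[OF measurable_reindex X])
  have "emeasure lborel X = emeasure (distr lborel borel (reindex (inv_into UNIV e))) X"
    using distr_reindex[OF bij_imp_bij_inv[OF e]] by simp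
  also have "\<dots> = emeasure lborel (reindex e ` X)"
    unfolding eq using X by (subst emeasure_distr) auto
  finally show "emeasure lborel (reindex e ` X) = emeasure lborel X" ..
qed

section \<open>Change of variables with Jacobian of modulus one\<close>

text \<open>The change of variables formula gives the measure of the image as the integral of the
  Jacobian modulus, here 1. Boxes suffice to identify \<open>lborel\<close>; the hypothesis
  \<open>borel\<close> allows the passage from Lebesgue measure back to
  \<open>lborel\<close>.\<close>

lemma emeasure_image_box_wo:
  fixes f :: "real^'n::{finite,wellorder} \<Rightarrow> real^'n::_"
  assumes der: "\<And>x. (f has_derivative f' x) (at x)"
    and det: "\<And>x. \<bar>det (matrix (f' x))\<bar> = 1" and inj: "inj f"
    and borel: "f ` box l u \<in> sets borel"
  shows "emeasure lborel (f ` box l u) = emeasure lborel (box l u)"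
proof -
  have "f ` box l u \<in> lmeasurable \<and> measure lebesgue (f ` box l u) = measure lebesgue (box l u)"
  proof (subst has_measure_differentiable_image)
    show "((\<lambda>x. \<bar>det (matrix (f' x))\<bar>) has_integral measure lebesgue (box l u)) (box l u)"
      using det has_integral_measure_lborel[of "box l u"] emeasure_lborel_box_finite[of l u] by simp
    show "(f has_derivative f' x) (at x within box l u)" for x
      using der has_derivative_at_withinI by blast
    show "inj_on f (box l u)" using inj by (rule inj_on_subset) auto
  qed auto
  hence "emeasure lebesgue (f ` box l u) = emeasure lebesgue (box l u)"
    by (metis emeasure_eq_measure2 lmeasurable_box)
  thus ?thesis using borel by simp
qed

text \<open>The Jacobian hypothesis concerns the inverse \<open>g\<close>, since the pushforward
  along \<open>f\<close> measures preimages under \<open>f\<close>, which are images under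
  \<open>g\<close>. For an action, \<open>g\<close> is the diffeomorphism whose Jacobian is given
  and \<open>f\<close> is its inverse.\<close>

lemma distr_lborel_volume_preserving:
  fixes f g :: "real^'d \<Rightarrow> real^'d"
  assumes gf: "\<And>x. g (f x) = x" and fg: "\<And>x. f (g x) = x"
    and f[measurable]: "f \<in> borel \<rightarrow>\<^sub>M borel"
    and der: "\<And>x. (g has_derivative g' x) (at x)"
    and det: "\<And>x. \<bar>det (matrix (g' x))\<bar> = 1"
  shows "distr lborel borel f = lborel"
proof (rule lborel_eqI[symmetric])
  fix l u :: "real^'d"
  assume le: "\<And>b. b \<in> Basis \<Longrightarrow> l \<bullet> b \<le> u \<bullet> b"
  define e where "e = (Rep_wo :: 'd wo \<Rightarrow> 'd)"
  have e: "bij e" unfolding e_def by (rule bij_Rep_wo)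
  define R where "R = reindex e"
  define R' where "R' = reindex (inv_into UNIV e)"
  have RR: "R (R' y) = y" "R' (R x) = x" for x y
    unfolding R_def R'_def by (auto simp: reindex_inverse[OF e])
  \<comment> \<open>Conjugating \<open>g\<close> by the relabelling gives a map over a well-ordered
    index type. Its Jacobian matrix is that of \<open>g\<close> with rows and columns relabelled
    alike, so the determinant is unchanged.\<close>
  define G where "G = (\<lambda>x. R (g (R' x)))"
  have RG: "R ` g ` box l u = G ` R ` box l u"
    unfolding G_def by (auto simp: image_iff RR)
  have gb: "g ` box l u = f -` box l u"
    using gf fg by (auto simp: image_iff) metis
  have gbm: "g ` box l u \<in> sets borel"
    unfolding gb using measurable_sets_borel[OF f] by auto
  have Rbox: "R ` box l u = box (R l) (R u)"
  proof (intro equalityI subsetI)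
    fix y assume "y \<in> box (R l) (R u)"
    hence "R' y \<in> box l u"
      using e unfolding R_def R'_def by (simp add: mem_box_cart reindex_def) (metis bij_inv_eq_iff)
    thus "y \<in> R ` box l u" by (metis RR(1) imageI)
  qed (auto simp: mem_box_cart R_def reindex_def)
  have "emeasure lborel (g ` box l u) = emeasure lborel (R ` g ` box l u)"
    unfolding R_def by (rule emeasure_reindex_image(2)[OF e gbm, symmetric])
  also have "\<dots> = emeasure lborel (G ` box (R l) (R u))"
    unfolding RG Rbox ..
  also have "\<dots> = emeasure lborel (box (R l) (R u))"
  proof (rule emeasure_image_box_wo)
    show "(G has_derivative (\<lambda>v. R (g' (R' x) (R' v)))) (at x)" for x
      unfolding G_def R_def R'_def
      by (rule bounded_linear.has_derivative[OF bounded_linear_reindex]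
          has_derivative_compose[OF bounded_linear_imp_has_derivative[OF bounded_linear_reindex] der])+
    show "inj G" unfolding G_def by (rule injI) (metis RR gf fg)
    show "G ` box (R l) (R u) \<in> sets borel"
      unfolding Rbox[symmetric] RG[symmetric] unfolding R_def
      by (rule emeasure_reindex_image(1)[OF e gbm])
    fix x
    have ax: "R' (axis j 1) = axis (e j) 1" for j
      using e by (auto simp: R'_def reindex_def axis_def vec_eq_iff) (metis bij_inv_eq_iff)+
    have "matrix (\<lambda>v. R (g' (R' x) (R' v))) = (\<chi> i j. matrix (g' (R' x)) $ e i $ e j)"
      by (simp add: matrix_def vec_eq_iff ax) (simp add: R_def reindex_def)
    thus "\<bar>det (matrix (\<lambda>v. R (g' (R' x) (R' v))))\<bar> = 1"
      using det det_reindex[OF e] by simp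
  qed
  also have "\<dots> = emeasure lborel (box l u)"
    unfolding Rbox[symmetric] unfolding R_def by (rule emeasure_reindex_image(2)[OF e]) simp
  also have "\<dots> = (\<Prod>b\<in>Basis. (u - l) \<bullet> b)" using le by (simp add: emeasure_lborel_box)
  finally show "emeasure (distr lborel borel f) (box l u) = (\<Prod>b\<in>Basis. (u - l) \<bullet> b)"
    by (subst emeasure_distr) (auto simp: gb)
qed auto

section \<open>Schwartz functions\<close>

lemma product_sigma_finite_lborel: "product_sigma_finite (\<lambda>b::'i. lborel :: real measure)"
  by (simp add: product_sigma_finite_def sigma_finite_lborel)

text \<open>Fubini for functions that factor over coordinates. It serves both the integrable weight
  below and the Gaussian integrals.\<close>

lemma
  fixes g :: "'a::euclidean_space \<Rightarrow> real \<Rightarrow> 'c::{real_normed_field,banach,second_countable_topology}"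
  assumes g: "\<And>b. b \<in> Basis \<Longrightarrow> integrable lborel (g b)"
  shows integrable_lborel_prod: "integrable lborel (\<lambda>x. \<Prod>b\<in>Basis. g b (x \<bullet> b))"
    and integral_lborel_prod: "(LINT x|lborel. (\<Prod>b\<in>Basis. g b (x \<bullet> b))) = (\<Prod>b\<in>Basis. (LINT t|lborel. g b t))"
proof -
  interpret product_sigma_finite "\<lambda>b::'a. lborel :: real measure"
    by (rule product_sigma_finite_lborel)
  have m: "(\<lambda>f. \<Sum>b\<in>(Basis :: 'a set). f b *\<^sub>R b) \<in> (\<Pi>\<^sub>M b\<in>(Basis :: 'a set). lborel) \<rightarrow>\<^sub>M borel"
    by measurable
  have [measurable]: "b \<in> Basis \<Longrightarrow> g b \<in> borel_measurable borel" for b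
    using borel_measurable_integrable[OF g[of b]] by simp
  have g2: "(\<lambda>x. \<Prod>b\<in>(Basis :: 'a set). g b (x \<bullet> b)) \<in> borel_measurable borel"
    by measurable
  have eq: "(\<Prod>b\<in>Basis. g b ((\<Sum>b'\<in>(Basis :: 'a set). f b' *\<^sub>R b') \<bullet> b)) = (\<Prod>b\<in>Basis. g b (f b))" for f
    by (intro prod.cong refl) simp
  show "integrable lborel (\<lambda>x. \<Prod>b\<in>Basis. g b (x \<bullet> b))"
    by (subst lborel_eq, subst integrable_distr_eq[OF m g2], unfold eq)
       (rule product_integrable_prod[OF finite_Basis g])
  show "(LINT x|lborel. (\<Prod>b\<in>Basis. g b (x \<bullet> b))) = (\<Prod>b\<in>Basis. (LINT t|lborel. g b t))"
    by (subst lborel_eq, subst integral_distr[OF m g2], unfold eq)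
       (rule product_integral_prod[OF finite_Basis g])
qed

text \<open>The weight \<open>1 + norm x\<close> is never zero, so one condition gives boundedness
  and decay at infinity together.\<close>

definition decays :: "nat \<Rightarrow> ('a::real_normed_vector \<Rightarrow> 'b::real_normed_vector) \<Rightarrow> bool" where
  "decays k f \<longleftrightarrow> (\<exists>C. \<forall>x. (1 + norm x) ^ k * norm (f x) \<le> C)"

lemma one_plus_power_le: "(1 + t) ^ k \<le> 2 ^ k * (1 + t ^ k)" if "t \<ge> 0" for t :: real
proof -
  have "(1 + t) ^ k \<le> (2 * max 1 t) ^ k" using that by (intro power_mono) auto
  also have "\<dots> = 2 ^ k * max 1 t ^ k" by (simp add: power_mult_distrib)
  also have "max 1 t ^ k \<le> 1 + t ^ k" using that by (cases "t \<le> 1") (auto simp: max_def)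
  finally show ?thesis by simp
qed

lemma decaysI:
  assumes "\<And>x. norm (f x) \<le> C" "\<And>x. norm x ^ k * norm (f x) \<le> D"
  shows "decays k f"
  unfolding decays_def
proof (intro exI allI)
  fix x
  have "(1 + norm x) ^ k * norm (f x) \<le> 2 ^ k * (1 + norm x ^ k) * norm (f x)"
    by (intro mult_right_mono one_plus_power_le) auto
  also have "\<dots> = 2 ^ k * (norm (f x) + norm x ^ k * norm (f x))" by (simp add: algebra_simps)
  also have "\<dots> \<le> 2 ^ k * (C + D)" by (intro mult_left_mono add_mono assms) auto
  finally show "(1 + norm x) ^ k * norm (f x) \<le> 2 ^ k * (C + D)" .
qed

lemma decays_bounded: "decays k f \<Longrightarrow> \<exists>C. \<forall>x. norm (f x) \<le> C"
proof -
  assume "decays k f"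
  then obtain C where C: "\<And>x. (1 + norm x) ^ k * norm (f x) \<le> C" unfolding decays_def by auto
  have "norm (f x) \<le> C" for x
  proof -
    have "1 * norm (f x) \<le> (1 + norm x) ^ k * norm (f x)" by (intro mult_right_mono) auto
    thus ?thesis using C[of x] by simp
  qed
  thus ?thesis by auto
qed

lemma decays_add:
  assumes "decays k f" "decays k g" shows "decays k (\<lambda>x. f x + g x)"
proof -
  obtain C D where C: "\<And>x. (1 + norm x) ^ k * norm (f x) \<le> C" and D: "\<And>x. (1 + norm x) ^ k * norm (g x) \<le> D"
    using assms unfolding decays_def by auto
  have "(1 + norm x) ^ k * norm (f x + g x) \<le> C + D" for x
  proof -
    have "(1 + norm x) ^ k * norm (f x + g x) \<le> (1 + norm x) ^ k * (norm (f x) + norm (g x))"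
      by (intro mult_left_mono norm_triangle_ineq) auto
    thus ?thesis using C[of x] D[of x] by (simp add: algebra_simps)
  qed
  thus ?thesis unfolding decays_def by auto
qed

lemma decays_bounded_mult:
  fixes f :: "'a::real_normed_vector \<Rightarrow> complex"
  assumes "decays k f" "\<And>x. norm (g x) \<le> B" shows "decays k (\<lambda>x. g x * f x)"
proof -
  obtain C where C: "\<And>x. (1 + norm x) ^ k * norm (f x) \<le> C" using assms unfolding decays_def by auto
  have "(1 + norm x) ^ k * norm (g x * f x) \<le> B * C" for x
  proof -
    have "(1 + norm x) ^ k * norm (g x * f x) = norm (g x) * ((1 + norm x) ^ k * norm (f x))"
      by (simp add: norm_mult)
    also have "\<dots> \<le> B * C" using C[of x] assms(2)[of x]
      by (intro mult_mono) (auto intro: order_trans[OF norm_ge_zero])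
    finally show ?thesis .
  qed
  thus ?thesis unfolding decays_def by auto
qed

lemma integrable_inverse_Lorentz: "integrable lborel (\<lambda>x::real. inverse (1 + x\<^sup>2))"
  using integrable_inverse_1_plus_square by (simp add: set_integrable_def)

text \<open>Each coordinate satisfies \<open>1 + (x \<bullet> b)^2 \<le> (1 + norm x)^2\<close>, so
  the exponent \<open>2 * DIM('a)\<close> makes the weight smaller than a product of one-dimensional
  Lorentz functions.\<close>

lemma integrable_weight: "integrable lborel (\<lambda>x::'a::euclidean_space. inverse ((1 + norm x) ^ (2 * DIM('a))))"
proof (rule Bochner_Integration.integrable_bound)
  show "integrable lborel (\<lambda>x::'a. \<Prod>b\<in>Basis. inverse (1 + (x \<bullet> b)\<^sup>2))"
    by (intro integrable_lborel_prod integrable_inverse_Lorentz)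
  show "(\<lambda>x::'a. inverse ((1 + norm x) ^ (2 * DIM('a)))) \<in> borel_measurable lborel" by measurable
  show "AE x::'a in lborel. norm (inverse ((1 + norm x) ^ (2 * DIM('a))))
      \<le> norm (\<Prod>b\<in>Basis. inverse (1 + (x \<bullet> b)\<^sup>2))"
  proof (rule AE_I2)
    fix x :: 'a
    have pos: "0 < (\<Prod>b\<in>(Basis::'a set). 1 + (x \<bullet> b)\<^sup>2)" by (intro prod_pos) (auto intro: add_pos_nonneg)
    have "(\<Prod>b\<in>(Basis::'a set). 1 + (x \<bullet> b)\<^sup>2) \<le> (\<Prod>b\<in>(Basis::'a set). (1 + norm x)\<^sup>2)"
    proof (intro prod_mono conjI)
      fix b :: 'a assume b: "b \<in> Basis"
      have "(x \<bullet> b)\<^sup>2 \<le> (norm x)\<^sup>2" by (rule abs_le_square_iff[THEN iffD1]) (simp add: Basis_le_norm[OF b])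
      thus "1 + (x \<bullet> b)\<^sup>2 \<le> (1 + norm x)\<^sup>2" using norm_ge_zero[of x] by (simp add: power2_sum del: norm_ge_zero)
    qed auto
    also have "\<dots> = (1 + norm x) ^ (2 * DIM('a))" by (simp add: power_mult)
    finally have "inverse ((1 + norm x) ^ (2 * DIM('a))) \<le> inverse (\<Prod>b\<in>(Basis::'a set). 1 + (x \<bullet> b)\<^sup>2)"
      using pos by (rule le_imp_inverse_le)
    also have "\<dots> = (\<Prod>b\<in>(Basis::'a set). inverse (1 + (x \<bullet> b)\<^sup>2))"
      using prod_inversef[of "\<lambda>b. 1 + (x \<bullet> b)\<^sup>2" Basis] by (simp add: o_def)
    also have "\<dots> \<le> norm (\<Prod>b\<in>(Basis::'a set). inverse (1 + (x \<bullet> b)\<^sup>2))" by (simp only: real_norm_def abs_ge_self)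
    finally show "norm (inverse ((1 + norm x) ^ (2 * DIM('a)))) \<le> norm (\<Prod>b\<in>Basis. inverse (1 + (x \<bullet> b)\<^sup>2))"
      by simp
  qed
qed

lemma decays_weight:
  assumes "decays k f"
  obtains C where "C \<ge> 0" "\<And>x. norm (f x) \<le> C * inverse ((1 + norm x) ^ k)"
proof -
  obtain C where C: "\<And>x. (1 + norm x) ^ k * norm (f x) \<le> C" using assms unfolding decays_def by auto
  have "0 < 1 + norm x" for x :: 'a by (simp add: add_pos_nonneg)
  hence "norm (f x) \<le> C * inverse ((1 + norm x) ^ k)" for x
    using C[of x] by (simp add: field_simps)
  moreover have "C \<ge> 0" using order_trans[OF _ C[of 0]] by simp
  ultimately show ?thesis using that by blast
qed

lemma integrable_decays:
  fixes f :: "'a::euclidean_space \<Rightarrow> 'b::{banach,second_countable_topology}"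
  assumes f: "f \<in> borel_measurable borel" and d: "decays (2 * DIM('a)) f"
  shows "integrable lborel f"
proof -
  obtain C where C: "C \<ge> 0" "\<And>x. norm (f x) \<le> C * inverse ((1 + norm x) ^ (2 * DIM('a)))"
    using decays_weight[OF d] by metis
  show ?thesis
  proof (rule Bochner_Integration.integrable_bound)
    show "integrable lborel (\<lambda>x::'a. C * inverse ((1 + norm x) ^ (2 * DIM('a))))"
      by (intro integrable_mult_right integrable_weight)
    show "AE x in lborel. norm (f x) \<le> norm (C * inverse ((1 + norm x) ^ (2 * DIM('a))))"
      using C by (intro AE_I2) (auto simp: abs_mult add_nonneg_nonneg)
  qed (use f in auto)
qed

section \<open>Integrability and coinduction for Schwartz functions\<close>

lemma schwartz_decays:
  assumes "schwartz \<psi>" shows "decays k \<psi>"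
proof -
  have *: "\<exists>C. \<forall>x. norm x ^ k * norm (iter_deriv [] \<psi> x) \<le> C" for k
    using assms unfolding schwartz_def by (metis empty_subsetI list.set(1))
  obtain C D where "\<And>x. norm x ^ 0 * norm (iter_deriv [] \<psi> x) \<le> C" "\<And>x. norm x ^ k * norm (iter_deriv [] \<psi> x) \<le> D"
    using *[of 0] *[of k] by meson
  thus ?thesis by (intro decaysI[of _ C _ D]) auto
qed

lemma schwartz_deriv:
  assumes "schwartz \<psi>" "b \<in> Basis" shows "schwartz (\<lambda>x. frechet_derivative \<psi> (at x) b)"
  using assms unfolding schwartz_def smooth_def by (simp add: iter_deriv_snoc[symmetric])

lemma schwartz_has_derivative:
  assumes "schwartz \<psi>" shows "(\<psi> has_derivative frechet_derivative \<psi> (at x)) (at x)"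
proof -
  have "\<forall>vs. set vs \<subseteq> Basis \<longrightarrow> (\<forall>x. iter_deriv vs \<psi> differentiable at x)"
    using assms unfolding schwartz_def smooth_def by blast
  from spec[OF this, of "[]"] have "\<psi> differentiable at x" by simp
  thus ?thesis by (rule frechet_derivative_works[THEN iffD1])
qed

lemma schwartz_continuous: "schwartz \<psi> \<Longrightarrow> continuous_on UNIV \<psi>"
  by (intro continuous_at_imp_continuous_on ballI has_derivative_continuous[OF schwartz_has_derivative])

lemma schwartz_measurable: "schwartz \<psi> \<Longrightarrow> \<psi> \<in> borel_measurable borel"
  by (intro borel_measurable_continuous_onI schwartz_continuous)

lemma schwartz_integrable: "schwartz \<psi> \<Longrightarrow> integrable lborel \<psi>"
  by (intro integrable_decays schwartz_measurable schwartz_decays)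

lemma schwartz_L2: "schwartz \<psi> \<Longrightarrow> \<psi> \<in> L2"
proof -
  assume s: "schwartz \<psi>"
  note [measurable] = schwartz_measurable[OF s]
  obtain B where "\<And>x. norm (\<psi> x) \<le> B" using decays_bounded[OF schwartz_decays[OF s, of 0]] by auto
  hence "decays (2 * DIM('a)) (\<lambda>x. \<psi> x * \<psi> x)"
    by (intro decays_bounded_mult schwartz_decays[OF s])
  hence "integrable lborel (\<lambda>x. \<psi> x * \<psi> x)" by (intro integrable_decays) auto
  hence "integrable lborel (\<lambda>x. norm (\<psi> x * \<psi> x))" by (rule integrable_norm)
  thus ?thesis using schwartz_measurable[OF s] by (simp add: L2_def norm_mult power2_eq_square)
qed

lemma schwartz_coinduct:
  assumes "f \<in> X"
    and "\<And>f x. f \<in> X \<Longrightarrow> f differentiable at x"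
    and "\<And>f k. f \<in> X \<Longrightarrow> decays k f"
    and deriv: "\<And>f b. f \<in> X \<Longrightarrow> b \<in> Basis \<Longrightarrow> \<exists>f'\<in>X. \<forall>x. frechet_derivative f (at x) b = f' x"
  shows "schwartz f"
  unfolding schwartz_def smooth_def
proof (intro conjI allI impI)
  fix vs :: "'a list" assume vs: "set vs \<subseteq> Basis"
  \<comment> \<open>Families constant in a dummy parameter allow the closure argument for
    parametrized families to be reused.\<close>
  let ?Y = "{\<lambda>h::real. f |f. f \<in> X}"
  have "\<exists>F'\<in>?Y. \<forall>h\<in>UNIV. iter_deriv vs ((\<lambda>h. f) h) = F' h"
  proof (rule iter_deriv_in_closed_class[OF _ vs])
    show "(\<lambda>h. f) \<in> ?Y" using assms(1) by blast
    fix F b assume "F \<in> ?Y" "b \<in> (Basis :: 'a set)"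
    then obtain g where g: "F = (\<lambda>h. g)" "g \<in> X" by blast
    obtain g' where "g' \<in> X" "\<forall>x. frechet_derivative g (at x) b = g' x"
      using deriv[OF g(2) \<open>b \<in> Basis\<close>] by blast
    thus "\<exists>F'\<in>?Y. \<forall>h\<in>UNIV. \<forall>x. frechet_derivative (F h) (at x) b = F' h x"
      using g by (intro bexI[of _ "\<lambda>h. g'"]) auto
  qed
  then obtain f' where f': "f' \<in> X" "iter_deriv vs f = f'" by auto
  show "iter_deriv vs f differentiable at x" for x using f' assms(2) by simp
  fix k
  obtain C where C: "\<And>x. (1 + norm x) ^ k * norm (f' x) \<le> C"
    using assms(3)[OF f'(1)] unfolding decays_def by meson
  have "norm x ^ k * norm (iter_deriv vs f x) \<le> C" for x
  proof -
    have "norm x ^ k * norm (f' x) \<le> (1 + norm x) ^ k * norm (f' x)"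
      by (intro mult_right_mono power_mono) auto
    thus ?thesis using C[of x] f'(2) by simp
  qed
  thus "\<exists>C. \<forall>x. norm x ^ k * norm (iter_deriv vs f x) \<le> C" by blast
qed

lemma integral_affine:
  fixes f :: "'a::euclidean_space \<Rightarrow> 'b::{banach,second_countable_topology}"
  assumes c: "c \<noteq> 0" and f[measurable]: "f \<in> borel_measurable borel"
  shows "(LINT x|lborel. f x) = \<bar>c\<bar> ^ DIM('a) *\<^sub>R (LINT u|lborel. f (t + c *\<^sub>R u))"
proof -
  have "(LINT x|lborel. f x) = (LINT x|density (distr lborel borel (\<lambda>x. t + c *\<^sub>R x)) (\<lambda>_. ennreal (\<bar>c\<bar> ^ DIM('a))). f x)"
    using lborel_affine[OF c, of t] by (simp add: ennreal_power)
  also have "\<dots> = (LINT x|distr lborel borel (\<lambda>x. t + c *\<^sub>R x). \<bar>c\<bar> ^ DIM('a) *\<^sub>R f x)"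
    by (subst integral_density) auto
  also have "\<dots> = \<bar>c\<bar> ^ DIM('a) *\<^sub>R (LINT u|lborel. f (t + c *\<^sub>R u))"
    by (subst integral_distr) auto
  finally show ?thesis .
qed

section \<open>Gaussian polynomials and their approximation power\<close>

text \<open>Finite sums of products of linear forms with positive integer powers of the Gaussian.
  Stability under differentiation gives Schwartz functions; the \<open>exp\<close> clause
  additionally admits polynomials in the Gaussian itself, which is the form in which the
  Stone-Weierstrass approximants appear.\<close>

inductive gauss_poly :: "('a::euclidean_space \<Rightarrow> complex) \<Rightarrow> bool" where
  gauss: "gauss_poly (\<lambda>x. c * of_real (exp (- (x \<bullet> x))))"
| inner: "gauss_poly f \<Longrightarrow> gauss_poly (\<lambda>x. of_real (x \<bullet> v) * f x)"
| exp: "gauss_poly f \<Longrightarrow> gauss_poly (\<lambda>x. of_real (exp (- (x \<bullet> x))) * f x)"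
| add: "gauss_poly f \<Longrightarrow> gauss_poly g \<Longrightarrow> gauss_poly (\<lambda>x. f x + g x)"

lemma gauss_poly_cmult: "gauss_poly f \<Longrightarrow> gauss_poly (\<lambda>x. c * f x)"
proof (induction rule: gauss_poly.induct)
  case (gauss d)
  show ?case using gauss_poly.gauss[of "c * d"] by (simp add: mult.assoc)
next
  case (inner f v)
  show ?case using gauss_poly.inner[OF inner.IH, of v] by (simp add: mult.left_commute)
next
  case (exp f)
  show ?case using gauss_poly.exp[OF exp.IH] by (simp add: mult.left_commute)
next
  case (add f g)
  show ?case using gauss_poly.add[OF add.IH] by (simp add: distrib_left)
qed

text \<open>From \<open>1 + t \<le> 2 + t^2\<close> and \<open>(1 + s / k)^k \<le> exp s\<close>
  with \<open>s = 2 + t^2\<close>, the weight is at most \<open>k^k exp (2 + t^2)\<close>; the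
  Gaussian cancels \<open>exp (t^2)\<close>. The case \<open>k = 0\<close> is separate because of
  the division.\<close>

lemma decays_gauss: "decays k (\<lambda>x::'a::euclidean_space. c * complex_of_real (exp (- (x \<bullet> x))))"
  unfolding decays_def
proof (intro exI allI)
  fix x :: 'a
  let ?t = "norm x"
  have "?t \<le> 1 + ?t\<^sup>2" using sum_squares_bound[of 1 ?t] by (auto simp: power2_eq_square) (smt (verit) norm_ge_zero zero_le_square)
  hence "(1 + ?t) ^ k \<le> (2 + ?t\<^sup>2) ^ k" by (intro power_mono) auto
  also have "\<dots> \<le> real k ^ k * exp (2 + ?t\<^sup>2)"
  proof (cases "k = 0")
    case False
    have "((2 + ?t\<^sup>2) / k) ^ k \<le> (1 + (2 + ?t\<^sup>2) / k) ^ k" by (intro power_mono) auto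
    also have "\<dots> \<le> exp (2 + ?t\<^sup>2)"
      using False by (intro exp_ge_one_plus_x_over_n_power_n) (auto intro: order_trans[of _ 0])
    finally show ?thesis using False by (simp add: power_divide field_simps)
  qed (simp add: add_nonneg_nonneg)
  finally have "(1 + ?t) ^ k * exp (- (x \<bullet> x)) \<le> real k ^ k * exp (2 + ?t\<^sup>2) * exp (- (x \<bullet> x))"
    by (intro mult_right_mono) auto
  also have "\<dots> = real k ^ k * exp 2"
    by (simp add: power2_norm_eq_inner mult.assoc flip: exp_add)
  finally have "norm c * ((1 + ?t) ^ k * exp (- (x \<bullet> x))) \<le> norm c * (real k ^ k * exp 2)"
    by (intro mult_left_mono) auto
  thus "(1 + norm x) ^ k * norm (c * complex_of_real (exp (- (x \<bullet> x)))) \<le> norm c * (real k ^ k * exp 2)"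
    by (simp add: norm_mult mult_ac)
qed

lemma gauss_poly_decays: "gauss_poly f \<Longrightarrow> decays k f"
proof (induction arbitrary: k rule: gauss_poly.induct)
  case (gauss c)
  show ?case by (rule decays_gauss)
next
  case (inner f v)
  \<comment> \<open>A linear factor costs one power of the weight, which is why the induction leaves
    \<open>k\<close> arbitrary.\<close>
  obtain C where C: "\<And>x. (1 + norm x) ^ Suc k * norm (f x) \<le> C"
    using inner.IH[of "Suc k"] unfolding decays_def by auto
  have "(1 + norm x) ^ k * norm (of_real (x \<bullet> v) * f x) \<le> norm v * C" for x
  proof -
    have "\<bar>x \<bullet> v\<bar> \<le> norm x * norm v" by (rule Cauchy_Schwarz_ineq2)
    also have "\<dots> \<le> (1 + norm x) * norm v" by (intro mult_right_mono) auto
    finally have "(1 + norm x) ^ k * norm (f x) * \<bar>x \<bullet> v\<bar> \<le> (1 + norm x) ^ k * norm (f x) * ((1 + norm x) * norm v)"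
      by (intro mult_left_mono) auto
    also have "\<dots> = norm v * ((1 + norm x) ^ Suc k * norm (f x))" by (simp add: mult_ac)
    also have "\<dots> \<le> norm v * C" by (intro mult_left_mono C) auto
    finally show ?thesis by (simp add: norm_mult mult_ac)
  qed
  thus ?case unfolding decays_def by auto
next
  case (exp f)
  show ?case by (rule decays_bounded_mult[OF exp.IH, where B=1]) simp
next
  case (add f g)
  show ?case by (intro decays_add add.IH)
qed

lemma gauss_poly_deriv:
  assumes "gauss_poly f"
  shows "\<exists>f'. (\<forall>x. (f has_derivative f' x) (at x)) \<and> (\<forall>b. gauss_poly (\<lambda>x. f' x b))"
  using assms
proof (induction rule: gauss_poly.induct)
  case (gauss c)
  have "((\<lambda>x::'a. c * complex_of_real (exp (- (x \<bullet> x)))) has_derivative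
      (\<lambda>b. of_real (x \<bullet> b) * ((-2 * c) * of_real (exp (- (x \<bullet> x)))))) (at x)" for x
    by (auto intro!: derivative_eq_intros simp: inner_commute)
  thus ?case by (intro exI[of _ "\<lambda>x b. of_real (x \<bullet> b) * ((-2 * c) * of_real (exp (- (x \<bullet> x))))"] conjI allI
       gauss_poly.inner gauss_poly.gauss)
next
  case (inner f v)
  then obtain f' where f': "\<And>x. (f has_derivative f' x) (at x)" "\<And>b. gauss_poly (\<lambda>x. f' x b)" by auto
  have "((\<lambda>x. of_real (x \<bullet> v) * f x) has_derivative (\<lambda>b. of_real (x \<bullet> v) * f' x b + of_real (b \<bullet> v) * f x)) (at x)" for x
    by (auto intro!: derivative_eq_intros f')
  thus ?case by (intro exI[of _ "\<lambda>x b. of_real (x \<bullet> v) * f' x b + of_real (b \<bullet> v) * f x"] conjI allI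
      gauss_poly.add gauss_poly.inner f'(2) gauss_poly_cmult inner.hyps)
next
  case (exp f)
  then obtain f' where f': "\<And>x. (f has_derivative f' x) (at x)" "\<And>b. gauss_poly (\<lambda>x. f' x b)" by auto
  have "((\<lambda>x. of_real (exp (- (x \<bullet> x))) * f x) has_derivative (\<lambda>b. of_real (exp (- (x \<bullet> x))) * f' x b
      + of_real (x \<bullet> b) * (of_real (exp (- (x \<bullet> x))) * (-2 * f x)))) (at x)" for x
    by (auto intro!: derivative_eq_intros f' simp: inner_commute)
  thus ?case by (intro exI[of _ "\<lambda>x b. of_real (exp (- (x \<bullet> x))) * f' x b
      + of_real (x \<bullet> b) * (of_real (exp (- (x \<bullet> x))) * (-2 * f x))"] conjI allI
      gauss_poly.add gauss_poly.inner gauss_poly.exp f'(2) gauss_poly_cmult exp.hyps)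
next
  case (add f g)
  then obtain f' g' where f': "\<And>x. (f has_derivative f' x) (at x)" "\<And>b. gauss_poly (\<lambda>x. f' x b)"
    "\<And>x. (g has_derivative g' x) (at x)" "\<And>b. gauss_poly (\<lambda>x. g' x b)" by auto
  show ?case
    by (intro exI[of _ "\<lambda>x b. f' x b + g' x b"] conjI allI has_derivative_add gauss_poly.add f')
qed

lemma gauss_poly_schwartz:
  assumes "gauss_poly f" shows "schwartz f"
proof (rule schwartz_coinduct[where X="Collect gauss_poly"])
  fix f :: "'a \<Rightarrow> complex" assume "f \<in> Collect gauss_poly"
  then obtain f' where f': "\<And>x. (f has_derivative f' x) (at x)" "\<And>b. gauss_poly (\<lambda>x. f' x b)"
    using gauss_poly_deriv by blast
  show "f differentiable at x" for x using f'(1) by (rule differentiableI)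
  show "\<exists>f'\<in>Collect gauss_poly. \<forall>x. frechet_derivative f (at x) b = f' x" for b
    using f'(2) frechet_derivative_at[OF f'(1)] by (intro bexI[of _ "\<lambda>x. f' x b"]) auto
qed (use assms gauss_poly_decays in auto)

text \<open>With \<open>s = exp (- |x|^2)\<close>, a linear functional of \<open>(s, s x)\<close>
  equals \<open>s\<close> times an affine function of \<open>x\<close>. Hence each linear factor is
  absorbed by the clauses of \<open>gauss_poly\<close>, and products are handled by applying the
  induction hypothesis twice.\<close>

lemma gauss_poly_polynomial:
  assumes "real_polynomial_function p" "gauss_poly f"
  shows "gauss_poly (\<lambda>x. of_real (p (exp (- (x \<bullet> x)), exp (- (x \<bullet> x)) *\<^sub>R x)) * f x)"
  using assms
proof (induction arbitrary: f rule: real_polynomial_function.induct)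
  case (linear L)
  interpret L: bounded_linear L by fact
  \<comment> \<open>The Riesz vector of the functional \<open>L (0, _)\<close>.\<close>
  define c where "c = (\<Sum>b\<in>Basis. L (0, b) *\<^sub>R b)"
  have scale: "L (0, r *\<^sub>R b) = r * L (0, b)" for r b
    using L.scaleR[of r "(0, b)"] by simp
  have c: "L (0, x) = x \<bullet> c" for x
  proof -
    have "L (0, x) = L (\<Sum>b\<in>Basis. (x \<bullet> b) *\<^sub>R (0, b))"
      by (simp add: scaleR_prod_def sum_prod euclidean_representation)
    also have "\<dots> = (\<Sum>b\<in>Basis. (x \<bullet> b) * L (0, b))" by (simp add: L.sum scale)
    finally show ?thesis by (simp add: c_def inner_sum_right mult.commute)
  qed
  have "L (s, s *\<^sub>R x) = s * (L (1, 0) + x \<bullet> c)" for s x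
  proof -
    have "(s, s *\<^sub>R x) = s *\<^sub>R ((1, 0) + (0, x))" by simp
    hence "L (s, s *\<^sub>R x) = s *\<^sub>R (L (1, 0) + L (0, x))" by (metis L.add L.scaleR)
    thus ?thesis by (simp add: c)
  qed
  hence eq: "of_real (L (exp (- (x \<bullet> x)), exp (- (x \<bullet> x)) *\<^sub>R x)) * f x =
     of_real (exp (- (x \<bullet> x))) * (of_real (L (1, 0)) * f x + of_real (x \<bullet> c) * f x)" for x
    by (simp add: algebra_simps)
  show ?case unfolding eq
    by (intro gauss_poly.exp gauss_poly.add gauss_poly_cmult gauss_poly.inner linear.prems)
next
  case (const c)
  thus ?case by (rule gauss_poly_cmult)
next
  case (add p q)
  thus ?case by (simp add: distrib_right gauss_poly.add)
next
  case (mult p q)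
  show ?case using mult.IH(1)[OF mult.IH(2)[OF mult.prems]] by (simp add: mult.assoc)
qed

text \<open>In the coordinates \<open>(exp (- |x|\<^sup>2), exp (- |x|\<^sup>2) x)\<close> the function \<open>exp |x|\<^sup>2 f x\<close> extends
  continuously to a ball, where the Stone-Weierstrass theorem applies.\<close>

lemma continuous_approx_gauss_poly:
  fixes f :: "'a::euclidean_space \<Rightarrow> complex"
  assumes cont: "continuous_on UNIV f" and R: "R > 0" and supp: "\<And>x. norm x > R \<Longrightarrow> f x = 0"
    and e: "e > 0"
  obtains s where "gauss_poly s" "\<And>x. norm (f x - s x) \<le> e * exp (- (x \<bullet> x))"
proof -
  \<comment> \<open>In the coordinate \<open>s = exp (- |x|^2)\<close>, the support of
    \<open>f\<close> lies in \<open>s \<ge> \<eta>'\<close>. The gap below \<open>\<eta>'\<close>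
    leaves room for a continuous cutoff \<open>\<theta>\<close> that vanishes for
    \<open>s \<le> \<eta>\<close> and is 1 for \<open>s \<ge> \<eta>'\<close>.\<close>
  define \<eta> where "\<eta> = exp (- ((R + 1)\<^sup>2))"
  define \<eta>' where "\<eta>' = exp (- (R\<^sup>2))"
  have \<eta>: "0 < \<eta>" "\<eta> < \<eta>'" using R by (auto simp: \<eta>_def \<eta>'_def power2_sum)
  define \<theta> where "\<theta> s = max 0 (min 1 ((s - \<eta>) / (\<eta>' - \<eta>)))" for s
  \<comment> \<open>In essence \<open>F (s, w) = f (w / s) / s\<close>, so that
    \<open>F (s, s x)\<close> times \<open>s\<close> is \<open>f x\<close>. Replacing
    \<open>s\<close> by \<open>max s \<eta>\<close> and multiplying by the cutoff removes the
    singularity at \<open>s = 0\<close>.\<close>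
  define F where "F z = of_real (\<theta> (fst z) / max (fst z) \<eta>) * f (snd z /\<^sub>R max (fst z) \<eta>)" for z :: "real \<times> 'a"
  let ?v = "\<lambda>x::'a. (exp (- (x \<bullet> x)), exp (- (x \<bullet> x)) *\<^sub>R x)"
  have ne: "max s \<eta> \<noteq> 0" for s using \<eta> by (auto simp: max_def)
  have "continuous_on UNIV (\<lambda>z::real \<times> 'a. f (snd z /\<^sub>R max (fst z) \<eta>))"
    by (rule continuous_on_compose2[OF cont]) (use ne in \<open>auto intro!: continuous_intros\<close>)
  hence "continuous_on UNIV F"
    unfolding F_def \<theta>_def using ne \<eta> by (auto intro!: continuous_intros)
  hence contF: "continuous_on (cball 0 2) F" by (rule continuous_on_subset) auto
  have Fv: "F (?v x) * of_real (exp (- (x \<bullet> x))) = f x" for x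
  proof -
    let ?s = "exp (- (x \<bullet> x))"
    have lt: "f x = 0" if "?s < \<eta>'"
    proof -
      have "R\<^sup>2 < (norm x)\<^sup>2" using that by (simp add: \<eta>'_def power2_norm_eq_inner)
      hence "R < norm x" using R by (simp add: power2_less_imp_less)
      thus ?thesis by (rule supp)
    qed
    consider "?s \<le> \<eta>" | "\<eta> < ?s" "?s < \<eta>'" | "\<eta>' \<le> ?s" by linarith
    thus ?thesis
    proof cases
      case 1
      hence "(?s - \<eta>) / (\<eta>' - \<eta>) \<le> 0" using \<eta> by (intro divide_nonpos_pos) auto
      hence "\<theta> ?s = 0" by (simp add: \<theta>_def)
      thus ?thesis using lt 1 \<eta> by (simp add: F_def)
    next
      case 2
      hence "max ?s \<eta> = ?s" by simp
      thus ?thesis using lt[OF 2(2)] by (simp add: F_def)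
    next
      case 3
      hence "\<theta> ?s = 1" using \<eta> by (simp add: \<theta>_def field_simps)
      moreover have "max ?s \<eta> = ?s" using 3 \<eta> by simp
      ultimately show ?thesis by (simp add: F_def)
    qed
  qed
  obtain g where g: "polynomial_function g" "\<And>z. z \<in> cball 0 2 \<Longrightarrow> norm (F z - g z) < e"
    using Stone_Weierstrass_polynomial_function[OF compact_cball contF e] by blast
  \<comment> \<open>Radius 2 is enough because \<open>1 + |x| \<le> 2 exp (|x|^2)\<close>.\<close>
  have v: "?v x \<in> cball 0 2" for x :: 'a
  proof -
    have "norm (?v x) \<le> norm (exp (- (x \<bullet> x))) + norm (exp (- (x \<bullet> x)) *\<^sub>R x)" by (rule norm_Pair_le)
    also have "\<dots> = exp (- (x \<bullet> x)) * (1 + norm x)" by (simp add: algebra_simps)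
    also have "\<dots> \<le> exp (- (x \<bullet> x)) * (2 * exp (x \<bullet> x))"
    proof (rule mult_left_mono)
      have "norm x \<le> 1 + 2 * (norm x)\<^sup>2"
      proof (cases "norm x \<le> 1")
        case False
        hence "norm x * 1 \<le> norm x * norm x" by (intro mult_left_mono) auto
        moreover have "0 \<le> norm x * norm x" by simp
        ultimately show ?thesis unfolding power2_eq_square by linarith
      qed (use zero_le_power2[of "norm x"] in linarith)
      moreover have "1 + (norm x)\<^sup>2 \<le> exp (x \<bullet> x)"
        using exp_ge_add_one_self[of "x \<bullet> x"] by (simp add: power2_norm_eq_inner)
      ultimately show "1 + norm x \<le> 2 * exp (x \<bullet> x)" by linarith
    qed auto
    also have "\<dots> = 2" by (simp flip: exp_add add: mult.left_commute)
    finally show ?thesis by simp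
  qed
  \<comment> \<open>This is \<open>g (?v x)\<close> times the Gaussian, split into real and
    imaginary parts. The extra Gaussian factor turns the uniform error \<open>e\<close> into an
    error with Gaussian decay, hence small in mean square over the whole space.\<close>
  define s where "s = (\<lambda>x::'a. of_real ((Re \<circ> g) (?v x)) * (1 * complex_of_real (exp (- (x \<bullet> x))))
       + of_real ((Im \<circ> g) (?v x)) * (\<i> * complex_of_real (exp (- (x \<bullet> x)))))"
  have "real_polynomial_function (Re \<circ> g)" "real_polynomial_function (Im \<circ> g)"
    using g(1) bounded_linear_Re bounded_linear_Im unfolding polynomial_function_def by blast+
  hence "gauss_poly s" unfolding s_def
    by (intro gauss_poly.add gauss_poly_polynomial gauss_poly.gauss)
  moreover have "norm (f x - s x) \<le> e * exp (- (x \<bullet> x))" for x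
  proof -
    have "s x = g (?v x) * of_real (exp (- (x \<bullet> x)))"
      by (subst complex_eq[of "g (?v x)"]) (simp add: s_def algebra_simps del: complex_eq)
    hence "f x - s x = (F (?v x) - g (?v x)) * of_real (exp (- (x \<bullet> x)))"
      using Fv[of x] by (simp add: algebra_simps)
    hence "norm (f x - s x) = norm (F (?v x) - g (?v x)) * exp (- (x \<bullet> x))" by (simp add: norm_mult)
    also have "\<dots> \<le> e * exp (- (x \<bullet> x))" using g(2)[OF v] by (intro mult_right_mono) (auto intro: less_imp_le)
    finally show ?thesis .
  qed
  ultimately show ?thesis using that by blast
qed

section \<open>Density of Schwartz functions\<close>

lemma L2_measurable: "\<psi> \<in> L2 \<Longrightarrow> \<psi> \<in> borel_measurable borel"
  by (simp add: L2_def)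

lemma L2_integrable: "\<psi> \<in> L2 \<Longrightarrow> integrable lborel (\<lambda>x. (norm (\<psi> x))\<^sup>2)"
  by (simp add: L2_def)

lemma norm_add_sq_le: "(norm (a + b))\<^sup>2 \<le> 2 * (norm a)\<^sup>2 + 2 * (norm b)\<^sup>2"
proof -
  have "(norm (a + b))\<^sup>2 \<le> (norm a + norm b)\<^sup>2" by (intro power_mono norm_triangle_ineq) auto
  also have "\<dots> \<le> 2 * (norm a)\<^sup>2 + 2 * (norm b)\<^sup>2"
    using sum_squares_bound[of "norm a" "norm b"] by (simp add: power2_sum)
  finally show ?thesis .
qed

lemma L2_cmult_add:
  assumes "\<psi> \<in> L2" "\<eta> \<in> L2" shows "(\<lambda>x. c * \<psi> x + \<eta> x) \<in> L2"
proof -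
  note [measurable] = L2_measurable[OF assms(1)] L2_measurable[OF assms(2)]
  have "integrable lborel (\<lambda>x. (norm (c * \<psi> x + \<eta> x))\<^sup>2)"
  proof (rule Bochner_Integration.integrable_bound)
    show "integrable lborel (\<lambda>x. 2 * ((norm c)\<^sup>2 * (norm (\<psi> x))\<^sup>2) + 2 * (norm (\<eta> x))\<^sup>2)"
      by (intro Bochner_Integration.integrable_add integrable_mult_right L2_integrable assms)
    show "AE x in lborel. norm ((norm (c * \<psi> x + \<eta> x))\<^sup>2) \<le>
       norm (2 * ((norm c)\<^sup>2 * (norm (\<psi> x))\<^sup>2) + 2 * (norm (\<eta> x))\<^sup>2)"
    proof (rule AE_I2)
      fix x
      have "(norm (c * \<psi> x + \<eta> x))\<^sup>2 \<le> 2 * ((norm c)\<^sup>2 * (norm (\<psi> x))\<^sup>2) + 2 * (norm (\<eta> x))\<^sup>2"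
        using norm_add_sq_le[of "c * \<psi> x" "\<eta> x"] by (simp add: norm_mult power_mult_distrib)
      thus "norm ((norm (c * \<psi> x + \<eta> x))\<^sup>2) \<le> norm (2 * ((norm c)\<^sup>2 * (norm (\<psi> x))\<^sup>2) + 2 * (norm (\<eta> x))\<^sup>2)"
        by simp
    qed
  qed measurable
  thus ?thesis by (simp add: L2_def)
qed

lemma L2_diff:
  assumes "\<psi> \<in> L2" "\<eta> \<in> L2" shows "(\<lambda>x. \<psi> x - \<eta> x) \<in> L2"
  using L2_cmult_add[OF assms(2,1), of "-1"] by simp

text \<open>A triangle inequality for squared distances at the price of a factor 2; the constants in
  the density proof are adjusted to it.\<close>

lemma integral_norm_diff_sq_triangle:
  assumes "f \<in> L2" "g \<in> L2" "h \<in> L2"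
  shows "(LINT x|lborel. (norm (f x - h x))\<^sup>2) \<le>
    2 * (LINT x|lborel. (norm (f x - g x))\<^sup>2) + 2 * (LINT x|lborel. (norm (g x - h x))\<^sup>2)"
proof -
  have "(LINT x|lborel. (norm (f x - h x))\<^sup>2) \<le> (LINT x|lborel. 2 * (norm (f x - g x))\<^sup>2 + 2 * (norm (g x - h x))\<^sup>2)"
  proof (rule integral_mono)
    show "(norm (f x - h x))\<^sup>2 \<le> 2 * (norm (f x - g x))\<^sup>2 + 2 * (norm (g x - h x))\<^sup>2" for x
      using norm_add_sq_le[of "f x - g x" "g x - h x"] by simp
  qed (intro Bochner_Integration.integrable_add integrable_mult_right L2_integrable L2_diff assms)+
  also have "\<dots> = 2 * (LINT x|lborel. (norm (f x - g x))\<^sup>2) + 2 * (LINT x|lborel. (norm (g x - h x))\<^sup>2)"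
    by (subst Bochner_Integration.integral_add)
       (auto intro!: integrable_mult_right L2_integrable L2_diff assms)
  finally show ?thesis .
qed

lemma integrable_indicator_cball: "integrable lborel (\<lambda>x::'a::euclidean_space. C * indicat_real (cball 0 r) x)"
  by (intro integrable_mult_right integrable_real_indicator) (use emeasure_bounded_finite[of "cball 0 r"] in auto)

lemma L2_bounded_support:
  fixes f :: "'a::euclidean_space \<Rightarrow> complex"
  assumes [measurable]: "f \<in> borel_measurable borel" and "\<And>x. norm (f x) \<le> M" "\<And>x. norm x > R \<Longrightarrow> f x = 0"
  shows "f \<in> L2"
proof -
  have "integrable lborel (\<lambda>x. (norm (f x))\<^sup>2)"
  proof (rule Bochner_Integration.integrable_bound[OF integrable_indicator_cball[of "M\<^sup>2" R]])
    have "(norm (f x))\<^sup>2 \<le> M\<^sup>2" for x using assms(2)[of x] by (intro power_mono) auto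
    thus "AE x in lborel. norm ((norm (f x))\<^sup>2) \<le> norm (M\<^sup>2 * indicat_real (cball 0 R) x)"
      using assms(3) by (intro AE_I2) (auto simp: indicator_def not_le)
  qed measurable
  thus ?thesis by (simp add: L2_def)
qed

lemma L2_truncate:
  fixes \<psi> :: "'a::euclidean_space \<Rightarrow> complex"
  assumes \<psi>: "\<psi> \<in> L2" and e: "e > 0"
  obtains M f where "M > 0" "f \<in> borel_measurable borel" "\<And>x. norm (f x) \<le> M" "\<And>x. norm x > M \<Longrightarrow> f x = 0"
    "(LINT x|lborel. (norm (\<psi> x - f x))\<^sup>2) < e"
proof -
  note [measurable] = L2_measurable[OF \<psi>]
  \<comment> \<open>One threshold limits both the values and the support. At each point the sequence
    is eventually equal to \<open>\<psi>\<close>, and the squared error is dominated by the square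
    of \<open>norm (\<psi> x)\<close>.\<close>
  define f where "f n x = (if norm (\<psi> x) \<le> real n \<and> norm x \<le> real n then \<psi> x else 0)" for n :: nat and x
  have [measurable]: "f n \<in> borel_measurable borel" for n unfolding f_def by measurable
  have "(\<lambda>n. LINT x|lborel. (norm (\<psi> x - f n x))\<^sup>2) \<longlonglongrightarrow> (LINT x::'a|lborel. (0::real))"
  proof (rule integral_dominated_convergence)
    show "integrable lborel (\<lambda>x. (norm (\<psi> x))\<^sup>2)" by (rule L2_integrable[OF \<psi>])
    show "AE x in lborel. (\<lambda>n. (norm (\<psi> x - f n x))\<^sup>2) \<longlonglongrightarrow> 0"
    proof (rule AE_I2)
      fix x
      have "\<forall>\<^sub>F n in sequentially. max (norm (\<psi> x)) (norm x) \<le> real n"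
        using eventually_ge_at_top[of "nat \<lceil>max (norm (\<psi> x)) (norm x)\<rceil>"] by eventually_elim linarith
      hence "\<forall>\<^sub>F n in sequentially. (norm (\<psi> x - f n x))\<^sup>2 = 0"
        by eventually_elim (simp add: f_def)
      thus "(\<lambda>n. (norm (\<psi> x - f n x))\<^sup>2) \<longlonglongrightarrow> 0" by (rule tendsto_eventually)
    qed
    show "AE x in lborel. norm ((norm (\<psi> x - f n x))\<^sup>2) \<le> (norm (\<psi> x))\<^sup>2" for n
      by (intro AE_I2) (simp add: f_def)
  qed measurable
  hence "\<forall>\<^sub>F n in sequentially. (LINT x|lborel. (norm (\<psi> x - f n x))\<^sup>2) < e"
    using e by (intro order_tendstoD(2)) auto
  with eventually_gt_at_top[of 0] have "\<forall>\<^sub>F n in sequentially. n > 0 \<and> (LINT x|lborel. (norm (\<psi> x - f n x))\<^sup>2) < e"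
    by eventually_elim simp
  then obtain n where n: "n > 0" "(LINT x|lborel. (norm (\<psi> x - f n x))\<^sup>2) < e"
    using eventually_happens'[OF sequentially_bot] by blast
  show ?thesis
    by (rule that[of "real n" "f n"]) (use n in \<open>auto simp: f_def\<close>)
qed

text \<open>A measurable function is an almost-everywhere limit of continuous ones. Clipping their
  values and cutting off their support provides an integrable majorant without affecting the
  limit.\<close>

lemma L2_approx_continuous:
  fixes f :: "'a::euclidean_space \<Rightarrow> complex"
  assumes M: "M > 0" and f[measurable]: "f \<in> borel_measurable borel"
    and bd: "\<And>x. norm (f x) \<le> M" and supp: "\<And>x. norm x > M \<Longrightarrow> f x = 0" and e: "e > 0"
  obtains g where "continuous_on UNIV g" "\<And>x. norm (g x) \<le> M" "\<And>x. norm x > M + 1 \<Longrightarrow> g x = 0"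
    "(LINT x|lborel. (norm (f x - g x))\<^sup>2) < e"
proof -
  have "f measurable_on UNIV"
    by (rule lebesgue_measurable_imp_measurable_on) (auto intro: measurable_completion)
  then obtain N g where N: "negligible N" and g: "\<And>n. continuous_on UNIV (g n)"
    "\<And>x. x \<notin> N \<Longrightarrow> (\<lambda>n. g n x) \<longlonglongrightarrow> f x"
    unfolding measurable_on_def by auto
  have AE: "AE x in lborel. (\<lambda>n. g n x) \<longlonglongrightarrow> f x"
  proof -
    have "AE x in lebesgue. (\<lambda>n. g n x) \<longlonglongrightarrow> f x"
      using N g(2) by (intro AE_I'[of N]) (auto simp: negligible_iff_null_sets)
    thus ?thesis by (simp add: AE_completion_iff)
  qed
  \<comment> \<open>\<open>clip\<close> is the radial retraction onto the disc of radius
    \<open>M\<close> and \<open>cut\<close> is 1 on the ball of radius \<open>M\<close>. By the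
    bounds on \<open>f\<close>, both leave it unchanged, so continuity carries the limit
    over.\<close>
  define clip where "clip z = of_real (M / max M (norm z)) * z" for z :: complex
  define cut where "cut x = max 0 (min 1 (M + 1 - norm x))" for x :: 'a
  define k where "k n x = of_real (cut x) * clip (g n x)" for n x
  have ne: "max M (norm z) \<noteq> 0" for z :: complex using M by (auto simp: max_def)
  have clipc: "continuous_on UNIV clip"
    unfolding clip_def using ne by (auto intro!: continuous_intros)
  have clip: "norm (clip z) \<le> M" for z
    using M by (auto simp: clip_def norm_mult max_def norm_divide)
  have clipf: "of_real (cut x) * clip (f x) = f x" for x
    using bd[of x] supp[of x] M by (auto simp: clip_def cut_def max_def min_def)
  have kc: "continuous_on UNIV (k n)" for n
    unfolding k_def cut_def
    by (intro continuous_intros continuous_on_compose2[OF clipc g(1)]) auto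
  have kn: "norm (k n x) \<le> M" for n x
  proof -
    have "norm (k n x) \<le> 1 * M" unfolding k_def norm_mult
      by (intro mult_mono clip) (auto simp: cut_def)
    thus ?thesis by simp
  qed
  have k0: "norm x > M + 1 \<Longrightarrow> k n x = 0" for n x by (simp add: k_def cut_def)
  have [measurable]: "k n \<in> borel_measurable borel" for n
    by (intro borel_measurable_continuous_onI kc)
  have "(\<lambda>n. LINT x|lborel. (norm (f x - k n x))\<^sup>2) \<longlonglongrightarrow> (LINT x::'a|lborel. (0::real))"
  proof (rule integral_dominated_convergence)
    show "integrable lborel (\<lambda>x::'a. (2 * M)\<^sup>2 * indicat_real (cball 0 (M + 1)) x)"
      by (rule integrable_indicator_cball)
    show "AE x in lborel. (\<lambda>n. (norm (f x - k n x))\<^sup>2) \<longlonglongrightarrow> 0"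
      using AE
    proof eventually_elim
      case (elim x)
      have "(\<lambda>n. clip (g n x)) \<longlonglongrightarrow> clip (f x)"
        using clipc elim by (auto simp: continuous_on_eq_continuous_at intro: isCont_tendsto_compose)
      hence "(\<lambda>n. k n x) \<longlonglongrightarrow> f x"
        unfolding k_def by (subst clipf[of x, symmetric]) (intro tendsto_intros)
      hence "(\<lambda>n. (norm (f x - k n x))\<^sup>2) \<longlonglongrightarrow> (norm (f x - f x))\<^sup>2" by (intro tendsto_intros)
      thus ?case by simp
    qed
    show "AE x in lborel. norm ((norm (f x - k n x))\<^sup>2) \<le> (2 * M)\<^sup>2 * indicat_real (cball 0 (M + 1)) x" for n
    proof (rule AE_I2)
      fix x
      have "norm (f x - k n x) \<le> 2 * M"
        using norm_triangle_ineq4[of "f x" "k n x"] bd[of x] kn[of n x] by linarith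
      hence "(norm (f x - k n x))\<^sup>2 \<le> (2 * M)\<^sup>2" by (intro power_mono) auto
      moreover have "f x - k n x = 0" if "norm x > M + 1" using supp[of x] k0[of x n] that by simp
      ultimately show "norm ((norm (f x - k n x))\<^sup>2) \<le> (2 * M)\<^sup>2 * indicat_real (cball 0 (M + 1)) x"
        by (auto simp: indicator_def not_le)
    qed
  qed measurable
  hence "\<forall>\<^sub>F n in sequentially. (LINT x|lborel. (norm (f x - k n x))\<^sup>2) < e"
    using e by (intro order_tendstoD(2)) auto
  then obtain n where n: "(LINT x|lborel. (norm (f x - k n x))\<^sup>2) < e"
    using eventually_happens'[OF sequentially_bot] by blast
  show ?thesis by (rule that[OF kc kn k0 n])
qed

lemma schwartz_dense_L2:
  fixes \<psi> :: "'a::euclidean_space \<Rightarrow> complex"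
  assumes \<psi>: "\<psi> \<in> L2" and e: "e > 0"
  obtains s where "schwartz s" "(LINT x|lborel. (norm (\<psi> x - s x))\<^sup>2) < e"
proof -
  \<comment> \<open>Two uses of the inequality with factor 2 weight the first two errors by 4 and
    the last by 2, and \<open>4 (e/16 + e/16) + 2 (e/4) = e\<close>.\<close>
  have e8: "e / 16 > 0" using e by simp
  obtain f M where f: "M > 0" "f \<in> borel_measurable borel" "\<And>x. norm (f x) \<le> M" "\<And>x. norm x > M \<Longrightarrow> f x = 0"
    "(LINT x|lborel. (norm (\<psi> x - f x))\<^sup>2) < e / 16"
    using L2_truncate[OF \<psi> e8] by blast
  obtain g where g: "continuous_on UNIV g" "\<And>x. norm (g x) \<le> M" "\<And>x. norm x > M + 1 \<Longrightarrow> g x = 0"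
    "(LINT x|lborel. (norm (f x - g x))\<^sup>2) < e / 16"
    using L2_approx_continuous[OF f(1-4) e8] by blast
  define G where "G = (\<lambda>x::'a. 1 * complex_of_real (exp (- (x \<bullet> x))))"
  have G: "G \<in> L2" unfolding G_def by (intro schwartz_L2 gauss_poly_schwartz gauss_poly.gauss)
  define I where "I = (LINT x|lborel. (norm (G x))\<^sup>2)"
  have I: "I \<ge> 0" unfolding I_def by (intro integral_nonneg_AE) auto
  \<comment> \<open>Chosen so that the squared error, at most \<open>d^2 I\<close>, stays below
    \<open>e / 4\<close>; the summand 1 keeps the denominator positive.\<close>
  define d where "d = sqrt (e / (4 * (I + 1)))"
  have d: "d > 0" "d\<^sup>2 = e / (4 * (I + 1))" using e I by (auto simp: d_def)
  have M1: "M + 1 > 0" using f(1) by simp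
  obtain s where s: "gauss_poly s" "\<And>x. norm (g x - s x) \<le> d * exp (- (x \<bullet> x))"
    using continuous_approx_gauss_poly[OF g(1) M1 g(3) d(1)] by blast
  have L2: "f \<in> L2" "g \<in> L2" "s \<in> L2"
    using L2_bounded_support[OF f(2,3,4)] L2_bounded_support[OF borel_measurable_continuous_onI[OF g(1)] g(2,3)]
      schwartz_L2[OF gauss_poly_schwartz[OF s(1)]] by auto
  have "(LINT x|lborel. (norm (g x - s x))\<^sup>2) \<le> (LINT x|lborel. d\<^sup>2 * (norm (G x))\<^sup>2)"
  proof (rule integral_mono)
    fix x
    have "(norm (g x - s x))\<^sup>2 \<le> (d * exp (- (x \<bullet> x)))\<^sup>2" by (intro power_mono s) auto
    thus "(norm (g x - s x))\<^sup>2 \<le> d\<^sup>2 * (norm (G x))\<^sup>2" by (simp add: G_def power_mult_distrib)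
  qed (intro integrable_mult_right L2_integrable L2_diff L2 G)+
  also have "\<dots> = d\<^sup>2 * I" by (simp add: I_def)
  also have "\<dots> < d\<^sup>2 * (I + 1)" using d(1) by (simp add: distrib_left)
  also have "\<dots> = e / 4" using I by (simp add: d(2) field_simps)
  finally have gs: "(LINT x|lborel. (norm (g x - s x))\<^sup>2) < e / 4" .
  have "(LINT x|lborel. (norm (\<psi> x - s x))\<^sup>2) < e"
    using integral_norm_diff_sq_triangle[OF \<psi> L2(2,3)] integral_norm_diff_sq_triangle[OF \<psi> L2(1,2)]
      f(5) g(4) gs by linarith
  thus ?thesis using that gauss_poly_schwartz[OF s(1)] by blast
qed

section \<open>Fourier inversion\<close>

text \<open>The unnormalized transform; inversion therefore produces the factor
  \<open>(2 pi)^d\<close>.\<close>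

definition fourier :: "('a::euclidean_space \<Rightarrow> complex) \<Rightarrow> 'a \<Rightarrow> complex" where
  "fourier f \<zeta> = (LINT y|lborel. f y * exp (- \<i> * of_real (\<zeta> \<bullet> y)))"

lemma fourier_integrable:
  assumes "schwartz f" shows "integrable lborel (\<lambda>y. f y * exp (- \<i> * of_real (\<zeta> \<bullet> y)))"
proof (rule Bochner_Integration.integrable_bound[OF schwartz_integrable[OF assms]])
  note [measurable] = schwartz_measurable[OF assms]
  show "(\<lambda>y. f y * exp (- \<i> * of_real (\<zeta> \<bullet> y))) \<in> borel_measurable lborel" by simp
qed (simp add: norm_mult)

lemma norm_fourier_le:
  assumes "schwartz f" shows "norm (fourier f \<zeta>) \<le> (LINT y|lborel. norm (f y))"
  unfolding fourier_def
  by (rule order_trans[OF integral_norm_bound]) (simp add: norm_mult)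

lemma fourier_measurable:
  assumes "schwartz f" shows "fourier f \<in> borel_measurable borel"
proof -
  note [measurable] = schwartz_measurable[OF assms]
  have "(\<lambda>(\<zeta>, y). f y * exp (- \<i> * complex_of_real (\<zeta> \<bullet> y))) \<in> borel_measurable (borel \<Otimes>\<^sub>M lborel)"
    by (simp add: split_def) measurable
  hence "(\<lambda>\<zeta>. LINT y|lborel. f y * exp (- \<i> * of_real (\<zeta> \<bullet> y))) \<in> borel_measurable borel"
    by (rule lborel.borel_measurable_lebesgue_integral)
  thus ?thesis by (simp add: fourier_def[abs_def])
qed

text \<open>Difference quotients have integral zero by translation invariance. They converge to the
  directional derivative, and the mean value inequality supplies a majorant for dominated
  convergence.\<close>

lemma integral_deriv_eq_0:
  fixes f :: "'a::euclidean_space \<Rightarrow> complex"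
  assumes der: "\<And>x. (f has_derivative f' x) (at x)" and int: "integrable lborel f"
    and dec: "decays (2 * DIM('a)) (\<lambda>x. f' x b)" and b: "b \<in> Basis"
    and meas: "(\<lambda>x. f' x b) \<in> borel_measurable borel"
  shows "(LINT x|lborel. f' x b) = 0"
proof -
  let ?m = "2 * DIM('a)"
  obtain C where C: "C \<ge> 0" "\<And>x. norm (f' x b) \<le> C * inverse ((1 + norm x) ^ ?m)"
    using decays_weight[OF dec] by metis
  define t where "t n = inverse (real (Suc n))" for n
  have t: "0 < t n" "t n \<le> 1" for n by (auto simp: t_def inverse_le_1_iff)
  have t0: "t \<longlonglongrightarrow> 0" unfolding t_def by (rule LIMSEQ_inverse_real_of_nat)
  define q where "q n x = (f (x + t n *\<^sub>R b) - f x) /\<^sub>R t n" for n x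
  have cont: "continuous_on UNIV f"
    by (intro continuous_at_imp_continuous_on ballI has_derivative_continuous[OF der])
  have [measurable]: "f \<in> borel_measurable borel" by (rule borel_measurable_continuous_onI[OF cont])
  have shift: "integrable lborel (\<lambda>x. f (x + a)) \<and> (LINT x|lborel. f (x + a)) = (LINT x|lborel. f x)" for a
  proof -
    have "integrable (distr lborel borel ((+) a)) f" using int by (simp add: lborel_distr_plus)
    hence 1: "integrable lborel (\<lambda>x. f (a + x))" by (subst (asm) integrable_distr_eq) auto
    have "(LINT x|lborel. f x) = (LINT x|distr lborel borel ((+) a). f x)" by (simp add: lborel_distr_plus)
    also have "\<dots> = (LINT x|lborel. f (a + x))" by (subst integral_distr) auto
    finally show ?thesis using 1 by (simp add: add.commute)
  qed
  have zero: "(LINT x|lborel. q n x) = 0" for n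
    unfolding q_def using shift[of "t n *\<^sub>R b"] int by simp
  have "(\<lambda>n. LINT x|lborel. q n x) \<longlonglongrightarrow> (LINT x|lborel. f' x b)"
  proof (rule integral_dominated_convergence)
    show "integrable lborel (\<lambda>x::'a. C * 2 ^ ?m * inverse ((1 + norm x) ^ ?m))"
      by (intro integrable_mult_right integrable_weight)
    show "AE x in lborel. (\<lambda>n. q n x) \<longlonglongrightarrow> f' x b"
    proof (rule AE_I2)
      fix x
      have lin: "linear (f' x)" using der has_derivative_linear by blast
      have "((\<lambda>s. x + s *\<^sub>R b) has_derivative (\<lambda>s. s *\<^sub>R b)) (at 0)"
        by (auto intro!: derivative_eq_intros)
      hence "((\<lambda>s. f (x + s *\<^sub>R b)) has_derivative (\<lambda>s. f' x (s *\<^sub>R b))) (at 0)"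
        by (rule has_derivative_compose) (use der[of x] in simp)
      hence "((\<lambda>s. norm (f (x + s *\<^sub>R b) - f x - s *\<^sub>R f' x b) / norm s) \<longlongrightarrow> 0) (at 0)"
        by (simp add: has_derivative_iff_norm linear_cmul[OF lin])
      moreover have "\<forall>\<^sub>F s in at 0. norm (f (x + s *\<^sub>R b) - f x - s *\<^sub>R f' x b) / norm s
          = norm ((f (x + s *\<^sub>R b) - f x) /\<^sub>R s - f' x b)"
        unfolding eventually_at_filter
      proof (intro always_eventually allI impI)
        fix s :: real assume "s \<noteq> 0"
        hence "(f (x + s *\<^sub>R b) - f x) /\<^sub>R s - f' x b = (f (x + s *\<^sub>R b) - f x - s *\<^sub>R f' x b) /\<^sub>R s"
          by (simp add: scaleR_diff_right)
        thus "norm (f (x + s *\<^sub>R b) - f x - s *\<^sub>R f' x b) / norm s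
          = norm ((f (x + s *\<^sub>R b) - f x) /\<^sub>R s - f' x b)"
          by (simp add: divide_inverse mult.commute)
      qed
      ultimately have "((\<lambda>s. norm ((f (x + s *\<^sub>R b) - f x) /\<^sub>R s - f' x b)) \<longlongrightarrow> 0) (at 0)"
        by (rule Lim_transform_eventually)
      hence "((\<lambda>s. (f (x + s *\<^sub>R b) - f x) /\<^sub>R s) \<longlongrightarrow> f' x b) (at 0)"
        by (simp add: tendsto_norm_zero_iff LIM_zero_iff)
      moreover have "filterlim t (at 0) sequentially"
        using t0 t(1) by (auto simp: filterlim_at less_imp_neq[THEN not_sym])
      ultimately show "(\<lambda>n. q n x) \<longlonglongrightarrow> f' x b"
        unfolding q_def by (rule filterlim_compose)
    qed
    show "AE x in lborel. norm (q n x) \<le> C * 2 ^ ?m * inverse ((1 + norm x) ^ ?m)" for n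
    proof (rule AE_I2)
      fix x :: 'a
      let ?B = "C * 2 ^ ?m * inverse ((1 + norm x) ^ ?m)"
      \<comment> \<open>A shift by at most one unit changes \<open>1 + norm x\<close> by a factor of
        at most 2, which is where \<open>2 ^ ?m\<close> comes from.\<close>
      have bound: "norm (f' (x + s *\<^sub>R b) b) \<le> ?B" if s: "0 \<le> s" "s \<le> 1" for s
      proof -
        have "norm x \<le> norm (x + s *\<^sub>R b) + norm (s *\<^sub>R b)" by (metis norm_triangle_ineq4 add_diff_cancel_right')
        moreover have "norm (s *\<^sub>R b) \<le> 1" using s b by simp
        ultimately have "1 + norm x \<le> 2 * (1 + norm (x + s *\<^sub>R b))"
          using norm_ge_zero[of "x + s *\<^sub>R b"] by argo
        hence "(1 + norm x) ^ ?m \<le> (2 * (1 + norm (x + s *\<^sub>R b))) ^ ?m" by (intro power_mono) auto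
        hence "(1 + norm x) ^ ?m \<le> 2 ^ ?m * (1 + norm (x + s *\<^sub>R b)) ^ ?m" by (simp only: power_mult_distrib)
        moreover have "0 < (1 + norm x) ^ ?m" "0 < (1 + norm (x + s *\<^sub>R b)) ^ ?m"
          by (intro zero_less_power add_pos_nonneg; simp)+
        ultimately have "inverse ((1 + norm (x + s *\<^sub>R b)) ^ ?m) \<le> 2 ^ ?m * inverse ((1 + norm x) ^ ?m)"
          by (simp add: field_simps)
        hence "C * inverse ((1 + norm (x + s *\<^sub>R b)) ^ ?m) \<le> C * (2 ^ ?m * inverse ((1 + norm x) ^ ?m))"
          using C(1) by (rule mult_left_mono)
        thus ?thesis using C(2)[of "x + s *\<^sub>R b"] by (simp add: mult.assoc)
      qed
      have "norm (f (x + t n *\<^sub>R b) - f (x + 0 *\<^sub>R b)) \<le> ?B * norm (t n - 0)"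
      proof (rule differentiable_bound[where S="{0..1}" and f="\<lambda>s. f (x + s *\<^sub>R b)" and f'="\<lambda>s u. u *\<^sub>R f' (x + s *\<^sub>R b) b"])
        fix s :: real assume s: "s \<in> {0..1}"
        have lin: "linear (f' (x + s *\<^sub>R b))" using der has_derivative_linear by blast
        have "((\<lambda>s. x + s *\<^sub>R b) has_derivative (\<lambda>s. s *\<^sub>R b)) (at s)"
          by (auto intro!: derivative_eq_intros)
        hence "((\<lambda>s. f (x + s *\<^sub>R b)) has_derivative (\<lambda>u. f' (x + s *\<^sub>R b) (u *\<^sub>R b))) (at s)"
          by (rule has_derivative_compose) (rule der)
        thus "((\<lambda>s. f (x + s *\<^sub>R b)) has_derivative (\<lambda>u. u *\<^sub>R f' (x + s *\<^sub>R b) b)) (at s within {0..1})"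
          by (simp add: linear_cmul[OF lin] has_derivative_at_withinI)
        show "onorm (\<lambda>u. u *\<^sub>R f' (x + s *\<^sub>R b) b) \<le> ?B"
          by (rule onorm_le) (use bound[of s] s in \<open>auto simp: mult.commute intro!: mult_left_mono\<close>)
      qed (use t[of n] in \<open>auto intro: less_imp_le\<close>)
      hence "norm (f (x + t n *\<^sub>R b) - f x) \<le> ?B * t n" using t[of n] by simp
      moreover have "norm (q n x) = norm (f (x + t n *\<^sub>R b) - f x) / t n"
        using t[of n] by (simp only: q_def norm_scaleR) (simp add: divide_inverse mult.commute)
      ultimately show "norm (q n x) \<le> ?B"
        using pos_divide_le_eq[OF t(1)[of n]] by metis
    qed
  qed (use meas in \<open>auto simp: q_def[abs_def]\<close>)
  hence "(\<lambda>n. 0) \<longlonglongrightarrow> (LINT x|lborel. f' x b)" by (simp add: zero)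
  thus ?thesis by (metis LIMSEQ_const_iff)
qed

text \<open>Integration by parts: the derivative of \<open>f\<close> times the exponential
  integrates to zero.\<close>

lemma fourier_deriv:
  fixes f :: "'a::euclidean_space \<Rightarrow> complex"
  assumes f: "schwartz f" and b: "b \<in> Basis"
  shows "fourier (\<lambda>x. frechet_derivative f (at x) b) \<zeta> = \<i> * of_real (\<zeta> \<bullet> b) * fourier f \<zeta>"
proof -
  let ?e = "\<lambda>y. exp (- \<i> * of_real (\<zeta> \<bullet> y))"
  let ?D = "\<lambda>x v. f x * (?e x * (- \<i> * of_real (\<zeta> \<bullet> v))) + frechet_derivative f (at x) v * ?e x"
  let ?df = "\<lambda>x. frechet_derivative f (at x) b"
  note f' = schwartz_deriv[OF f b]
  note [measurable] = schwartz_measurable[OF f] schwartz_measurable[OF f']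
  have der: "((\<lambda>x. f x * ?e x) has_derivative ?D x) (at x)" for x
  proof (rule has_derivative_mult[OF schwartz_has_derivative[OF f]])
    have "((\<lambda>x. - \<i> * complex_of_real (\<zeta> \<bullet> x)) has_derivative (\<lambda>v. - \<i> * of_real (\<zeta> \<bullet> v))) (at x)"
      by (intro derivative_intros has_derivative_inner_right has_derivative_ident)
    thus "(?e has_derivative (\<lambda>v. ?e x * (- \<i> * of_real (\<zeta> \<bullet> v)))) (at x)"
      by (rule has_derivative_compose[OF _ DERIV_exp[THEN has_field_derivative_imp_has_derivative]])
  qed
  have eq: "?D x b = (- \<i> * of_real (\<zeta> \<bullet> b) * ?e x) * f x + ?e x * ?df x" for x by (simp add: algebra_simps)
  have "(LINT x|lborel. ?D x b) = 0"
  proof (rule integral_deriv_eq_0[OF der _ _ b])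
    show "integrable lborel (\<lambda>x. f x * ?e x)" by (rule fourier_integrable[OF f])
    show "decays (2 * DIM('a)) (\<lambda>x. ?D x b)"
      unfolding eq
      by (intro decays_add decays_bounded_mult[where B="\<bar>\<zeta> \<bullet> b\<bar>"] decays_bounded_mult[where B=1] schwartz_decays f f')
         (simp_all add: norm_mult)
    show "(\<lambda>x. ?D x b) \<in> borel_measurable borel" unfolding eq by simp
  qed
  also have "(\<lambda>x. ?D x b) = (\<lambda>x. (- \<i> * of_real (\<zeta> \<bullet> b)) * (f x * ?e x) + ?df x * ?e x)"
    by (simp add: fun_eq_iff algebra_simps)
  finally have "(LINT x|lborel. (- \<i> * of_real (\<zeta> \<bullet> b)) * (f x * ?e x) + ?df x * ?e x) = 0" .
  also have "(LINT x|lborel. (- \<i> * of_real (\<zeta> \<bullet> b)) * (f x * ?e x) + ?df x * ?e x)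
     = (- \<i> * of_real (\<zeta> \<bullet> b)) * fourier f \<zeta> + fourier ?df \<zeta>"
    unfolding fourier_def
    by (subst Bochner_Integration.integral_add)
       (use fourier_integrable[OF f, of \<zeta>] fourier_integrable[OF f', of \<zeta>] in auto)
  finally show ?thesis by (simp add: algebra_simps add_eq_0_iff)
qed

text \<open>Bounding \<open>norm \<zeta>\<close> by the sum of the coordinates' absolute values
  trades one power of \<open>\<zeta>\<close> for one derivative of \<open>f\<close>, again Schwartz;
  order zero is the \<open>L1\<close> bound.\<close>

lemma fourier_rapid:
  fixes f :: "'a::euclidean_space \<Rightarrow> complex"
  assumes "schwartz f"
  shows "\<exists>C. \<forall>\<zeta>. norm \<zeta> ^ k * norm (fourier f \<zeta>) \<le> C"
  using assms
proof (induction k arbitrary: f)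
  case 0
  thus ?case using norm_fourier_le[OF 0] by auto
next
  case (Suc k)
  have "\<exists>C. \<forall>b\<in>Basis. \<forall>\<zeta>. norm \<zeta> ^ k * norm (fourier (\<lambda>x. frechet_derivative f (at x) b) \<zeta>) \<le> C b"
    using Suc.IH[OF schwartz_deriv[OF Suc.prems]] by (intro bchoice) blast
  then obtain C where C: "\<And>b \<zeta>. b \<in> Basis \<Longrightarrow> norm \<zeta> ^ k * norm (fourier (\<lambda>x. frechet_derivative f (at x) b) \<zeta>) \<le> C b"
    by blast
  have "norm \<zeta> ^ Suc k * norm (fourier f \<zeta>) \<le> sum C Basis" for \<zeta>
  proof -
    have "norm \<zeta> ^ Suc k * norm (fourier f \<zeta>) \<le> (\<Sum>b\<in>Basis. \<bar>\<zeta> \<bullet> b\<bar>) * (norm \<zeta> ^ k * norm (fourier f \<zeta>))"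
      by (simp add: mult.assoc norm_le_l1 mult_right_mono)
    also have "\<dots> = (\<Sum>b\<in>Basis. norm \<zeta> ^ k * norm (fourier (\<lambda>x. frechet_derivative f (at x) b) \<zeta>))"
      unfolding sum_distrib_right by (intro sum.cong refl) (simp add: fourier_deriv[OF Suc.prems] norm_mult)
    also have "\<dots> \<le> sum C Basis" by (intro sum_mono C)
    finally show ?thesis .
  qed
  thus ?case by blast
qed

lemma integrable_fourier:
  fixes f :: "'a::euclidean_space \<Rightarrow> complex"
  assumes "schwartz f" shows "integrable lborel (fourier f)"
proof (rule integrable_decays[OF fourier_measurable[OF assms]])
  obtain C where "\<And>\<zeta>. norm \<zeta> ^ (2 * DIM('a)) * norm (fourier f \<zeta>) \<le> C"
    using fourier_rapid[OF assms] by blast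
  thus "decays (2 * DIM('a)) (fourier f)"
    by (rule decaysI[OF norm_fourier_le[OF assms]])
qed

lemma integrable_affine:
  fixes f :: "'a::euclidean_space \<Rightarrow> 'b::{banach,second_countable_topology}"
  assumes c: "c \<noteq> 0" and f: "integrable lborel f"
  shows "integrable lborel (\<lambda>u. f (t + c *\<^sub>R u))"
proof -
  have [measurable]: "f \<in> borel_measurable borel" using borel_measurable_integrable[OF f] by simp
  have "integrable (density (distr lborel borel (\<lambda>x. t + c *\<^sub>R x)) (\<lambda>_. ennreal (\<bar>c\<bar> ^ DIM('a)))) f"
    using f lborel_affine[OF c, of t] by (simp add: ennreal_power)
  hence "integrable (distr lborel borel (\<lambda>x. t + c *\<^sub>R x)) (\<lambda>x. \<bar>c\<bar> ^ DIM('a) *\<^sub>R f x)"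
    by (subst (asm) integrable_density) auto
  hence "integrable lborel (\<lambda>u. \<bar>c\<bar> ^ DIM('a) *\<^sub>R f (t + c *\<^sub>R u))"
    by (subst (asm) integrable_distr_eq) auto
  hence "integrable lborel (\<lambda>u. inverse (\<bar>c\<bar> ^ DIM('a)) *\<^sub>R \<bar>c\<bar> ^ DIM('a) *\<^sub>R f (t + c *\<^sub>R u))"
    by (rule integrable_scaleR_right)
  thus ?thesis using c by simp
qed

section \<open>Gaussian integrals and the inversion formula\<close>

text \<open>Up to the factor \<open>sqrt (2 pi)\<close> this is the characteristic function of the
  standard normal distribution.\<close>

lemma
  fixes t :: real
  shows integrable_gauss_exp: "integrable lborel (\<lambda>x. complex_of_real (exp (- (x\<^sup>2 / 2))) * exp (\<i> * of_real (t * x)))" (is ?A)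
    and integral_gauss_exp: "(LINT x|lborel. complex_of_real (exp (- (x\<^sup>2 / 2))) * exp (\<i> * of_real (t * x)))
      = of_real (sqrt (2 * pi) * exp (- (t\<^sup>2 / 2)))" (is ?B)
proof -
  have eq: "complex_of_real (exp (- (x\<^sup>2 / 2))) * exp (\<i> * of_real (t * x)) =
    of_real (sqrt (2 * pi)) * (std_normal_density x *\<^sub>R exp (\<i> * of_real (t * x)))" for x
    by (simp add: std_normal_density_def scaleR_conv_of_real field_simps flip: of_real_mult)
  have m: "(\<lambda>x. exp (\<i> * complex_of_real (t * x))) \<in> borel_measurable borel"
    by (intro borel_measurable_continuous_onI continuous_intros)
  have int: "integrable lborel (\<lambda>x. std_normal_density x *\<^sub>R exp (\<i> * complex_of_real (t * x)))"
  proof (rule Bochner_Integration.integrable_bound[OF integrable_normal_density[of 1 0]])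
    show "(\<lambda>x. std_normal_density x *\<^sub>R exp (\<i> * complex_of_real (t * x))) \<in> borel_measurable lborel"
      using m by simp
  qed (simp_all add: norm_mult)
  show ?A unfolding eq by (intro integrable_mult_right int)
  have "(LINT x|lborel. std_normal_density x *\<^sub>R exp (\<i> * complex_of_real (t * x))) = char std_normal_distribution t"
    unfolding char_def by (subst integral_density) (use m in auto)
  also have "\<dots> = of_real (exp (- (t\<^sup>2 / 2)))" by (simp add: char_std_normal_distribution)
  finally have *: "(LINT x|lborel. std_normal_density x *\<^sub>R exp (\<i> * complex_of_real (t * x)))
    = of_real (exp (- (t\<^sup>2 / 2)))" .
  show ?B unfolding eq integral_mult_right_zero * by simp
qed

lemma gauss_exp_prod:
  fixes x w :: "'a::euclidean_space"
  shows "complex_of_real (exp (- (x \<bullet> x / 2))) * exp (\<i> * of_real (w \<bullet> x)) =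
    (\<Prod>b\<in>Basis. complex_of_real (exp (- ((x \<bullet> b)\<^sup>2 / 2))) * exp (\<i> * of_real ((w \<bullet> b) * (x \<bullet> b))))"
proof -
  have "x \<bullet> x = (\<Sum>b\<in>Basis. (x \<bullet> b)\<^sup>2)" "w \<bullet> x = (\<Sum>b\<in>Basis. (w \<bullet> b) * (x \<bullet> b))"
    by (simp_all add: euclidean_inner[of x x] euclidean_inner[of w x] power2_eq_square)
  thus ?thesis
    by (simp add: prod.distrib sum_distrib_left sum_divide_distrib exp_sum flip: sum_negf)
qed

lemma
  fixes w :: "'a::euclidean_space"
  shows integrable_gauss_exp_euclidean:
      "integrable lborel (\<lambda>x. complex_of_real (exp (- (x \<bullet> x / 2))) * exp (\<i> * of_real (w \<bullet> x)))"
    and integral_gauss_exp_euclidean: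
      "(LINT x|lborel. complex_of_real (exp (- (x \<bullet> x / 2))) * exp (\<i> * of_real (w \<bullet> x)))
        = of_real (sqrt (2 * pi) ^ DIM('a) * exp (- (w \<bullet> w / 2)))"
proof -
  have w: "w \<bullet> w = (\<Sum>b\<in>Basis. (w \<bullet> b)\<^sup>2)"
    by (simp add: euclidean_inner[of w w] power2_eq_square)
  show "integrable lborel (\<lambda>x. complex_of_real (exp (- (x \<bullet> x / 2))) * exp (\<i> * of_real (w \<bullet> x)))"
    unfolding gauss_exp_prod by (intro integrable_lborel_prod integrable_gauss_exp)
  show "(LINT x|lborel. complex_of_real (exp (- (x \<bullet> x / 2))) * exp (\<i> * of_real (w \<bullet> x)))
        = of_real (sqrt (2 * pi) ^ DIM('a) * exp (- (w \<bullet> w / 2)))"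
    unfolding gauss_exp_prod
    by (subst integral_lborel_prod[OF integrable_gauss_exp], subst integral_gauss_exp)
       (simp add: w prod.distrib sum_divide_distrib exp_sum flip: sum_negf)
qed

text \<open>The double integral is not absolutely convergent, so a Gaussian regularizer
  \<open>K e\<close> is inserted to permit Fubini. After the exchange, the inner integral is again a
  Gaussian and the outer one averages \<open>f\<close> around \<open>z\<close> at scale
  \<open>e\<close>. The limit \<open>e\<close> to 0 gives \<open>f z\<close>, with a factor
  \<open>A\<close> from each of the two Gaussian integrals.\<close>

lemma fourier_inversion:
  fixes f :: "'a::euclidean_space \<Rightarrow> complex"
  assumes f: "schwartz f"
  shows "(LINT \<zeta>|lborel. fourier f \<zeta> * exp (\<i> * of_real (\<zeta> \<bullet> z))) = of_real ((2 * pi) ^ DIM('a)) * f z"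
proof -
  let ?d = "DIM('a)"
  define A where "A = sqrt (2 * pi) ^ ?d"
  define K where "K e \<zeta> = complex_of_real (exp (- ((e *\<^sub>R \<zeta>) \<bullet> (e *\<^sub>R \<zeta>) / 2)))" for e and \<zeta> :: 'a
  define H where "H w \<eta> = complex_of_real (exp (- (\<eta> \<bullet> \<eta> / 2))) * exp (\<i> * of_real (w \<bullet> \<eta>))" for w \<eta> :: 'a
  note [measurable] = schwartz_measurable[OF f] fourier_measurable[OF f]
  have Km[measurable]: "K e \<in> borel_measurable borel" for e
    unfolding K_def[abs_def] by (intro borel_measurable_continuous_onI continuous_intros) auto
  have Hm[measurable]: "H w \<in> borel_measurable borel" for w
    unfolding H_def[abs_def] by (intro borel_measurable_continuous_onI continuous_intros) auto
  have em[measurable]: "(\<lambda>y. exp (\<i> * complex_of_real (y \<bullet> w))) \<in> borel_measurable borel" for w :: 'a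
    by (intro borel_measurable_continuous_onI continuous_intros)
  have H0: "H 0 \<eta> = of_real (exp (- (\<eta> \<bullet> \<eta> / 2)))" for \<eta> by (simp add: H_def)
  have Kint: "integrable lborel (K e)" if "e > 0" for e
    using integrable_affine[OF _ integrable_gauss_exp_euclidean[of 0], of e 0] that
    by (simp add: K_def[abs_def])
  have Knorm: "norm (K e \<zeta>) \<le> 1" for e \<zeta>
    by (simp add: K_def del: inner_scaleR_left inner_scaleR_right)
  have key: "(LINT \<zeta>|lborel. K e \<zeta> * (fourier f \<zeta> * exp (\<i> * of_real (\<zeta> \<bullet> z))))
      = of_real A * (LINT u|lborel. f (z + e *\<^sub>R u) * H 0 u)" if e: "e > 0" for e
  proof -
    define g where "g \<zeta> y = f y * (K e \<zeta> * exp (\<i> * of_real (\<zeta> \<bullet> (z - y))))" for \<zeta> y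
    have gn: "norm (g \<zeta> y) = norm (K e \<zeta>) * norm (f y)" for \<zeta> y by (simp add: g_def norm_mult)
    have cm: "(\<lambda>p. exp (\<i> * complex_of_real (fst p \<bullet> (z - snd p)))) \<in> borel_measurable (borel :: ('a \<times> 'a) measure)"
      by (intro borel_measurable_continuous_onI continuous_intros)
    hence [measurable]: "(\<lambda>p. exp (\<i> * complex_of_real (fst p \<bullet> (z - snd p)))) \<in> borel_measurable (borel \<Otimes>\<^sub>M (borel :: 'a measure))"
      by (simp add: borel_prod)
    have gm: "case_prod g \<in> borel_measurable (lborel \<Otimes>\<^sub>M lborel)"
      unfolding g_def split_def by measurable
    have gint: "integrable (lborel \<Otimes>\<^sub>M lborel) (case_prod g)"
    proof (rule lborel_pair.Fubini_integrable[OF gm])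
      show "integrable lborel (\<lambda>\<zeta>. LINT y|lborel. norm (case (\<zeta>, y) of (\<zeta>, y) \<Rightarrow> g \<zeta> y))"
        by (simp add: gn Kint[OF e])
      show "AE \<zeta> in lborel. integrable lborel (\<lambda>y. case (\<zeta>, y) of (\<zeta>, y) \<Rightarrow> g \<zeta> y)"
      proof (rule AE_I2)
        fix \<zeta>
        have "g \<zeta> y = (K e \<zeta> * exp (\<i> * of_real (\<zeta> \<bullet> z))) * (f y * exp (- \<i> * of_real (\<zeta> \<bullet> y)))" for y
          by (simp add: g_def inner_diff_right algebra_simps exp_diff exp_minus divide_inverse)
        thus "integrable lborel (\<lambda>y. case (\<zeta>, y) of (\<zeta>, y) \<Rightarrow> g \<zeta> y)"
          using fourier_integrable[OF f, of \<zeta>] by simp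
      qed
    qed
    have g1: "(LINT y|lborel. g \<zeta> y) = K e \<zeta> * (fourier f \<zeta> * exp (\<i> * of_real (\<zeta> \<bullet> z)))" for \<zeta>
    proof -
      have "g \<zeta> y = (K e \<zeta> * exp (\<i> * of_real (\<zeta> \<bullet> z))) * (f y * exp (- \<i> * of_real (\<zeta> \<bullet> y)))" for y
        by (simp add: g_def inner_diff_right algebra_simps exp_diff exp_minus divide_inverse)
      thus ?thesis by (simp add: fourier_def)
    qed
    \<comment> \<open>Scaling \<open>\<zeta>\<close> by \<open>e\<close> gives the transform of the
      Gaussian at \<open>(z - y) / e\<close>. The factor \<open>e ^ ?d\<close> compensates this
      scaling here and is supplied later by the substitution \<open>y = z + e u\<close>.\<close>
    have g2: "e ^ ?d *\<^sub>R (LINT \<zeta>|lborel. g \<zeta> y) = f y * of_real (A * exp (- (((z - y) /\<^sub>R e) \<bullet> ((z - y) /\<^sub>R e) / 2)))" for y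
    proof -
      have "g \<zeta> y = f y * H ((z - y) /\<^sub>R e) (0 + e *\<^sub>R \<zeta>)" for \<zeta>
      proof -
        have "((z - y) /\<^sub>R e) \<bullet> (0 + e *\<^sub>R \<zeta>) = \<zeta> \<bullet> (z - y)"
          using e by (simp add: inner_commute)
        thus ?thesis by (simp only: g_def K_def H_def add_0)
      qed
      hence "e ^ ?d *\<^sub>R (LINT \<zeta>|lborel. g \<zeta> y) = f y * (\<bar>e\<bar> ^ ?d *\<^sub>R (LINT \<zeta>|lborel. H ((z - y) /\<^sub>R e) (0 + e *\<^sub>R \<zeta>)))"
        using e by (simp only: integral_mult_right_zero) simp
      also have "\<dots> = f y * (LINT \<zeta>|lborel. H ((z - y) /\<^sub>R e) \<zeta>)"
        using e by (subst integral_affine[OF _ Hm, of e _ 0]) auto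
      also have "\<dots> = f y * of_real (A * exp (- (((z - y) /\<^sub>R e) \<bullet> ((z - y) /\<^sub>R e) / 2)))"
        unfolding H_def integral_gauss_exp_euclidean A_def ..
      finally show ?thesis .
    qed
    have "(LINT \<zeta>|lborel. K e \<zeta> * (fourier f \<zeta> * exp (\<i> * of_real (\<zeta> \<bullet> z)))) = (LINT \<zeta>|lborel. LINT y|lborel. g \<zeta> y)"
      by (simp only: g1)
    also have "\<dots> = (LINT y|lborel. LINT \<zeta>|lborel. g \<zeta> y)"
      by (rule lborel_pair.Fubini_integral[OF gint, symmetric])
    also have "\<dots> = \<bar>e\<bar> ^ ?d *\<^sub>R (LINT u|lborel. LINT \<zeta>|lborel. g \<zeta> (z + e *\<^sub>R u))"
    proof (rule integral_affine)
      have "case_prod (\<lambda>y \<zeta>. g \<zeta> y) \<in> borel_measurable (lborel \<Otimes>\<^sub>M lborel)"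
        using measurable_compose[OF measurable_pair_swap' gm] by (simp add: split_def)
      hence "(\<lambda>y. LINT \<zeta>|lborel. g \<zeta> y) \<in> borel_measurable lborel"
        by (rule lborel.borel_measurable_lebesgue_integral)
      thus "(\<lambda>y. LINT \<zeta>|lborel. g \<zeta> y) \<in> borel_measurable borel" by simp
    qed (use e in simp)
    also have "\<dots> = (LINT u|lborel. e ^ ?d *\<^sub>R (LINT \<zeta>|lborel. g \<zeta> (z + e *\<^sub>R u)))" using e by simp
    also have "\<dots> = (LINT u|lborel. of_real A * (f (z + e *\<^sub>R u) * H 0 u))"
      unfolding g2 using e by (simp add: H0 mult_ac)
    also have "\<dots> = of_real A * (LINT u|lborel. f (z + e *\<^sub>R u) * H 0 u)" by simp
    finally show ?thesis .
  qed
  define e where "e n = inverse (real (Suc n))" for n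
  have e: "e n > 0" for n by (simp add: e_def)
  have e0: "e \<longlonglongrightarrow> 0" unfolding e_def by (rule LIMSEQ_inverse_real_of_nat)
  have L: "(\<lambda>n. LINT \<zeta>|lborel. K (e n) \<zeta> * (fourier f \<zeta> * exp (\<i> * of_real (\<zeta> \<bullet> z))))
    \<longlonglongrightarrow> (LINT \<zeta>|lborel. fourier f \<zeta> * exp (\<i> * of_real (\<zeta> \<bullet> z)))"
  proof (rule integral_dominated_convergence[OF _ _ integrable_norm[OF integrable_fourier[OF f]]])
    show "AE \<zeta> in lborel. (\<lambda>n. K (e n) \<zeta> * (fourier f \<zeta> * exp (\<i> * of_real (\<zeta> \<bullet> z))))
      \<longlonglongrightarrow> fourier f \<zeta> * exp (\<i> * of_real (\<zeta> \<bullet> z))"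
    proof (rule AE_I2)
      fix \<zeta>
      have "(\<lambda>n. K (e n) \<zeta>) \<longlonglongrightarrow> complex_of_real (exp (- ((0 *\<^sub>R \<zeta>) \<bullet> (0 *\<^sub>R \<zeta>) / 2)))"
        unfolding K_def by (intro tendsto_intros e0) simp
      hence "(\<lambda>n. K (e n) \<zeta> * (fourier f \<zeta> * exp (\<i> * of_real (\<zeta> \<bullet> z))))
        \<longlonglongrightarrow> complex_of_real (exp (- ((0 *\<^sub>R \<zeta>) \<bullet> (0 *\<^sub>R \<zeta>) / 2))) * (fourier f \<zeta> * exp (\<i> * of_real (\<zeta> \<bullet> z)))"
        by (intro tendsto_intros)
      thus "(\<lambda>n. K (e n) \<zeta> * (fourier f \<zeta> * exp (\<i> * of_real (\<zeta> \<bullet> z))))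
        \<longlonglongrightarrow> fourier f \<zeta> * exp (\<i> * of_real (\<zeta> \<bullet> z))" by simp
    qed
    show "AE \<zeta> in lborel. norm (K (e n) \<zeta> * (fourier f \<zeta> * exp (\<i> * of_real (\<zeta> \<bullet> z)))) \<le> norm (fourier f \<zeta>)" for n
      using Knorm by (intro AE_I2) (simp add: norm_mult mult_left_le_one_le)
  qed simp_all
  obtain B where B: "\<And>x. norm (f x) \<le> B" using decays_bounded[OF schwartz_decays[OF f, of 0]] by auto
  have H0int: "integrable lborel (H 0)" unfolding H_def[abs_def] by (rule integrable_gauss_exp_euclidean)
  have R: "(\<lambda>n. LINT u|lborel. f (z + e n *\<^sub>R u) * H 0 u) \<longlonglongrightarrow> (LINT u|lborel. f z * H 0 u)"
  proof (rule integral_dominated_convergence)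
    show "integrable lborel (\<lambda>u. B * norm (H 0 u))" by (intro integrable_mult_right integrable_norm H0int)
    show "AE u in lborel. (\<lambda>n. f (z + e n *\<^sub>R u) * H 0 u) \<longlonglongrightarrow> f z * H 0 u"
    proof (rule AE_I2)
      fix u
      have "(\<lambda>n. z + e n *\<^sub>R u) \<longlonglongrightarrow> z + 0 *\<^sub>R u" by (intro tendsto_intros e0)
      moreover have "isCont f z" using schwartz_continuous[OF f] by (simp add: continuous_on_eq_continuous_at)
      ultimately have "(\<lambda>n. f (z + e n *\<^sub>R u)) \<longlonglongrightarrow> f z" by (intro isCont_tendsto_compose[of z f]) auto
      thus "(\<lambda>n. f (z + e n *\<^sub>R u) * H 0 u) \<longlonglongrightarrow> f z * H 0 u" by (intro tendsto_intros)
    qed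
    show "AE u in lborel. norm (f (z + e n *\<^sub>R u) * H 0 u) \<le> B * norm (H 0 u)" for n
      using B by (intro AE_I2) (simp add: norm_mult mult_right_mono)
  qed measurable
  have "(LINT \<zeta>|lborel. fourier f \<zeta> * exp (\<i> * of_real (\<zeta> \<bullet> z))) = of_real A * (LINT u|lborel. f z * H 0 u)"
  proof (rule LIMSEQ_unique[OF L])
    show "(\<lambda>n. LINT \<zeta>|lborel. K (e n) \<zeta> * (fourier f \<zeta> * exp (\<i> * of_real (\<zeta> \<bullet> z))))
      \<longlonglongrightarrow> of_real A * (LINT u|lborel. f z * H 0 u)"
      unfolding key[OF e] by (intro tendsto_intros R)
  qed
  also have "(LINT u|lborel. f z * H 0 u) = f z * of_real A"
    using integral_gauss_exp_euclidean[of "0 :: 'a"] by (simp add: H_def A_def)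
  also have "of_real A * (f z * of_real A) = of_real (A * A) * f z" by simp
  also have "A * A = (2 * pi) ^ ?d"
    by (simp only: A_def power_mult_distrib[symmetric]) simp
  finally show ?thesis .
qed

text \<open>Constancy of the symbol in \<open>\<xi>\<close> at this \<open>x\<close> makes the inner
  integral a multiple of the Fourier transform at \<open>\<xi> / h\<close>. Rescaling contributes
  \<open>h^d\<close>, inversion \<open>(2 pi)^d\<close>, and together they cancel the
  normalization.\<close>

lemma osc_integral_schwartz:
  fixes \<psi> :: "real^'d \<Rightarrow> complex"
  assumes \<psi>: "schwartz \<psi>" and h: "h > 0" and a: "\<And>\<xi>. a (x, \<xi>) = c"
  shows "osc_integral h a f \<psi> x = c * \<psi> (inv_into UNIV f x)"
proof -
  define z where "z = inv_into UNIV f x"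
  define k where "k = c / complex_of_real ((2 * pi * h) ^ CARD('d))"
  define F where "F = (\<lambda>\<zeta>. fourier \<psi> \<zeta> * exp (\<i> * of_real (\<zeta> \<bullet> z)))"
  have Fm: "F \<in> borel_measurable borel"
  proof -
    note [measurable] = fourier_measurable[OF \<psi>]
    have [measurable]: "(\<lambda>y. exp (\<i> * complex_of_real (y \<bullet> z))) \<in> borel_measurable borel"
      by (intro borel_measurable_continuous_onI continuous_intros)
    show ?thesis unfolding F_def by measurable
  qed
  have inner: "(LINT y|lborel. \<psi> y * a (x, \<xi>) * exp (\<i> / of_real h * of_real (\<xi> \<bullet> (z - y)))
          / of_real ((2 * pi * h) ^ CARD('d))) = k * F (\<xi> /\<^sub>R h)" for \<xi>
  proof -
    have "\<psi> y * a (x, \<xi>) * exp (\<i> / of_real h * of_real (\<xi> \<bullet> (z - y))) / of_real ((2 * pi * h) ^ CARD('d))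
      = (k * exp (\<i> * of_real ((\<xi> /\<^sub>R h) \<bullet> z))) * (\<psi> y * exp (- \<i> * of_real ((\<xi> /\<^sub>R h) \<bullet> y)))" for y
    proof -
      have "exp (\<i> / of_real h * of_real (\<xi> \<bullet> (z - y))) =
         exp (\<i> * of_real ((\<xi> /\<^sub>R h) \<bullet> z)) * exp (- \<i> * of_real ((\<xi> /\<^sub>R h) \<bullet> y))"
        by (simp add: inner_diff_right algebra_simps divide_inverse flip: exp_add)
      thus ?thesis by (simp add: a k_def)
    qed
    hence "(LINT y|lborel. \<psi> y * a (x, \<xi>) * exp (\<i> / of_real h * of_real (\<xi> \<bullet> (z - y)))
          / of_real ((2 * pi * h) ^ CARD('d))) =
       (LINT y|lborel. (k * exp (\<i> * of_real ((\<xi> /\<^sub>R h) \<bullet> z))) * (\<psi> y * exp (- \<i> * of_real ((\<xi> /\<^sub>R h) \<bullet> y))))"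
      by (simp only:)
    also have "\<dots> = (k * exp (\<i> * of_real ((\<xi> /\<^sub>R h) \<bullet> z))) * fourier \<psi> (\<xi> /\<^sub>R h)"
      unfolding fourier_def by (rule integral_mult_right_zero)
    finally show ?thesis by (simp add: F_def)
  qed
  have "osc_integral h a f \<psi> x = k * (LINT \<xi>|lborel. F (\<xi> /\<^sub>R h))"
    unfolding osc_integral_def z_def[symmetric] inner by simp
  also have "(LINT \<xi>|lborel. F (\<xi> /\<^sub>R h)) = h ^ CARD('d) *\<^sub>R (LINT \<zeta>|lborel. F \<zeta>)"
    using integral_affine[OF _ Fm, of "inverse h" 0] h by (simp add: power_inverse)
  also have "(LINT \<zeta>|lborel. F \<zeta>) = of_real ((2 * pi) ^ CARD('d)) * \<psi> z"
    unfolding F_def using fourier_inversion[OF \<psi>, of z] by simp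
  finally show ?thesis using h by (simp add: k_def z_def power_mult_distrib scaleR_conv_of_real)
qed

section \<open>Weighted composition operators\<close>

text \<open>The set of agreement is closed and of full measure, hence everything.\<close>

lemma AE_continuous_eq:
  fixes f g :: "'a::euclidean_space \<Rightarrow> complex"
  assumes "continuous_on UNIV f" "continuous_on UNIV g" "AE x in lborel. f x = g x"
  shows "f x = g x"
proof -
  have "closed {x. f x = g x}" by (rule closed_Collect_eq[OF assms(1,2)])
  moreover have "AE x in lebesgue. x \<in> {x. f x = g x}" using assms(3) by (simp add: AE_completion_iff)
  ultimately have "x \<in> {x. f x = g x}" by (rule mem_closed_if_AE_lebesgue)
  thus ?thesis by simp
qed

section \<open>Substitution along volume-preserving maps\<close>

definition volume_preserving_map :: "('a::euclidean_space \<Rightarrow> 'a) \<Rightarrow> bool" where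
  "volume_preserving_map P \<longleftrightarrow> P \<in> borel \<rightarrow>\<^sub>M borel \<and> distr lborel borel P = lborel"

definition weighted_composition :: "('a \<Rightarrow> complex) \<Rightarrow> ('a \<Rightarrow> 'a) \<Rightarrow> ('a \<Rightarrow> complex) \<Rightarrow> 'a \<Rightarrow> complex" where
  "weighted_composition c P \<psi> = (\<lambda>x. c x * \<psi> (P x))"

lemma volume_preserving_integral:
  fixes f :: "'a::euclidean_space \<Rightarrow> 'b::{banach,second_countable_topology}"
  assumes P: "volume_preserving_map P" and [measurable]: "f \<in> borel_measurable borel"
  shows "(LINT x|lborel. f (P x)) = (LINT x|lborel. f x)"
    and "integrable lborel (\<lambda>x. f (P x)) \<longleftrightarrow> integrable lborel f"
proof -
  have [measurable]: "P \<in> borel \<rightarrow>\<^sub>M borel" and eq: "distr lborel borel P = lborel"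
    using P by (auto simp: volume_preserving_map_def)
  have "(LINT x|distr lborel borel P. f x) = (LINT x|lborel. f (P x))" by (subst integral_distr) auto
  thus "(LINT x|lborel. f (P x)) = (LINT x|lborel. f x)" by (simp add: eq)
  have "integrable (distr lborel borel P) f \<longleftrightarrow> integrable lborel (\<lambda>x. f (P x))"
    by (subst integrable_distr_eq) auto
  thus "integrable lborel (\<lambda>x. f (P x)) \<longleftrightarrow> integrable lborel f" by (simp add: eq)
qed

text \<open>Needed for composing operators: an identity for \<open>T g' \<psi>\<close> known almost
  everywhere may still be evaluated along \<open>P g\<close>.\<close>

lemma volume_preserving_AE:
  assumes "volume_preserving_map P" "AE x in lborel. Q x" shows "AE x in lborel. Q (P x)"
proof (rule AE_distrD[of P lborel borel Q])
  have P: "P \<in> borel \<rightarrow>\<^sub>M borel" "distr lborel borel P = lborel"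
    using assms(1) by (auto simp: volume_preserving_map_def)
  show "P \<in> lborel \<rightarrow>\<^sub>M borel" using P(1) by simp
  show "AE x in distr lborel borel P. Q x" unfolding P(2) by (rule assms(2))
qed

lemma volume_preserving_id: "volume_preserving_map (\<lambda>x. x)"
  using distr_id2[of borel lborel] by (simp add: volume_preserving_map_def)

lemma volume_preserving_inverse:
  assumes "volume_preserving_map P" "f \<in> borel \<rightarrow>\<^sub>M borel" "\<And>x. f (P x) = x"
  shows "volume_preserving_map f"
proof -
  have P: "P \<in> borel \<rightarrow>\<^sub>M borel" "distr lborel borel P = lborel"
    using assms(1) by (auto simp: volume_preserving_map_def)
  have "distr lborel borel f = distr (distr lborel borel P) borel f" by (simp add: P)
  also have "\<dots> = distr lborel borel (f \<circ> P)" using P assms(2) by (subst distr_distr) auto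
  also have "f \<circ> P = (\<lambda>x. x)" using assms(3) by auto
  finally show ?thesis using assms(2) distr_id2[of borel lborel] by (simp add: volume_preserving_map_def)
qed

lemma
  fixes \<psi> :: "'a::euclidean_space \<Rightarrow> complex"
  assumes P: "volume_preserving_map P" and c: "c \<in> borel_measurable borel" "\<And>x. norm (c x) \<le> B"
    and \<psi>: "\<psi> \<in> L2"
  shows weighted_composition_L2: "weighted_composition c P \<psi> \<in> L2"
    and weighted_composition_norm: "L2_norm (weighted_composition c P \<psi>) \<le> B * L2_norm \<psi>"
proof -
  have [measurable]: "P \<in> borel \<rightarrow>\<^sub>M borel" using P by (simp add: volume_preserving_map_def)
  note [measurable] = c(1) L2_measurable[OF \<psi>]
  have B: "B \<ge> 0" using c(2) norm_ge_zero order_trans by blast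
  have int: "integrable lborel (\<lambda>x. (norm (\<psi> (P x)))\<^sup>2)"
    using volume_preserving_integral(2)[OF P, of "\<lambda>x. (norm (\<psi> x))\<^sup>2"] L2_integrable[OF \<psi>] by simp
  have le: "(norm (weighted_composition c P \<psi> x))\<^sup>2 \<le> B\<^sup>2 * (norm (\<psi> (P x)))\<^sup>2" for x
  proof -
    have "norm (weighted_composition c P \<psi> x) \<le> B * norm (\<psi> (P x))"
      unfolding weighted_composition_def norm_mult by (intro mult_right_mono c) auto
    hence "(norm (weighted_composition c P \<psi> x))\<^sup>2 \<le> (B * norm (\<psi> (P x)))\<^sup>2" by (intro power_mono) auto
    thus ?thesis by (simp add: power_mult_distrib)
  qed
  have m: "weighted_composition c P \<psi> \<in> borel_measurable borel"
    unfolding weighted_composition_def by measurable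
  have int2: "integrable lborel (\<lambda>x. (norm (weighted_composition c P \<psi> x))\<^sup>2)"
  proof (rule Bochner_Integration.integrable_bound)
    show "integrable lborel (\<lambda>x. B\<^sup>2 * (norm (\<psi> (P x)))\<^sup>2)" by (intro integrable_mult_right int)
    show "AE x in lborel. norm ((norm (weighted_composition c P \<psi> x))\<^sup>2) \<le> norm (B\<^sup>2 * (norm (\<psi> (P x)))\<^sup>2)"
      using le by (intro AE_I2) simp
  qed (use m in measurable)
  show "weighted_composition c P \<psi> \<in> L2" using m int2 by (simp add: L2_def)
  have "(LINT x|lborel. (norm (weighted_composition c P \<psi> x))\<^sup>2) \<le> (LINT x|lborel. B\<^sup>2 * (norm (\<psi> (P x)))\<^sup>2)"
    by (intro integral_mono int2 integrable_mult_right int le)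
  also have "\<dots> = B\<^sup>2 * (LINT x|lborel. (norm (\<psi> x))\<^sup>2)"
    using volume_preserving_integral(1)[OF P, of "\<lambda>x. (norm (\<psi> x))\<^sup>2"] by simp
  finally have "L2_norm (weighted_composition c P \<psi>) \<le> sqrt (B\<^sup>2 * (LINT x|lborel. (norm (\<psi> x))\<^sup>2))"
    unfolding L2_norm_def by (rule real_sqrt_le_mono)
  thus "L2_norm (weighted_composition c P \<psi>) \<le> B * L2_norm \<psi>"
    using B by (simp add: L2_norm_def real_sqrt_mult)
qed

lemma bounded_operator_weighted_composition:
  assumes "volume_preserving_map P" "c \<in> borel_measurable borel" "\<And>x. norm (c x) \<le> B"
  shows "bounded_operator (weighted_composition c P)"
  unfolding bounded_operator_def
proof (intro conjI ballI allI exI[of _ B])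
  show "AE x in lborel. weighted_composition c P (\<lambda>y. k * \<psi> y + \<eta> y) x =
    k * weighted_composition c P \<psi> x + weighted_composition c P \<eta> x" for k \<psi> \<eta>
    by (simp add: weighted_composition_def algebra_simps)
qed (use weighted_composition_L2[OF assms] weighted_composition_norm[OF assms] in auto)

section \<open>Bounded operators are determined by Schwartz functions\<close>

lemma bounded_operator_diff:
  assumes T: "bounded_operator T" and \<psi>: "\<psi> \<in> L2" and \<eta>: "\<eta> \<in> L2"
  shows "AE x in lborel. T (\<lambda>y. \<psi> y - \<eta> y) x = T \<psi> x - T \<eta> x"
proof -
  have "AE x in lborel. T (\<lambda>y. (-1) * \<eta> y + \<psi> y) x = (-1) * T \<eta> x + T \<psi> x"
    using assms unfolding bounded_operator_def by blast
  thus ?thesis by simp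
qed

lemma bounded_operator_integral_diff:
  assumes T: "bounded_operator T"
  obtains C where "\<And>\<psi> \<eta>. \<psi> \<in> L2 \<Longrightarrow> \<eta> \<in> L2 \<Longrightarrow>
    (LINT x|lborel. (norm (T \<psi> x - T \<eta> x))\<^sup>2) \<le> C * (LINT x|lborel. (norm (\<psi> x - \<eta> x))\<^sup>2)"
proof -
  obtain C where C: "\<And>\<psi>. \<psi> \<in> L2 \<Longrightarrow> L2_norm (T \<psi>) \<le> C * L2_norm \<psi>"
    and L2: "\<And>\<psi>. \<psi> \<in> L2 \<Longrightarrow> T \<psi> \<in> L2"
    using T unfolding bounded_operator_def by blast
  have "(LINT x|lborel. (norm (T \<psi> x - T \<eta> x))\<^sup>2) \<le> C\<^sup>2 * (LINT x|lborel. (norm (\<psi> x - \<eta> x))\<^sup>2)"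
    if \<psi>: "\<psi> \<in> L2" and \<eta>: "\<eta> \<in> L2" for \<psi> \<eta>
  proof -
    let ?d = "\<lambda>y. \<psi> y - \<eta> y"
    have d: "?d \<in> L2" by (rule L2_diff[OF \<psi> \<eta>])
    note [measurable] = L2_measurable[OF L2[OF \<psi>]] L2_measurable[OF L2[OF \<eta>]] L2_measurable[OF L2[OF d]]
    have "(LINT x|lborel. (norm (T \<psi> x - T \<eta> x))\<^sup>2) = (LINT x|lborel. (norm (T ?d x))\<^sup>2)"
    proof (rule integral_cong_AE)
      show "AE x in lborel. (norm (T \<psi> x - T \<eta> x))\<^sup>2 = (norm (T ?d x))\<^sup>2"
        using bounded_operator_diff[OF T \<psi> \<eta>] by eventually_elim simp
    qed measurable
    also have "\<dots> = (L2_norm (T ?d))\<^sup>2" unfolding L2_norm_def by (simp add: integral_nonneg_AE)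
    also have "\<dots> \<le> (C * L2_norm ?d)\<^sup>2"
      by (intro power_mono C d) (simp add: L2_norm_def integral_nonneg_AE)
    also have "\<dots> = C\<^sup>2 * (LINT x|lborel. (norm (\<psi> x - \<eta> x))\<^sup>2)"
      unfolding L2_norm_def by (simp add: power_mult_distrib integral_nonneg_AE)
    finally show ?thesis .
  qed
  thus ?thesis using that by blast
qed

lemma bounded_operator_unique:
  assumes T: "bounded_operator T" and U: "bounded_operator U"
    and eq: "\<And>s. schwartz s \<Longrightarrow> AE x in lborel. T s x = U s x" and \<psi>: "\<psi> \<in> L2"
  shows "AE x in lborel. T \<psi> x = U \<psi> x"
proof -
  obtain C where C: "\<And>\<psi> \<eta>. \<psi> \<in> L2 \<Longrightarrow> \<eta> \<in> L2 \<Longrightarrow>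
    (LINT x|lborel. (norm (T \<psi> x - T \<eta> x))\<^sup>2) \<le> C * (LINT x|lborel. (norm (\<psi> x - \<eta> x))\<^sup>2)"
    using bounded_operator_integral_diff[OF T] by blast
  obtain D where D: "\<And>\<psi> \<eta>. \<psi> \<in> L2 \<Longrightarrow> \<eta> \<in> L2 \<Longrightarrow>
    (LINT x|lborel. (norm (U \<psi> x - U \<eta> x))\<^sup>2) \<le> D * (LINT x|lborel. (norm (\<psi> x - \<eta> x))\<^sup>2)"
    using bounded_operator_integral_diff[OF U] by blast
  have L2: "T \<eta> \<in> L2" "U \<eta> \<in> L2" if "\<eta> \<in> L2" for \<eta>
    using T U that unfolding bounded_operator_def by blast+
  note [measurable] = L2_measurable[OF L2(1)[OF \<psi>]] L2_measurable[OF L2(2)[OF \<psi>]]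
  let ?I = "LINT x|lborel. (norm (T \<psi> x - U \<psi> x))\<^sup>2"
  have I0: "?I \<ge> 0" by (intro integral_nonneg_AE) auto
  have "?I \<le> 0"
  proof (rule field_le_epsilon)
    fix e :: real assume e: "e > 0"
    \<comment> \<open>The total error is at most \<open>2 |C| + 2 |D|\<close> times the squared
      distance from \<open>\<psi>\<close> to \<open>s\<close>; the summand 1 makes \<open>K\<close>
      positive so that \<open>e / K\<close> is an admissible tolerance.\<close>
    define K where "K = 2 * \<bar>C\<bar> + 2 * \<bar>D\<bar> + 1"
    have K: "K > 0" by (simp add: K_def add_nonneg_pos)
    obtain s where s: "schwartz s" "(LINT x|lborel. (norm (\<psi> x - s x))\<^sup>2) < e / K"
      using schwartz_dense_L2[OF \<psi> divide_pos_pos[OF e K]] by blast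
    let ?J = "LINT x|lborel. (norm (\<psi> x - s x))\<^sup>2"
    have J: "?J \<ge> 0" by (intro integral_nonneg_AE) auto
    have sL: "s \<in> L2" by (rule schwartz_L2[OF s(1)])
    note [measurable] = L2_measurable[OF L2(1)[OF sL]] L2_measurable[OF L2(2)[OF sL]]
    have "(LINT x|lborel. (norm (T s x - U \<psi> x))\<^sup>2) = (LINT x|lborel. (norm (U \<psi> x - U s x))\<^sup>2)"
    proof (rule integral_cong_AE)
      show "AE x in lborel. (norm (T s x - U \<psi> x))\<^sup>2 = (norm (U \<psi> x - U s x))\<^sup>2"
        using eq[OF s(1)] by eventually_elim (simp add: norm_minus_commute)
    qed measurable
    also have "\<dots> \<le> D * ?J" by (rule D[OF \<psi> sL])
    also have "\<dots> \<le> \<bar>D\<bar> * ?J" using J by (intro mult_right_mono) auto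
    finally have 1: "(LINT x|lborel. (norm (T s x - U \<psi> x))\<^sup>2) \<le> \<bar>D\<bar> * ?J" .
    have "(LINT x|lborel. (norm (T \<psi> x - T s x))\<^sup>2) \<le> C * ?J" by (rule C[OF \<psi> sL])
    also have "\<dots> \<le> \<bar>C\<bar> * ?J" using J by (intro mult_right_mono) auto
    finally have 2: "(LINT x|lborel. (norm (T \<psi> x - T s x))\<^sup>2) \<le> \<bar>C\<bar> * ?J" .
    have "?I \<le> 2 * (\<bar>C\<bar> * ?J) + 2 * (\<bar>D\<bar> * ?J)"
      using integral_norm_diff_sq_triangle[OF L2(1)[OF \<psi>] L2(1)[OF sL] L2(2)[OF \<psi>]] 1 2 by linarith
    also have "\<dots> \<le> K * ?J" using J by (simp add: K_def algebra_simps)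
    also have "\<dots> \<le> K * (e / K)" using K s(2) by (intro mult_left_mono) auto
    finally show "?I \<le> 0 + e" using K by simp
  qed
  hence "?I = 0" using I0 by simp
  hence "AE x in lborel. (norm (T \<psi> x - U \<psi> x))\<^sup>2 = 0"
    by (subst (asm) integral_nonneg_eq_0_iff_AE) (auto intro!: L2_integrable L2_diff L2 \<psi>)
  thus ?thesis by eventually_elim simp
qed

text \<open>Equality of operators on \<open>L2\<close> up to null sets. It treats the chosen
  operator \<open>Op\<close> and the explicit phase operators on the same footing.\<close>

definition acts_as :: "(('a::euclidean_space \<Rightarrow> complex) \<Rightarrow> 'a \<Rightarrow> complex) \<Rightarrow> ('a \<Rightarrow> complex) \<Rightarrow> ('a \<Rightarrow> 'a) \<Rightarrow> bool" where
  "acts_as T c P \<longleftrightarrow> bounded_operator T \<and> (\<forall>\<psi>\<in>L2. AE x in lborel. T \<psi> x = weighted_composition c P \<psi> x)"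

lemma acts_as_weighted_composition:
  assumes "volume_preserving_map P" "c \<in> borel_measurable borel" "\<And>x. norm (c x) \<le> B"
  shows "acts_as (weighted_composition c P) c P"
  unfolding acts_as_def using bounded_operator_weighted_composition[OF assms] by simp

text \<open>The weighted composition satisfies the specification inside the choice, so the chosen
  operator satisfies it too, and density forces the two to agree on all of
  \<open>L2\<close>.\<close>

lemma acts_as_Op:
  fixes f :: "real^'d \<Rightarrow> real^'d"
  assumes h: "h > 0" and a: "\<And>x \<xi>. a (x, \<xi>) = c x"
    and P: "volume_preserving_map (inv_into UNIV f)"
    and c: "c \<in> borel_measurable borel" "\<And>x. norm (c x) \<le> B"
  shows "acts_as (Op h a f) c (inv_into UNIV f)"
proof -
  let ?W = "weighted_composition c (inv_into UNIV f)"
  let ?spec = "\<lambda>T. bounded_operator T \<and> (\<forall>\<psi>. schwartz \<psi> \<longrightarrow> (AE x in lborel. T \<psi> x = osc_integral h a f \<psi> x))"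
  have W: "bounded_operator ?W" by (rule bounded_operator_weighted_composition[OF P c])
  have osc: "osc_integral h a f \<psi> x = ?W \<psi> x" if "schwartz \<psi>" for \<psi> x
    using osc_integral_schwartz[OF that h, of a x "c x" f] a by (simp add: weighted_composition_def)
  have "?spec ?W" using W osc by simp
  hence spec: "?spec (Op h a f)" unfolding Op_def by (rule someI[of ?spec])
  have "AE x in lborel. Op h a f \<psi> x = ?W \<psi> x" if "\<psi> \<in> L2" for \<psi>
    by (rule bounded_operator_unique[OF _ W _ that]) (use spec osc in auto)
  thus ?thesis using spec by (simp add: acts_as_def)
qed

lemma L2_mult_cnj_integrable:
  assumes "\<psi> \<in> L2" "\<eta> \<in> L2" shows "integrable lborel (\<lambda>x. \<psi> x * cnj (\<eta> x))"
proof (rule Bochner_Integration.integrable_bound)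
  note [measurable] = L2_measurable[OF assms(1)] L2_measurable[OF assms(2)]
  show "integrable lborel (\<lambda>x. (norm (\<psi> x))\<^sup>2 + (norm (\<eta> x))\<^sup>2)"
    by (intro Bochner_Integration.integrable_add L2_integrable assms)
  show "AE x in lborel. norm (\<psi> x * cnj (\<eta> x)) \<le> norm ((norm (\<psi> x))\<^sup>2 + (norm (\<eta> x))\<^sup>2)"
  proof (rule AE_I2)
    fix x
    have "2 * (norm (\<psi> x) * norm (\<eta> x)) \<le> (norm (\<psi> x))\<^sup>2 + (norm (\<eta> x))\<^sup>2"
      using sum_squares_bound[of "norm (\<psi> x)" "norm (\<eta> x)"] by simp
    moreover have "0 \<le> norm (\<psi> x) * norm (\<eta> x)" by simp
    ultimately have "norm (\<psi> x) * norm (\<eta> x) \<le> (norm (\<psi> x))\<^sup>2 + (norm (\<eta> x))\<^sup>2" by linarith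
    thus "norm (\<psi> x * cnj (\<eta> x)) \<le> norm ((norm (\<psi> x))\<^sup>2 + (norm (\<eta> x))\<^sup>2)" by (simp add: norm_mult)
  qed
  have "(\<lambda>x. cnj (\<eta> x)) \<in> borel_measurable borel"
    by (rule measurable_compose[OF L2_measurable[OF assms(2)] borel_measurable_continuous_onI]) (intro continuous_intros)
  thus "(\<lambda>x. \<psi> x * cnj (\<eta> x)) \<in> borel_measurable lborel" by simp
qed

lemma acts_as_inner:
  fixes T :: "('a::euclidean_space \<Rightarrow> complex) \<Rightarrow> 'a \<Rightarrow> complex"
  assumes T: "acts_as T c P" and P: "volume_preserving_map P" and c: "c \<in> borel_measurable borel"
    and \<psi>: "\<psi> \<in> L2" and \<eta>: "\<eta> \<in> L2"
  shows "L2_inner (T \<psi>) (T \<eta>) = (LINT x|lborel. of_real ((norm (c x))\<^sup>2) * (\<psi> (P x) * cnj (\<eta> (P x))))"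
proof -
  have eq: "AE x in lborel. T \<psi> x = c x * \<psi> (P x)" "AE x in lborel. T \<eta> x = c x * \<eta> (P x)"
    using T \<psi> \<eta> by (auto simp: acts_as_def weighted_composition_def)
  have "T \<psi> \<in> L2" "T \<eta> \<in> L2" using T \<psi> \<eta> by (auto simp: acts_as_def bounded_operator_def)
  note [measurable] = L2_measurable[OF this(1)] L2_measurable[OF this(2)]
  have [measurable]: "P \<in> borel \<rightarrow>\<^sub>M borel" using P by (simp add: volume_preserving_map_def)
  note [measurable] = c L2_measurable[OF \<psi>] L2_measurable[OF \<eta>]
  have [measurable]: "cnj \<in> borel_measurable borel"
    by (intro borel_measurable_continuous_onI continuous_intros)
  show ?thesis unfolding L2_inner_def
  proof (rule integral_cong_AE)
    show "AE x in lborel. T \<psi> x * cnj (T \<eta> x) = of_real ((norm (c x))\<^sup>2) * (\<psi> (P x) * cnj (\<eta> (P x)))"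
      using eq
    proof eventually_elim
      case (elim x)
      thus ?case by (simp only: complex_norm_square complex_cnj_mult mult_ac)
    qed
  qed measurable
qed

lemma unitary_operator_acts_as:
  assumes T: "acts_as T c P" and P: "volume_preserving_map P" and f: "f \<in> borel \<rightarrow>\<^sub>M borel"
    and inv: "\<And>x. f (P x) = x" "\<And>x. P (f x) = x"
    and c: "c \<in> borel_measurable borel" "\<And>x. norm (c x) = 1"
  shows "unitary_operator T"
  unfolding unitary_operator_def
proof (intro conjI ballI)
  show "bounded_operator T" using T by (simp add: acts_as_def)
  have cm: "(\<lambda>x. cnj (\<eta> x)) \<in> borel_measurable borel" if "\<eta> \<in> borel_measurable borel" for \<eta> :: "'a \<Rightarrow> complex"
    by (rule measurable_compose[OF that borel_measurable_continuous_onI]) (intro continuous_intros)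
  show "L2_inner (T \<psi>) (T \<eta>) = L2_inner \<psi> \<eta>" if "\<psi> \<in> L2" "\<eta> \<in> L2" for \<psi> \<eta>
    using volume_preserving_integral(1)[OF P borel_measurable_times[OF L2_measurable[OF that(1)] cm[OF L2_measurable[OF that(2)]]]]
    by (subst acts_as_inner[OF T P c(1) that]) (simp add: c(2) L2_inner_def)
  fix \<eta> :: "'a \<Rightarrow> complex" assume \<eta>: "\<eta> \<in> L2"
  have fv: "volume_preserving_map f" by (rule volume_preserving_inverse[OF P f inv(1)])
  \<comment> \<open>The inverse of a weighted composition with unimodular weight: \<open>P\<close>
    undoes \<open>f\<close>, and the conjugate undoes \<open>c\<close>.\<close>
  let ?\<psi> = "weighted_composition (\<lambda>y. cnj (c (f y))) f \<eta>"
  have \<psi>: "?\<psi> \<in> L2"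
  proof (rule weighted_composition_L2[OF fv _ _ \<eta>])
    show "(\<lambda>y. cnj (c (f y))) \<in> borel_measurable borel"
      by (rule cm) (rule measurable_compose[OF f c(1)])
    show "norm (cnj (c (f x))) \<le> 1" for x by (simp add: c(2))
  qed
  have "AE x in lborel. T ?\<psi> x = weighted_composition c P ?\<psi> x" using T \<psi> by (simp add: acts_as_def)
  hence "AE x in lborel. T ?\<psi> x = \<eta> x"
  proof eventually_elim
    case (elim x)
    have "c x * cnj (c x) = 1" by (simp add: c(2) complex_norm_square[symmetric])
    thus ?case unfolding elim by (simp add: weighted_composition_def inv mult.assoc[symmetric])
  qed
  thus "\<exists>\<psi>\<in>L2. AE x in lborel. T \<psi> x = \<eta> x" using \<psi> by blast
qed

text \<open>A test vector without zeros: an identity between multiples of it can be cancelled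
  pointwise.\<close>

definition gaussian :: "'a::euclidean_space \<Rightarrow> complex" where
  "gaussian x = 1 * of_real (exp (- (x \<bullet> x)))"

lemma gaussian_L2: "gaussian \<in> L2"
  unfolding gaussian_def[abs_def] by (intro schwartz_L2 gauss_poly_schwartz gauss_poly.gauss)

lemma gaussian_nonzero: "gaussian x \<noteq> 0"
  by (simp add: gaussian_def)

text \<open>Unitarity gives \<open>\<integral> (|c|\<^sup>2 - 1) \<kappa> G = 0\<close> for every \<open>\<kappa>\<close> in \<open>L\<^sup>2\<close>, where \<open>G\<close> is the Gaussian; take \<open>\<kappa> = (|c|\<^sup>2 - 1) G\<close>.\<close>

lemma unitary_operator_weight_norm:
  assumes T: "acts_as T c P" and U: "unitary_operator T"
    and P: "volume_preserving_map P" and f: "f \<in> borel \<rightarrow>\<^sub>M borel"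
    and inv: "\<And>x. f (P x) = x"
    and c: "continuous_on UNIV c" "\<And>x. norm (c x) \<le> B"
  shows "norm (c x) = 1"
proof -
  have fv: "volume_preserving_map f" by (rule volume_preserving_inverse[OF P f inv])
  have cm[measurable]: "c \<in> borel_measurable borel" by (rule borel_measurable_continuous_onI[OF c(1)])
  define q where "q x = (norm (c x))\<^sup>2 - 1" for x
  have qm[measurable]: "q \<in> borel_measurable borel" unfolding q_def by measurable
  have qb: "norm (complex_of_real (q x)) \<le> B\<^sup>2 + 1" for x
  proof -
    have "(norm (c x))\<^sup>2 \<le> B\<^sup>2" using c(2)[of x] by (intro power_mono) auto
    thus ?thesis unfolding q_def norm_of_real using zero_le_power2[of "norm (c x)"] by argo
  qed
  define \<kappa> where "\<kappa> = weighted_composition (\<lambda>x. complex_of_real (q x)) (\<lambda>x. x) gaussian"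
  have \<kappa>: "\<kappa> \<in> L2" unfolding \<kappa>_def
    by (rule weighted_composition_L2[OF volume_preserving_id _ qb gaussian_L2]) simp
  have comp: "weighted_composition (\<lambda>_. 1) f \<psi> \<in> L2" if "\<psi> \<in> L2" for \<psi>
    by (rule weighted_composition_L2[OF fv _ _ that, where B=1]) auto
  \<comment> \<open>Composition with \<open>f\<close> is inserted so that the composition with
    \<open>P\<close> in \<open>acts_as_inner\<close> restores \<open>\<kappa>\<close> and the
    Gaussian, leaving \<open>c\<close> uncomposed.\<close>
  let ?\<psi> = "weighted_composition (\<lambda>_. 1) f \<kappa>"
  let ?\<eta> = "weighted_composition (\<lambda>_. 1) f gaussian"
  have int: "integrable lborel (\<lambda>x. \<kappa> x * cnj (gaussian x))" by (rule L2_mult_cnj_integrable[OF \<kappa> gaussian_L2])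
  have "(LINT x|lborel. of_real ((norm (c x))\<^sup>2) * (\<kappa> x * cnj (gaussian x))) = L2_inner (T ?\<psi>) (T ?\<eta>)"
    by (subst acts_as_inner[OF T P cm comp[OF \<kappa>] comp[OF gaussian_L2]])
       (simp add: weighted_composition_def inv)
  also have "\<dots> = L2_inner ?\<psi> ?\<eta>"
    using U comp[OF \<kappa>] comp[OF gaussian_L2] unfolding unitary_operator_def by blast
  also have "\<dots> = (LINT x|lborel. \<kappa> (f x) * cnj (gaussian (f x)))"
    by (simp add: L2_inner_def weighted_composition_def)
  also have "\<dots> = (LINT x|lborel. \<kappa> x * cnj (gaussian x))"
    by (rule volume_preserving_integral(1)[OF fv]) (use borel_measurable_integrable[OF int] in simp)
  finally have eq: "(LINT x|lborel. of_real ((norm (c x))\<^sup>2) * (\<kappa> x * cnj (gaussian x))) = (LINT x|lborel. \<kappa> x * cnj (gaussian x))" .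
  have int2: "integrable lborel (\<lambda>x. of_real (q x) * (\<kappa> x * cnj (gaussian x)))"
  proof (rule Bochner_Integration.integrable_bound[OF integrable_mult_right[OF integrable_norm[OF int], of "B\<^sup>2 + 1"]])
    show "(\<lambda>x. of_real (q x) * (\<kappa> x * cnj (gaussian x))) \<in> borel_measurable lborel"
      using borel_measurable_integrable[OF int] by measurable
    show "AE x in lborel. norm (complex_of_real (q x) * (\<kappa> x * cnj (gaussian x))) \<le> norm ((B\<^sup>2 + 1) * norm (\<kappa> x * cnj (gaussian x)))"
    proof (rule AE_I2)
      fix x
      have "norm (complex_of_real (q x) * (\<kappa> x * cnj (gaussian x))) \<le> (B\<^sup>2 + 1) * norm (\<kappa> x * cnj (gaussian x))"
        unfolding norm_mult[of "complex_of_real (q x)"] by (intro mult_right_mono qb) auto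
      also have "\<dots> \<le> norm ((B\<^sup>2 + 1) * norm (\<kappa> x * cnj (gaussian x)))" by (simp only: real_norm_def abs_ge_self)
      finally show "norm (complex_of_real (q x) * (\<kappa> x * cnj (gaussian x))) \<le> norm ((B\<^sup>2 + 1) * norm (\<kappa> x * cnj (gaussian x)))" .
    qed
  qed
  have "of_real ((norm (c x))\<^sup>2) * (\<kappa> x * cnj (gaussian x)) = of_real (q x) * (\<kappa> x * cnj (gaussian x)) + \<kappa> x * cnj (gaussian x)" for x
    by (simp add: q_def algebra_simps)
  hence "(LINT x|lborel. of_real (q x) * (\<kappa> x * cnj (gaussian x))) = 0"
    using eq Bochner_Integration.integral_add[OF int2 int] by simp
  moreover have sq: "of_real (q x) * (\<kappa> x * cnj (gaussian x)) = complex_of_real ((q x * exp (- (x \<bullet> x)))\<^sup>2)" for x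
    by (simp add: \<kappa>_def weighted_composition_def gaussian_def power2_eq_square mult_ac)
  ultimately have "(LINT x|lborel. (q x * exp (- (x \<bullet> x)))\<^sup>2) = 0"
    by (simp only: sq integral_complex_of_real of_real_eq_0_iff)
  moreover have "integrable lborel (\<lambda>x. (q x * exp (- (x \<bullet> x)))\<^sup>2)"
    using integrable_Re[OF int2] unfolding sq by simp
  ultimately have "AE x in lborel. (q x * exp (- (x \<bullet> x)))\<^sup>2 = 0"
    by (subst (asm) integral_nonneg_eq_0_iff_AE) auto
  hence "AE x in lborel. complex_of_real (norm (c x)) = 1"
  proof eventually_elim
    case (elim x)
    hence "(norm (c x))\<^sup>2 = 1" by (simp add: q_def)
    thus ?case by (simp add: power2_eq_1_iff)  (smt (verit) norm_ge_zero)
  qed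
  hence "complex_of_real (norm (c x)) = 1"
    by (intro AE_continuous_eq[where g="\<lambda>_. 1"] continuous_intros c)
  thus ?thesis by simp
qed

section \<open>Representations by weighted compositions\<close>

text \<open>\<open>P g\<close> plays the role of the inverse diffeomorphism, hence the reversed
  order in its composition law; the weight of a product picks up the second weight evaluated along
  \<open>P g\<close>.\<close>

lemma L2_representation_acts_as:
  fixes T :: "'g \<Rightarrow> ('a::euclidean_space \<Rightarrow> complex) \<Rightarrow> 'a \<Rightarrow> complex" and G :: "('g, 'm) monoid_scheme"
  assumes G: "group G" and T: "\<And>g. g \<in> carrier G \<Longrightarrow> acts_as (T g) (c g) (P g)"
    and P: "\<And>g. g \<in> carrier G \<Longrightarrow> volume_preserving_map (P g)"
    and one: "\<And>x. c \<one>\<^bsub>G\<^esub> x = 1" "\<And>x. P \<one>\<^bsub>G\<^esub> x = x"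
    and mult: "\<And>g g' x. g \<in> carrier G \<Longrightarrow> g' \<in> carrier G \<Longrightarrow> c (g \<otimes>\<^bsub>G\<^esub> g') x = c g x * c g' (P g x)"
      "\<And>g g' x. g \<in> carrier G \<Longrightarrow> g' \<in> carrier G \<Longrightarrow> P (g \<otimes>\<^bsub>G\<^esub> g') x = P g' (P g x)"
  shows "L2_representation G T"
  unfolding L2_representation_def
proof (intro conjI ballI)
  interpret group G by (rule G)
  show "bounded_operator (T g)" if "g \<in> carrier G" for g using T[OF that] by (simp add: acts_as_def)
  show "AE x in lborel. T \<one>\<^bsub>G\<^esub> \<psi> x = \<psi> x" if "\<psi> \<in> L2" for \<psi>
    using T[OF one_closed] that by (simp add: acts_as_def weighted_composition_def one)
  fix g g' and \<psi> :: "'a \<Rightarrow> complex" assume g: "g \<in> carrier G" "g' \<in> carrier G" and \<psi>: "\<psi> \<in> L2"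
  have L2: "T g' \<psi> \<in> L2" using T[OF g(2)] \<psi> unfolding acts_as_def bounded_operator_def by blast
  have 1: "AE x in lborel. T (g \<otimes>\<^bsub>G\<^esub> g') \<psi> x = c (g \<otimes>\<^bsub>G\<^esub> g') x * \<psi> (P (g \<otimes>\<^bsub>G\<^esub> g') x)"
    using T[OF m_closed[OF g]] \<psi> by (simp add: acts_as_def weighted_composition_def)
  have 2: "AE x in lborel. T g (T g' \<psi>) x = c g x * T g' \<psi> (P g x)"
    using T[OF g(1)] L2 by (simp add: acts_as_def weighted_composition_def)
  have "AE x in lborel. T g' \<psi> x = c g' x * \<psi> (P g' x)"
    using T[OF g(2)] \<psi> by (simp add: acts_as_def weighted_composition_def)
  hence 3: "AE x in lborel. T g' \<psi> (P g x) = c g' (P g x) * \<psi> (P g' (P g x))"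
    by (rule volume_preserving_AE[OF P[OF g(1)]])
  show "AE x in lborel. T (g \<otimes>\<^bsub>G\<^esub> g') \<psi> x = T g (T g' \<psi>) x"
    using 1 2 3 by eventually_elim (simp add: mult[OF g])
qed

text \<open>Converse direction: cancelling the nowhere zero Gaussian in the representation
  identities leaves identities between weights almost everywhere, and continuity makes them
  pointwise.\<close>

lemma L2_representation_weights:
  fixes T :: "'g \<Rightarrow> ('a::euclidean_space \<Rightarrow> complex) \<Rightarrow> 'a \<Rightarrow> complex" and G :: "('g, 'm) monoid_scheme"
  assumes G: "group G" and R: "L2_representation G T"
    and T: "\<And>g. g \<in> carrier G \<Longrightarrow> acts_as (T g) (c g) (P g)"
    and P: "\<And>g. g \<in> carrier G \<Longrightarrow> volume_preserving_map (P g)"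
    and cont: "\<And>g. g \<in> carrier G \<Longrightarrow> continuous_on UNIV (c g)" "\<And>g. g \<in> carrier G \<Longrightarrow> continuous_on UNIV (P g)"
    and one: "\<And>x. P \<one>\<^bsub>G\<^esub> x = x"
    and mult: "\<And>g g' x. g \<in> carrier G \<Longrightarrow> g' \<in> carrier G \<Longrightarrow> P (g \<otimes>\<^bsub>G\<^esub> g') x = P g' (P g x)"
  shows "c \<one>\<^bsub>G\<^esub> x = 1"
    and "g \<in> carrier G \<Longrightarrow> g' \<in> carrier G \<Longrightarrow> c (g \<otimes>\<^bsub>G\<^esub> g') x = c g x * c g' (P g x)"
proof -
  interpret group G by (rule G)
  have act: "AE x in lborel. T g \<psi> x = c g x * \<psi> (P g x)" if "g \<in> carrier G" "\<psi> \<in> L2" for g \<psi>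
    using T[OF that(1)] that(2) by (simp add: acts_as_def weighted_composition_def)
  have "AE x in lborel. T \<one>\<^bsub>G\<^esub> gaussian x = gaussian x"
    using R gaussian_L2 unfolding L2_representation_def by blast
  with act[OF one_closed gaussian_L2] have "AE x in lborel. c \<one>\<^bsub>G\<^esub> x = 1"
    by eventually_elim (simp add: one gaussian_nonzero)
  thus "c \<one>\<^bsub>G\<^esub> x = 1"
    by (intro AE_continuous_eq[where g="\<lambda>_. 1"] continuous_intros cont one_closed)
  assume g: "g \<in> carrier G" "g' \<in> carrier G"
  have L2: "T g' gaussian \<in> L2" using T[OF g(2)] gaussian_L2 unfolding acts_as_def bounded_operator_def by blast
  have "AE x in lborel. T (g \<otimes>\<^bsub>G\<^esub> g') gaussian x = T g (T g' gaussian) x"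
    using R gaussian_L2 g unfolding L2_representation_def by blast
  with act[OF m_closed[OF g] gaussian_L2] act[OF g(1) L2] volume_preserving_AE[OF P[OF g(1)] act[OF g(2) gaussian_L2]]
  have "AE x in lborel. c (g \<otimes>\<^bsub>G\<^esub> g') x = c g x * c g' (P g x)"
    by eventually_elim (simp add: mult[OF g] gaussian_nonzero)
  moreover have "continuous_on UNIV (\<lambda>x. c g' (P g x))"
    by (rule continuous_on_compose2[OF cont(1)[OF g(2)] cont(2)[OF g(1)]]) auto
  ultimately show "c (g \<otimes>\<^bsub>G\<^esub> g') x = c g x * c g' (P g x)"
    by (intro AE_continuous_eq continuous_intros cont m_closed g)
qed

section \<open>Unitary systems and cocycles\<close>

declare One_nat_def [simp del]

lemma smooth_has_derivative:
  assumes "smooth f" shows "(f has_derivative frechet_derivative f (at x)) (at x)"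
proof -
  have "\<forall>vs. set vs \<subseteq> Basis \<longrightarrow> (\<forall>x. iter_deriv vs f differentiable at x)"
    using assms by (simp add: smooth_def)
  from spec[OF this, of "[]"] have "f differentiable at x" by simp
  thus ?thesis by (rule frechet_derivative_works[THEN iffD1])
qed

lemma smooth_continuous: "smooth f \<Longrightarrow> continuous_on UNIV f"
  by (intro continuous_at_imp_continuous_on ballI has_derivative_continuous[OF smooth_has_derivative])

lemma codiff_0: "codiff G \<phi> 0 b [g] h x = b [] h (inv_into UNIV (\<phi> g) x) - b [] h x"
  by (simp add: codiff_def)

lemma codiff_1: "codiff G \<phi> 1 S [g, g'] h x =
    S [g'] h (inv_into UNIV (\<phi> g) x) - S [g \<otimes>\<^bsub>G\<^esub> g'] h x + S [g] h x"
  by (simp add: codiff_def)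

lemma tuples_0: "gs \<in> tuples G 0 \<longleftrightarrow> gs = []"
  by (auto simp: tuples_def)

lemma tuples_1: "gs \<in> tuples G 1 \<longleftrightarrow> (\<exists>g\<in>carrier G. gs = [g])"
  by (auto simp: tuples_def length_Suc_conv One_nat_def)

lemma tuples_2: "gs \<in> tuples G 2 \<longleftrightarrow> (\<exists>g\<in>carrier G. \<exists>g'\<in>carrier G. gs = [g, g'])"
  by (auto simp: tuples_def length_Suc_conv numeral_2_eq_2)

lemma cochain_1_iff:
  "cochain G h0 1 S \<longleftrightarrow> (\<forall>g\<in>carrier G. S [g] \<in> phase_space h0) \<and>
     (\<one>\<^bsub>G\<^esub> \<in> carrier G \<longrightarrow> (\<forall>h\<in>{0<..h0}. \<forall>x. S [\<one>\<^bsub>G\<^esub>] h x = 0))"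
  unfolding cochain_def by (auto simp: tuples_1)

lemma phase_space_const: "(\<lambda>h x. c h) \<in> phase_space h0"
  by (simp add: phase_space_iff)

lemma phase_space_continuous:
  "S \<in> phase_space h0 \<Longrightarrow> h \<in> {0<..h0} \<Longrightarrow> continuous_on UNIV (S h)"
  unfolding phase_space_def by (auto intro: smooth_continuous)

lemma phase_space_diff_const:
  assumes "S \<in> phase_space h0" shows "(\<lambda>h x. S h x - c h) \<in> phase_space h0"
proof -
  have der: "((\<lambda>x. S h x - c h) has_derivative frechet_derivative (S h) (at x)) (at x)" if "h \<in> {0<..h0}" for h x
  proof -
    have "smooth (S h)" using assms that by (simp add: phase_space_def)
    from has_derivative_diff[OF smooth_has_derivative[OF this] has_derivative_const]
    show ?thesis by simp
  qed
  have "bounded_smooth {0<..h0} (\<lambda>h x. frechet_derivative (\<lambda>x. S h x - c h) (at x) b)" if "b \<in> Basis" for b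
  proof (rule bounded_smooth_cong)
    show "bounded_smooth {0<..h0} (\<lambda>h x. frechet_derivative (S h) (at x) b)"
      using assms that by (simp add: phase_space_iff)
  qed (simp add: frechet_derivative_at[OF der, symmetric])
  thus ?thesis using differentiableI[OF der] by (simp add: phase_space_iff)
qed

lemma exp_imag_eq_1: "exp (\<i> * of_real t) = 1 \<longleftrightarrow> (\<exists>n::int. t = 2 * pi * of_int n)"
  by (auto simp: exp_eq_1 mult_ac)

lemma cocycle_imp_mod_2pi: "cocycle G \<phi> h0 1 S \<Longrightarrow> cocycle_mod_2pi G \<phi> h0 S"
  unfolding cocycle_def cocycle_mod_2pi_def by (auto intro: exI[of _ 0])

text \<open>The exponential kills exactly the ambiguity in 2 pi times the integers, so the relation
  becomes an exact multiplicative one.\<close>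

lemma cocycle_mod_2pi_mult:
  assumes "cocycle_mod_2pi G \<phi> h0 S" "g \<in> carrier G" "g' \<in> carrier G" "h \<in> {0<..h0}"
  shows "exp (\<i> * of_real (S [g \<otimes>\<^bsub>G\<^esub> g'] h x)) =
    exp (\<i> * of_real (S [g] h x)) * exp (\<i> * of_real (S [g'] h (inv_into UNIV (\<phi> g) x)))"
proof -
  have "[g, g'] \<in> tuples G 2" using assms(2,3) by (auto simp: tuples_2)
  hence "\<exists>n::int. codiff G \<phi> 1 S [g, g'] h x = 2 * pi * of_int n"
    using assms(1,4) unfolding cocycle_mod_2pi_def by blast
  hence "exp (\<i> * of_real (codiff G \<phi> 1 S [g, g'] h x)) = 1" by (simp only: exp_imag_eq_1)
  hence "exp (\<i> * of_real (S [g'] h (inv_into UNIV (\<phi> g) x) + S [g] h x)) / exp (\<i> * of_real (S [g \<otimes>\<^bsub>G\<^esub> g'] h x)) = 1"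
    unfolding codiff_1 exp_diff[symmetric] by (simp add: algebra_simps)
  thus ?thesis by (simp add: divide_eq_1_iff distrib_left exp_add mult.commute)
qed

lemma phase_operator_eq:
  "phase_operator \<phi> S h g = weighted_composition (\<lambda>x. exp (\<i> * of_real (S [g] h x))) (inv_into UNIV (\<phi> g))"
  by (simp add: fun_eq_iff phase_operator_def weighted_composition_def)

section \<open>Systems and cocycles for a fixed action\<close>

locale vp_action = group G for G :: "('g, 'm) monoid_scheme" (structure) +
  fixes \<phi> :: "'g \<Rightarrow> real^'d \<Rightarrow> real^'d" and h0 :: real
  assumes action: "volume_preserving_action G \<phi>"
begin

definition inv_act :: "'g \<Rightarrow> real^'d \<Rightarrow> real^'d" where
  "inv_act g = inv_into UNIV (\<phi> g)"

lemma diffeo: "g \<in> carrier G \<Longrightarrow> diffeomorphism (\<phi> g)"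
  using action by (simp add: volume_preserving_action_def)

lemma inv_act_inverse:
  assumes "g \<in> carrier G" shows "\<phi> g (inv_act g x) = x" "inv_act g (\<phi> g x) = x"
  using diffeo[OF assms] by (auto simp: diffeomorphism_def inv_act_def bij_is_surj surj_f_inv_f bij_is_inj)

lemma continuous_action: "g \<in> carrier G \<Longrightarrow> continuous_on UNIV (\<phi> g)"
  and continuous_inv_act: "g \<in> carrier G \<Longrightarrow> continuous_on UNIV (inv_act g)"
  using diffeo by (auto simp: diffeomorphism_def inv_act_def intro: smooth_continuous)

lemma measurable_action: "g \<in> carrier G \<Longrightarrow> \<phi> g \<in> borel \<rightarrow>\<^sub>M borel"
  by (intro borel_measurable_continuous_onI continuous_action)

lemma volume_preserving_inv_act:
  assumes g: "g \<in> carrier G" shows "volume_preserving_map (inv_act g)"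
proof -
  have m: "inv_act g \<in> borel \<rightarrow>\<^sub>M borel" by (intro borel_measurable_continuous_onI continuous_inv_act g)
  have "smooth (\<phi> g)" using diffeo[OF g] by (simp add: diffeomorphism_def)
  hence "distr lborel borel (inv_act g) = lborel"
    using action g by (intro distr_lborel_volume_preserving[OF inv_act_inverse(1,2)[OF g] m smooth_has_derivative])
       (auto simp: volume_preserving_action_def)
  with m show ?thesis by (simp add: volume_preserving_map_def)
qed

lemma inv_act_one: "inv_act \<one> x = x"
proof -
  have "\<phi> \<one> = id" using action by (simp add: volume_preserving_action_def)
  thus ?thesis using inv_act_inverse(1)[OF one_closed, of x] by simp
qed

lemma inv_act_mult:
  assumes g: "g \<in> carrier G" "g' \<in> carrier G" shows "inv_act (g \<otimes> g') x = inv_act g' (inv_act g x)"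
proof -
  have "\<phi> (g \<otimes> g') = \<phi> g \<circ> \<phi> g'" using action g by (simp add: volume_preserving_action_def)
  hence "\<phi> (g \<otimes> g') (inv_act g' (inv_act g x)) = x" by (simp add: inv_act_inverse g)
  thus ?thesis using inv_act_inverse(2)[OF m_closed[OF g]] by metis
qed

lemma continuous_phase:
  assumes "cochain G h0 1 S" "g \<in> carrier G" "h \<in> {0<..h0}"
  shows "continuous_on UNIV (S [g] h)"
  using assms unfolding cochain_1_iff by (auto intro: phase_space_continuous)

lemma measurable_phase:
  assumes "cochain G h0 1 S" "g \<in> carrier G" "h \<in> {0<..h0}"
  shows "(\<lambda>x. exp (\<i> * complex_of_real (S [g] h x))) \<in> borel_measurable borel"
  by (intro borel_measurable_continuous_onI continuous_intros continuous_phase[OF assms])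

lemma acts_as_phase_operator:
  assumes "cochain G h0 1 S" "g \<in> carrier G" "h \<in> {0<..h0}"
  shows "acts_as (phase_operator \<phi> S h g) (\<lambda>x. exp (\<i> * of_real (S [g] h x))) (inv_act g)"
  unfolding phase_operator_eq inv_act_def[symmetric]
  by (rule acts_as_weighted_composition[OF volume_preserving_inv_act measurable_phase, where B=1])
     (use assms in auto)

lemma acts_as_Op_phase:
  assumes S: "cochain G h0 1 S" and a: "has_phase G h0 a S" and g: "g \<in> carrier G" and h: "h \<in> {0<..h0}"
  shows "acts_as (Op h (a g h) (\<phi> g)) (\<lambda>x. exp (\<i> * of_real (S [g] h x))) (inv_act g)"
  unfolding inv_act_def
  by (rule acts_as_Op[where B=1])
     (use a g h measurable_phase[OF S g h] volume_preserving_inv_act[OF g] in \<open>auto simp: has_phase_def inv_act_def\<close>)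

text \<open>Stated for any \<open>T\<close> with the given action, so that it applies both to
  \<open>Op\<close> and to \<open>phase_operator\<close>.\<close>

lemma representation_phase:
  assumes S: "cocycle_mod_2pi G \<phi> h0 S" and h: "h \<in> {0<..h0}"
    and T: "\<And>g. g \<in> carrier G \<Longrightarrow> acts_as (T g) (\<lambda>x. exp (\<i> * of_real (S [g] h x))) (inv_act g)"
  shows "L2_representation G T"
proof (rule L2_representation_acts_as[OF is_group T])
  have "cochain G h0 1 S" using S by (simp add: cocycle_mod_2pi_def)
  thus "exp (\<i> * complex_of_real (S [\<one>] h x)) = 1" for x
    using h by (simp add: cochain_1_iff)
qed (use volume_preserving_inv_act inv_act_one inv_act_mult cocycle_mod_2pi_mult[OF S _ _ h] in \<open>auto simp: inv_act_def\<close>)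

lemma unitary_G_system_of_phase:
  assumes S: "cocycle_mod_2pi G \<phi> h0 S" and a: "has_phase G h0 a S"
  shows "unitary_G_system G \<phi> h0 a" "independent_of_xi G h0 a"
proof -
  have coch: "cochain G h0 1 S" using S by (simp add: cocycle_mod_2pi_def)
  show "independent_of_xi G h0 a" using a unfolding independent_of_xi_def has_phase_def by metis
  show "unitary_G_system G \<phi> h0 a"
    unfolding unitary_G_system_def unitary_representation_def
  proof (intro conjI ballI)
    fix g assume g: "g \<in> carrier G"
    hence "S [g] \<in> phase_space h0" using coch by (simp add: cochain_1_iff)
    hence "bounded_smooth {0<..h0} (\<lambda>h (z :: (real^'d) \<times> (real^'d)). exp (\<i> * complex_of_real (S [g] h (fst z))))"
      by (rule bounded_smooth_compose_fst[OF bounded_smooth_exp_phase])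
    thus "a g \<in> symbol_class h0" unfolding symbol_class_iff
      by (rule bounded_smooth_cong) (use a g in \<open>auto simp: has_phase_def\<close>)
  next
    fix h assume h: "h \<in> {0<..h0}"
    note act = acts_as_Op_phase[OF coch a _ h]
    show "L2_representation G (\<lambda>g. Op h (a g h) (\<phi> g))" by (rule representation_phase[OF S h act])
    show "unitary_operator (Op h (a g h) (\<phi> g))" if g: "g \<in> carrier G" for g
      by (rule unitary_operator_acts_as[OF act[OF g] volume_preserving_inv_act[OF g] measurable_action[OF g]
            inv_act_inverse[OF g] measurable_phase[OF coch g h]]) simp
  qed
qed

lemma phase_of_unitary_G_system:
  assumes U: "unitary_G_system G \<phi> h0 a" and I: "independent_of_xi G h0 a"
  shows "\<exists>S. cocycle_mod_2pi G \<phi> h0 S \<and> has_phase G h0 a S"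
proof -
  define c where "c g h x = a g h (x, 0)" for g h x
  have ac: "a g h (x, \<xi>) = c g h x" if "g \<in> carrier G" "h \<in> {0<..h0}" for g h x \<xi>
    using I that unfolding independent_of_xi_def c_def by blast
  have sm: "bounded_smooth {0<..h0} (c g)" if "g \<in> carrier G" for g
    using U that unfolding unitary_G_system_def symbol_class_iff c_def[abs_def]
    by (intro bounded_smooth_slice) blast
  have cont: "continuous_on UNIV (c g h)" if "g \<in> carrier G" "h \<in> {0<..h0}" for g h
    using sm[OF that(1)] that(2) by (auto simp: bounded_smooth_def intro: smooth_continuous)
  have bdd: "\<exists>B. \<forall>h\<in>{0<..h0}. \<forall>x. norm (c g h x) \<le> B" if "g \<in> carrier G" for g
    by (rule bounded_smooth_bounded[OF sm[OF that]])
  have act: "acts_as (Op h (a g h) (\<phi> g)) (c g h) (inv_act g)" if g: "g \<in> carrier G" and h: "h \<in> {0<..h0}" for g h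
  proof -
    obtain B where "\<And>x. norm (c g h x) \<le> B" using bdd[OF g] h by blast
    thus ?thesis unfolding inv_act_def using g h ac[OF g h] volume_preserving_inv_act[OF g]
      by (intro acts_as_Op borel_measurable_continuous_onI cont) (auto simp: inv_act_def)
  qed
  have norm1: "norm (c g h x) = 1" if g: "g \<in> carrier G" and h: "h \<in> {0<..h0}" for g h x
  proof -
    obtain B where B: "\<And>x. norm (c g h x) \<le> B" using bdd[OF g] h by blast
    have "unitary_operator (Op h (a g h) (\<phi> g))"
      using U g h by (simp add: unitary_G_system_def unitary_representation_def)
    from unitary_operator_weight_norm[OF act[OF g h] this volume_preserving_inv_act[OF g] measurable_action[OF g]
        inv_act_inverse(1)[OF g] cont[OF g h] B]
    show ?thesis .
  qed
  have rep: "L2_representation G (\<lambda>g. Op h (a g h) (\<phi> g))" if "h \<in> {0<..h0}" for h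
    using U that by (simp add: unitary_G_system_def unitary_representation_def)
  note weights = L2_representation_weights[OF is_group rep act volume_preserving_inv_act cont continuous_inv_act inv_act_one inv_act_mult]
  have c1: "c \<one> h x = 1" if "h \<in> {0<..h0}" for h x
    by (rule weights(1)) (use that in auto)
  have cm: "c (g \<otimes> g') h x = c g h x * c g' h (inv_act g x)"
    if "g \<in> carrier G" "g' \<in> carrier G" "h \<in> {0<..h0}" for g g' h x
    by (rule weights(2)) (use that in auto)
  have "\<forall>g\<in>carrier G. \<exists>S. S \<in> phase_space h0 \<and> (\<forall>h\<in>{0<..h0}. \<forall>x. c g h x = exp (\<i> * of_real (S h x)))"
  proof
    fix g assume g: "g \<in> carrier G"
    show "\<exists>S. S \<in> phase_space h0 \<and> (\<forall>h\<in>{0<..h0}. \<forall>x. c g h x = exp (\<i> * of_real (S h x)))"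
    proof (rule phase_lift[OF sm[OF g]])
      show "norm (c g h x) = 1" if "h \<in> {0<..h0}" for h x by (rule norm1[OF g that])
      fix S assume "S \<in> phase_space h0" "\<And>h x. h \<in> {0<..h0} \<Longrightarrow> c g h x = exp (\<i> * of_real (S h x))"
      thus ?thesis by (intro exI[of _ S] conjI ballI allI)
    qed
  qed
  then obtain L where L: "\<And>g. g \<in> carrier G \<Longrightarrow> L g \<in> phase_space h0"
    "\<And>g h x. g \<in> carrier G \<Longrightarrow> h \<in> {0<..h0} \<Longrightarrow> c g h x = exp (\<i> * of_real (L g h x))"
    unfolding bchoice_iff by blast
  \<comment> \<open>Cochains must vanish at the unit, whereas a lift of the constant weight 1 may be
    another multiple of 2 pi. The phase at the unit is therefore reset to zero, which
    \<open>c1\<close> permits.\<close>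
  define S where "S gs = (if hd gs = \<one> then (\<lambda>h x. 0) else L (hd gs))" for gs
  have Sc: "c g h x = exp (\<i> * of_real (S [g] h x))" if "g \<in> carrier G" "h \<in> {0<..h0}" for g h x
    using L(2)[OF that, of x] c1[OF that(2), of x] by (cases "g = \<one>") (simp_all add: S_def)
  have "cochain G h0 1 S"
    unfolding cochain_1_iff using L(1) phase_space_const[of "\<lambda>_. 0" h0] by (auto simp: S_def)
  moreover have "\<exists>n::int. codiff G \<phi> 1 S gs h x = 2 * pi * of_int n"
    if gs: "gs \<in> tuples G 2" and h: "h \<in> {0<..h0}" for gs h x
  proof -
    obtain g g' where g: "gs = [g, g']" "g \<in> carrier G" "g' \<in> carrier G" using gs by (auto simp: tuples_2)
    have "exp (\<i> * of_real (codiff G \<phi> 1 S gs h x)) =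
       exp (\<i> * of_real (S [g'] h (inv_act g x))) / exp (\<i> * of_real (S [g \<otimes> g'] h x)) * exp (\<i> * of_real (S [g] h x))"
      unfolding g(1) codiff_1 inv_act_def[symmetric] by (simp add: algebra_simps exp_add exp_diff)
    also have "\<dots> = 1"
      using cm[OF g(2,3) h, of x] norm1[OF m_closed[OF g(2,3)] h, of x]
      unfolding Sc[OF g(2) h] Sc[OF g(3) h] Sc[OF m_closed[OF g(2,3)] h] by (simp add: mult.commute)
    finally show ?thesis by (simp only: exp_imag_eq_1)
  qed
  ultimately have "cocycle_mod_2pi G \<phi> h0 S" unfolding cocycle_mod_2pi_def by blast
  moreover have "has_phase G h0 a S" using ac Sc by (simp add: has_phase_def)
  ultimately show ?thesis by blast
qed

text \<open>The defect of a cocycle mod \<open>2 \<pi>\<close> is integer-valued and continuous, hence constant on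
  \<open>\<real>\<^sup>d\<close>; it is an integral 2-cocycle of \<open>G\<close>.\<close>

lemma integral_defect:
  assumes S: "cocycle_mod_2pi G \<phi> h0 S" and h: "h \<in> {0<..h0}"
  obtains k :: "'g \<Rightarrow> 'g \<Rightarrow> int" where
    "\<And>g g' x. g \<in> carrier G \<Longrightarrow> g' \<in> carrier G \<Longrightarrow>
       S [g'] h (inv_act g x) - S [g \<otimes> g'] h x + S [g] h x = 2 * pi * of_int (k g g')"
proof -
  have coch: "cochain G h0 1 S" using S by (simp add: cocycle_mod_2pi_def)
  have "\<exists>n::int. \<forall>x. S [g'] h (inv_act g x) - S [g \<otimes> g'] h x + S [g] h x = 2 * pi * of_int n"
    if g: "g \<in> carrier G" "g' \<in> carrier G" for g g'
  proof -
    define F where "F x = (S [g'] h (inv_act g x) - S [g \<otimes> g'] h x + S [g] h x) / (2 * pi)" for x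
    have FZ: "F x \<in> \<int>" for x
    proof -
      have "[g, g'] \<in> tuples G 2" using g by (auto simp: tuples_2)
      then obtain n :: int where "codiff G \<phi> 1 S [g, g'] h x = 2 * pi * of_int n"
        using S h unfolding cocycle_mod_2pi_def by blast
      hence "F x = of_int n" unfolding F_def inv_act_def codiff_1 by simp
      thus ?thesis by simp
    qed
    hence "range F \<subseteq> \<int>" by auto
    moreover have "continuous_on UNIV F"
      unfolding F_def
      by (intro continuous_intros continuous_on_compose2[OF continuous_phase[OF coch g(2) h] continuous_inv_act[OF g(1)]]
          continuous_phase[OF coch _ h] m_closed g) auto
    moreover have "1 \<le> norm (F y - F x)" if "F y \<noteq> F x" for x y
      using Ints_nonzero_abs_ge1[OF Ints_diff[OF FZ FZ]] that by simp
    ultimately have "F constant_on UNIV"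
      by (intro continuous_discrete_range_constant[OF connected_UNIV]) (auto intro!: exI[of _ 1])
    then obtain y where y: "\<And>x. F x = y" by (auto simp: constant_on_def)
    have "y \<in> \<int>" using \<open>range F \<subseteq> \<int>\<close> y by auto
    then obtain n :: int where "y = of_int n" by (auto elim: Ints_cases)
    thus ?thesis using y by (intro exI[of _ n]) (simp add: F_def field_simps)
  qed
  hence "\<forall>g. \<forall>g'. \<exists>n::int. g \<in> carrier G \<longrightarrow> g' \<in> carrier G \<longrightarrow>
     (\<forall>x. S [g'] h (inv_act g x) - S [g \<otimes> g'] h x + S [g] h x = 2 * pi * of_int n)" by blast
  then obtain k :: "'g \<Rightarrow> 'g \<Rightarrow> int" where "\<And>g g' x. g \<in> carrier G \<Longrightarrow> g' \<in> carrier G \<Longrightarrow>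
       S [g'] h (inv_act g x) - S [g \<otimes> g'] h x + S [g] h x = 2 * pi * of_int (k g g')"
    unfolding choice_iff by blast
  thus ?thesis using that by blast
qed

text \<open>If the integral defect is the coboundary of \<open>n\<close>, subtracting
  \<open>2 pi n\<close> from the phases removes it and preserves their exponentials. The choice of
  \<open>n\<close> depends on \<open>h\<close> without any bound, but constants in \<open>x\<close>
  do not affect the conditions of \<open>phase_space\<close>.\<close>

lemma cocycle_of_mod_2pi:
  assumes H2: "integral_H2_vanishes G" and S: "cocycle_mod_2pi G \<phi> h0 S" and a: "has_phase G h0 a S"
  shows "\<exists>S'. cocycle G \<phi> h0 1 S' \<and> has_phase G h0 a S'"
proof -
  have coch: "cochain G h0 1 S" using S by (simp add: cocycle_mod_2pi_def)
  have "\<exists>n :: 'g \<Rightarrow> int. \<forall>g\<in>carrier G. \<forall>g'\<in>carrier G. \<forall>x.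
     S [g'] h (inv_act g x) - S [g \<otimes> g'] h x + S [g] h x = 2 * pi * of_int (n g' - n (g \<otimes> g') + n g)"
    if h: "h \<in> {0<..h0}" for h
  proof -
    obtain k :: "'g \<Rightarrow> 'g \<Rightarrow> int" where k: "\<And>g g' x. g \<in> carrier G \<Longrightarrow> g' \<in> carrier G \<Longrightarrow>
       S [g'] h (inv_act g x) - S [g \<otimes> g'] h x + S [g] h x = 2 * pi * of_int (k g g')"
      using integral_defect[OF S h] by blast
    have "k g2 g3 - k (g1 \<otimes> g2) g3 + k g1 (g2 \<otimes> g3) - k g1 g2 = 0"
      if g: "g1 \<in> carrier G" "g2 \<in> carrier G" "g3 \<in> carrier G" for g1 g2 g3
    proof -
      have "2 * pi * real_of_int (k g2 g3 - k (g1 \<otimes> g2) g3 + k g1 (g2 \<otimes> g3) - k g1 g2) =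
        2 * pi * of_int (k g2 g3) - 2 * pi * of_int (k (g1 \<otimes> g2) g3) + 2 * pi * of_int (k g1 (g2 \<otimes> g3)) - 2 * pi * of_int (k g1 g2)"
        by (simp add: algebra_simps)
      also have "\<dots> = 0"
        \<comment> \<open>The four defect formulas telescope when the one for
          \<open>(g2, g3)\<close> is taken at the point moved by \<open>g1\<close>. This is
          legitimate because the defect does not depend on the point.\<close>
        using k[OF g(2,3), of "inv_act g1 0"] k[OF m_closed[OF g(1,2)] g(3), of 0]
          k[OF g(1) m_closed[OF g(2,3)], of 0] k[OF g(1,2), of 0]
        by (simp add: inv_act_mult[OF g(1,2)] m_assoc[OF g])
      finally have "real_of_int (k g2 g3 - k (g1 \<otimes> g2) g3 + k g1 (g2 \<otimes> g3) - k g1 g2) = 0"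
        by (simp only: mult_eq_0_iff) simp
      thus ?thesis by (simp only: of_int_eq_0_iff)
    qed
    hence "\<forall>g1\<in>carrier G. \<forall>g2\<in>carrier G. \<forall>g3\<in>carrier G.
        k g2 g3 - k (g1 \<otimes> g2) g3 + k g1 (g2 \<otimes> g3) - k g1 g2 = 0"
      by (intro ballI)
    hence "\<exists>n :: 'g \<Rightarrow> int. \<forall>g\<in>carrier G. \<forall>g'\<in>carrier G. k g g' = n g' - n (g \<otimes> g') + n g"
      by (rule mp[OF spec[OF H2[unfolded integral_H2_vanishes_def], of k]])
    then obtain n :: "'g \<Rightarrow> int" where
      n: "\<And>g g'. g \<in> carrier G \<Longrightarrow> g' \<in> carrier G \<Longrightarrow> k g g' = n g' - n (g \<otimes> g') + n g" by blast
    show ?thesis by (intro exI[of _ n] ballI allI) (simp only: k n)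
  qed
  hence "\<exists>n. \<forall>h\<in>{0<..h0}. \<forall>g\<in>carrier G. \<forall>g'\<in>carrier G. \<forall>x.
     S [g'] h (inv_act g x) - S [g \<otimes> g'] h x + S [g] h x = 2 * pi * of_int (n h g' - n h (g \<otimes> g') + n h g :: int)"
    by (intro bchoice ballI)
  then obtain n :: "real \<Rightarrow> 'g \<Rightarrow> int" where n: "\<And>h g g' x. h \<in> {0<..h0} \<Longrightarrow> g \<in> carrier G \<Longrightarrow> g' \<in> carrier G \<Longrightarrow>
     S [g'] h (inv_act g x) - S [g \<otimes> g'] h x + S [g] h x = 2 * pi * of_int (n h g' - n h (g \<otimes> g') + n h g)"
    by blast
  define S' where "S' gs h x = S gs h x - 2 * pi * of_int (n h (hd gs))" for gs h x
  \<comment> \<open>At the pair of units the defect is the phase of the unit, which is zero, while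
    the right-hand side is \<open>2 pi n h \<one>\<close>. So the correction respects the
    normalization of cochains.\<close>
  have n1: "n h \<one> = 0" if "h \<in> {0<..h0}" for h
    using n[OF that one_closed one_closed, of 0] coch that by (simp add: cochain_1_iff inv_act_one)
  have "S' [g] \<in> phase_space h0" if "g \<in> carrier G" for g
    using phase_space_diff_const[of "S [g]" h0 "\<lambda>h. 2 * pi * of_int (n h g)"] coch that
    by (simp add: S'_def[abs_def] cochain_1_iff)
  moreover have "S' [\<one>] h x = 0" if "h \<in> {0<..h0}" for h x
    using n1[OF that] coch that by (simp add: S'_def cochain_1_iff)
  ultimately have "cochain G h0 1 S'" by (simp add: cochain_1_iff)
  moreover have "codiff G \<phi> 1 S' gs h x = 0" if gs: "gs \<in> tuples G 2" and h: "h \<in> {0<..h0}" for gs h x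
  proof -
    obtain g g' where g: "gs = [g, g']" "g \<in> carrier G" "g' \<in> carrier G" using gs by (auto simp: tuples_2)
    show ?thesis using n[OF h g(2,3), of x]
      by (simp add: g(1) codiff_1 S'_def algebra_simps flip: inv_act_def)
  qed
  ultimately have "cocycle G \<phi> h0 1 S'" by (simp add: cocycle_def one_add_one del: One_nat_def)
  moreover have "has_phase G h0 a S'"
  proof -
    have "exp (\<i> * complex_of_real (S' [g] h x)) = exp (\<i> * complex_of_real (S [g] h x))" for g h x
    proof -
      have "exp (\<i> * complex_of_real (2 * pi * of_int (n h g))) = 1" unfolding exp_imag_eq_1 by blast
      thus ?thesis by (simp add: S'_def right_diff_distrib exp_diff)
    qed
    thus ?thesis using a by (simp add: has_phase_def)
  qed
  ultimately show ?thesis by blast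
qed

lemma equivalent_of_cohomologous:
  assumes S: "cocycle G \<phi> h0 1 S" and S': "cocycle G \<phi> h0 1 S'" and coh: "cohomologous G \<phi> h0 1 S S'"
    and h: "h \<in> {0<..h0}"
  shows "equivalent_representations G (phase_operator \<phi> S h) (phase_operator \<phi> S' h)"
proof -
  obtain b where b: "cochain G h0 0 b" and
    eq: "\<And>gs h x. gs \<in> tuples G 1 \<Longrightarrow> h \<in> {0<..h0} \<Longrightarrow> S gs h x - S' gs h x = codiff G \<phi> 0 b gs h x"
    using coh unfolding cohomologous_def by auto
  define u where "u = b [] h"
  have "b [] \<in> phase_space h0" using b by (simp add: cochain_def tuples_0)
  hence uc: "continuous_on UNIV u" unfolding u_def by (rule phase_space_continuous[OF _ h])
  have Su: "S [g] h x - S' [g] h x = u (inv_act g x) - u x" if "g \<in> carrier G" for g x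
    using eq[of "[g]" h x] that h by (auto simp: tuples_1 codiff_0 u_def inv_act_def simp del: One_nat_def)
  \<comment> \<open>The real parameter \<open>s\<close> covers the intertwiner
    (\<open>s = 1\<close>) and its inverse (\<open>s = -1\<close>). Although \<open>u\<close> may be
    unbounded, the multiplier has modulus one.\<close>
  define V where "V s = weighted_composition (\<lambda>x. exp (\<i> * complex_of_real (s * u x))) (\<lambda>x. x)" for s
  have V: "bounded_operator (V s)" for s
    unfolding V_def
    by (intro bounded_operator_weighted_composition[OF volume_preserving_id _, where B=1]
         borel_measurable_continuous_onI continuous_intros uc) auto
  have rep: "L2_representation G (phase_operator \<phi> R h)" if "cocycle G \<phi> h0 1 R" for R
  proof (rule representation_phase[OF cocycle_imp_mod_2pi[OF that] h])
    have "cochain G h0 1 R" using that by (simp add: cocycle_def)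
    thus "g \<in> carrier G \<Longrightarrow> acts_as (phase_operator \<phi> R h g) (\<lambda>x. exp (\<i> * of_real (R [g] h x))) (inv_act g)" for g
      by (rule acts_as_phase_operator[OF _ _ h])
  qed
  have inv: "V s (V (- s) \<psi>) x = \<psi> x" for s \<psi> x
    by (simp add: V_def weighted_composition_def mult.assoc[symmetric] flip: exp_add)
  have "V 1 (phase_operator \<phi> S h g \<psi>) x = phase_operator \<phi> S' h g (V 1 \<psi>) x" if g: "g \<in> carrier G" for g \<psi> x
  proof -
    have "u x + S [g] h x = S' [g] h x + u (inv_act g x)" using Su[OF g, of x] by simp
    hence "exp (\<i> * complex_of_real (u x + S [g] h x)) = exp (\<i> * complex_of_real (S' [g] h x + u (inv_act g x)))"
      by simp
    hence "exp (\<i> * complex_of_real (u x)) * exp (\<i> * complex_of_real (S [g] h x)) =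
       exp (\<i> * complex_of_real (S' [g] h x)) * exp (\<i> * complex_of_real (u (inv_act g x)))"
      by (simp add: distrib_left exp_add)
    thus ?thesis by (simp add: V_def phase_operator_eq weighted_composition_def mult.assoc[symmetric] flip: inv_act_def)
  qed
  thus ?thesis
    unfolding equivalent_representations_def
    using rep[OF S] rep[OF S'] V inv[of 1] inv[of "-1"]
    by (intro conjI exI[of _ "V 1"] exI[of _ "V (- 1)"]) auto
qed

end

theorem theorem14:
  fixes G :: "('g, 'm) monoid_scheme"
    and \<phi> :: "'g \<Rightarrow> real^'d \<Rightarrow> real^'d"
    and h0 :: real
  assumes "group G"
    and "volume_preserving_action G \<phi>"
    and "h0 > 0"
  shows
    "(\<forall>a. unitary_G_system G \<phi> h0 a \<and> independent_of_xi G h0 a \<longleftrightarrow>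
        (\<exists>S. cocycle_mod_2pi G \<phi> h0 S \<and> has_phase G h0 a S)) \<and>
     (\<forall>a S. cocycle G \<phi> h0 1 S \<and> has_phase G h0 a S \<longrightarrow>
        unitary_G_system G \<phi> h0 a \<and> independent_of_xi G h0 a) \<and>
     (integral_H2_vanishes G \<longrightarrow>
       (\<forall>a. unitary_G_system G \<phi> h0 a \<and> independent_of_xi G h0 a \<longleftrightarrow>
          (\<exists>S. cocycle G \<phi> h0 1 S \<and> has_phase G h0 a S))) \<and>
     (\<forall>a S. cocycle_mod_2pi G \<phi> h0 S \<and> has_phase G h0 a S \<longrightarrow>
        (\<forall>h\<in>{0<..h0}. \<forall>g\<in>carrier G. \<forall>\<psi>\<in>L2.
           AE x in lborel. Op h (a g h) (\<phi> g) \<psi> x = phase_operator \<phi> S h g \<psi> x)) \<and>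
     (\<forall>S S'. cocycle G \<phi> h0 1 S \<and> cocycle G \<phi> h0 1 S' \<and> cohomologous G \<phi> h0 1 S S' \<longrightarrow>
        (\<forall>h\<in>{0<..h0}.
           equivalent_representations G (phase_operator \<phi> S h) (phase_operator \<phi> S' h))) \<and>
     (cohomology_vanishes G \<phi> h0 1 \<longrightarrow>
        (\<forall>S. cocycle G \<phi> h0 1 S \<longrightarrow>
          (\<forall>h\<in>{0<..h0}.
             equivalent_representations G (phase_operator \<phi> S h) (trivial_quantization \<phi>))))"
proof -
  interpret vp_action G \<phi> h0
    using assms(1,2) by (simp add: vp_action_def vp_action_axioms_def)
  have iff: "unitary_G_system G \<phi> h0 a \<and> independent_of_xi G h0 a \<longleftrightarrow>
        (\<exists>S. cocycle_mod_2pi G \<phi> h0 S \<and> has_phase G h0 a S)" for a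
    using unitary_G_system_of_phase phase_of_unitary_G_system by blast
  have op: "AE x in lborel. Op h (a g h) (\<phi> g) \<psi> x = phase_operator \<phi> S h g \<psi> x"
    if "cocycle_mod_2pi G \<phi> h0 S" "has_phase G h0 a S" "h \<in> {0<..h0}" "g \<in> carrier G" "\<psi> \<in> L2" for a S h g \<psi>
    using acts_as_Op_phase[OF _ that(2,4,3)] that(1,5)
    by (simp add: acts_as_def cocycle_mod_2pi_def phase_operator_eq inv_act_def)
  \<comment> \<open>The trivial quantization is the phase operator of the zero cocycle, so the
    vanishing case is an instance of the claim on cohomologous cocycles.\<close>
  have zero: "cocycle G \<phi> h0 1 (\<lambda>_ _ _. 0)"
  proof -
    have "(\<lambda>_ _. 0) \<in> (phase_space h0 :: (real \<Rightarrow> real^'d \<Rightarrow> real) set)" by (rule phase_space_const)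
    thus ?thesis by (simp add: cocycle_def cochain_def codiff_def)
  qed
  have triv: "phase_operator \<phi> (\<lambda>_ _ _. 0) h = trivial_quantization \<phi>" for h
    by (simp add: fun_eq_iff phase_operator_def trivial_quantization_def)
  have van: "equivalent_representations G (phase_operator \<phi> S h) (trivial_quantization \<phi>)"
    if "cohomology_vanishes G \<phi> h0 1" "cocycle G \<phi> h0 1 S" "h \<in> {0<..h0}" for S h
    using equivalent_of_cohomologous[OF that(2) zero _ that(3)] that(1,2)
    unfolding cohomology_vanishes_def triv by blast
  show ?thesis
  proof (intro conjI allI impI ballI)
    show "unitary_G_system G \<phi> h0 a \<and> independent_of_xi G h0 a \<longleftrightarrow>
        (\<exists>S. cocycle_mod_2pi G \<phi> h0 S \<and> has_phase G h0 a S)" for a by (rule iff)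
    show "unitary_G_system G \<phi> h0 a" "independent_of_xi G h0 a"
      if "cocycle G \<phi> h0 1 S \<and> has_phase G h0 a S" for a S
      using iff cocycle_imp_mod_2pi that by blast+
    show "unitary_G_system G \<phi> h0 a \<and> independent_of_xi G h0 a \<longleftrightarrow>
          (\<exists>S. cocycle G \<phi> h0 1 S \<and> has_phase G h0 a S)" if "integral_H2_vanishes G" for a
      using iff cocycle_imp_mod_2pi cocycle_of_mod_2pi[OF that] by blast
  qed (use op equivalent_of_cohomologous van in blast)+
qed

end
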